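(* Let $0\le d\le n$ be integers. (1) Let $K$ be a field and $B=K^{\mathrm{mon}}$. Then the canonical isomorphism $\bigwedge^dK^n\simeq(\bigwedge^dB^n)^{\mathrm{hull},+}$ ($e_I\leftrightarrow$ class of $e_I$) induces a bijection between $K$-matroids of rank $d$ on $[n]$ (in the sense of Baker-Bowler) and $B$-matroids of rank $d$ on $[n]$. (2) Let $S$ be an idempotent semifield and $B=S^{\mathrm{mon}}$. Then the canonical isomorphism $\bigwedge^dS^n\simeq(\bigwedge^dB^n)^{\mathrm{idem},+}$ ($e_I\leftrightarrow$ class of $e_I$) induces a bijection between rank $d$ tropical $S$-Plücker vectors in $\bigwedge^dS^n$ and Grassmann-Plücker functions of rank $d$ on $[n]$ with coefficients in $B$. (3) Let $B$ be an $\mathbb F_1^\pm$-algebra. Then there is a canonical bijection between $B$-matroids of rank $d$ on $[n]$ and $B^\times$-classes of rank $d$ $B$-Plücker vectors in $\bigwedge^dB^n$ (the class of $\sum_Iv_Ie_I$ corresponding to the class of $\Delta: I\mapsto v_I$).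
   Context: **Ordered blueprints.** Semirings are commutative with $0$ and $1$ unless otherwise stated. An ordered semiring is a semiring with a partial order compatible with addition and multiplication. An ordered blueprint is $B=(B^\bullet,B^+,\le)$ where $(B^+,\le)$ is an ordered semiring and $B^\bullet\subseteq B^+$ is a multiplicative submonoid containing $0$ and $1$ such that every element of $B^+$ is a finite sum of elements of $B^\bullet$; $B^\times$ is the group of invertible elements of $B^\bullet$. An $\mathbb{F}_1^{\pm}$-algebra is an ordered blueprint $B$ with a distinguished $\epsilon\in B^\bullet$ such that $\epsilon^2=1$ and $0\le 1+\epsilon$. If $\mathfrak r$ is a preorder on $B^+$ compatible with addition and multiplication and containing $\le$, the quotient $B/\!\!/\mathfrak r$ has ambient semiring $B^+$ modulo "$x\le_{\mathfrak r}y$ and $y\le_{\mathfrak r}x$", the induced partial order, and underlying monoid the image of $B^\bullet$; $B/\!\!/\langle H\rangle$ is the quotient by the smallest such preorder containing $H$ ($a\equiv b$ means $a\le b$ and $b\le a$). **Monomial blueprints.** For a pointed monoid $D$ with absorbing element $0_D$, let $\widetilde D=\mathbb N[D]/\langle 0\equiv 1.0_D\rangle$ and $D/\!\!/\langle H\rangle:=(D,\widetilde D,=)/\!\!/\langle H\rangle$. For a ring $R$ with multiplicative monoid $R^\bullet$, $R^{\mathrm{mon}}=R^\bullet/\!\!/\langle 1.b\le\sum 1.a_i \mid b=\sum a_i\text{ in }R\rangle$, with $\epsilon=1.(-1)$. An idempotent semifield is a semiring $S$ with $0\neq1$, $1+1=1$ and every non-zero element invertible; $S^{\mathrm{mon}}=S^\bullet/\!\!/\langle\Omega_S\rangle$,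 where $\Omega_S$ is the set of relations $1.b\le\sum_{i=1}^m1.a_i$ such that $\sum_{i=1}^m a_i=b+\sum_{i\ne k}a_i$ in $S$ for every $k\in\{1,\dots,m\}$; here $\epsilon=1.1$. **$B$-modules.** A $B$-module is $M=(M^\bullet,M^+,\le)$ where $M^+$ is a $B^+$-(semi)module, $\le$ is a partial order on $M^+$ compatible with addition and such that $b_1\le b_2$, $m_1\le m_2$ imply $b_1m_1\le b_2m_2$, and $M^\bullet\subseteq M^+$ contains $0$, is stable under $B^\bullet$, and generates $M^+$ as a semigroup. An additive $B$-preorder on $M$ is a preorder $\mathfrak r$ on $M^+$ compatible with addition, containing $\le$, with $b_1m_1\le_{\mathfrak r}b_2m_2$ whenever $b_1\le b_2$ and $m_1\le_{\mathfrak r}m_2$; the quotient is $M^+$ modulo "$x\le_{\mathfrak r}y$ and $y\le_{\mathfrak r}x$", with induced order. $M^{\mathrm{hull}}$ is the quotient by the smallest additive $B$-preorder containing all $(x,y)$ with $x\le y$ or $y\le x$; $M^{\mathrm{idem}}$ is the quotient by the smallest one containing $(m,m+m)$ and $(m+m,m)$ for all $m$. The superscript "$,+$" means the ambient module of the result. $(K^{\mathrm{mon}})^{\mathrm{hull},+}\cong K$ and $(S^{\mathrm{mon}})^{\mathrm{idem},+}\cong S$ via class of $1.a\leftrightarrow a$ (hull and idem of a blueprint being the quotients by $\langle a\equiv b\mid a\le b\rangle$ and $\langle1\equiv1+1\rangle$), giving the $K$- and $S$-module structures. **Exterior powers.** $B^n=((B^\bullet)^n,(B^+)^n,\le)$ has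 the coordinatewise order and canonical basis $e_1,\dots,e_n$; $[n]=\{1,\dots,n\}$, and $\binom{[n]}{d}$ is the set of $d$-subsets of $[n]$ (empty if $d<0$ or $d>n$). $M_1\otimes_BM_2$: on the semimodule tensor product $M_1^+\otimes_{B^+}M_2^+$ (universal for $B^+$-bilinear maps), take the smallest preorder compatible with addition and with the action of $(B^+,\le)$ containing $x_1\otimes y_1\le x_2\otimes y_2$ whenever $x_1\le x_2$, $y_1\le y_2$, and pass to the quotient by the associated equivalence with induced order; the underlying set consists of classes of $m_1\otimes m_2$, $m_i\in M_i^\bullet$. $T(B^n)=\bigoplus_{l\ge0}(B^n)^{\otimes l}$ with componentwise order, a $B$-algebra under concatenation. Let $\tau_n=\{e_i\otimes e_i\equiv0\}\cup\{e_i\otimes e_j\equiv\epsilon\,e_j\otimes e_i: i\neq j\}$, and let $A_n$ be the quotient of $T(B^n)^+$ by the equivalence associated to the smallest preorder compatible with addition and left and right multiplication, containing the order of $T(B^n)$ and the relations $\tau_n$ in both directions, with induced order. For $I=\{i_1<\dots<i_d\}$, $e_I$ is the class of $e_{i_1}\otimes\dots\otimes e_{i_d}$. Let $H_{d,n}=\{\sum_{I\in\binom{[n]}{d}}b_Ie_I: b_I\in B^\bullet\}$ and let $S_{d,n}$ be the $B^+$-submodule it generates; $\bigwedge^dB^n=(H_{d,n},S_{d,n},\le)$ with induced order. The $e_I$, $I\in\binom{[n]}{d}$, form a $B^+$-basis of $S_{d,n}$. For an idempotent semifield $S$, $\bigwedge^dS^n$ is the degree-$d$ part of $\bigwedge S^n=\mathrm{Sym}(S^n)/\langle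 e_i^2\equiv0: i\in[n]\rangle$; it is free on the $e_I=e_{i_1}\cdots e_{i_d}$. For a field $K$, $\bigwedge^dK^n$ is the usual exterior power. **$B$-matroids.** A Grassmann-Plücker function of rank $d$ on $[n]$ with coefficients in an $\mathbb F_1^\pm$-algebra $B$ is a function $\Delta:\binom{[n]}{d}\to B^\bullet$ with $\Delta(J)\in B^\times$ for some $J$ and $$\sum_{k:\,i_k\notin X}\epsilon^{k}\,\Delta(X\cup\{i_k\})\,\Delta(Y\setminus\{i_k\})\ge0\quad\text{in }B^+$$ for all $X\in\binom{[n]}{d-1}$ and $Y=\{i_1<\dots<i_{d+1}\}\in\binom{[n]}{d+1}$. $\Delta\sim\Delta'$ if $\Delta=a\Delta'$ for some $a\in B^\times$. A $B$-matroid of rank $d$ on $[n]$ is an equivalence class of Grassmann-Plücker functions. **$B$-Plücker vectors.** A rank $d$ $B$-Plücker vector is a $v=\sum_{I\in\binom{[n]}{d}}v_Ie_I\in H_{d,n}$ with $v_I\in B^\bullet$, some $v_J\in B^\times$, and $\sum_{k:\,i_k\notin X}\epsilon^{k}v_{X\cup\{i_k\}}v_{Y\setminus\{i_k\}}\ge0$ in $B^+$ for all $X\in\binom{[n]}{d-1}$ and $Y=\{i_1<\dots<i_{d+1}\}\in\binom{[n]}{d+1}$. $B^\times$ acts on these by multiplication. **$K$-matroids (Baker-Bowler).** For a field $K$, a $K$-matroid of rank $d$ on $[n]$ is a $K^\times$-class of Grassmann-Plücker functions over $K$, i.e. functions $p:[n]^d\to K$ that are not identically zero, alternating, and satisfy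 $\sum_{k=1}^{d+1}(-1)^kp(y_1,\dots,\widehat{y_k},\dots,y_{d+1})\,p(y_k,x_1,\dots,x_{d-1})=0$ for all $x_i,y_j\in[n]$ (for $d=0$ this condition is void). Such $p$ is determined by the values $p_I=p(i_1,\dots,i_d)$ for $I=\{i_1<\dots<i_d\}$. **Tropical Plücker vectors.** For an idempotent semifield $S$, a rank $d$ tropical $S$-Plücker vector is a non-zero $v=\sum_Iv_Ie_I\in\bigwedge^dS^n$ such that for all $A\in\binom{[n]}{d+1}$, $X\in\binom{[n]}{d-1}$ and $p\in A\setminus X$, $\sum_{i\in A\setminus X}v_{A\setminus\{i\}}v_{X\cup\{i\}}=\sum_{i\in A\setminus X,\,i\ne p}v_{A\setminus\{i\}}v_{X\cup\{i\}}$ in $S$.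
   Formalization: In the Grassmann-Plücker and B-Plücker relations the exponent of ε is k plus the number of x in X with x < i_k instead of k (with k alone, (1) fails for d=2, n=3, K=Q), and Ω_S only contains relations with m ≥ 1 (m = 0 would collapse S^mon). *)

theory Defs
  imports "HOL-Algebra.Ring" "HOL-Library.Multiset" "HOL-Library.FuncSet"
    "HOL-Combinatorics.Permutations"
begin

hide_const (open) Multiset.mult

section \<open>Ordered blueprints\<close>

text \<open>The fields inherited from \<open>ring\<close> describe the ambient semiring \<open>B\<^sup>+\<close>; \<open>und\<close> is the
  underlying monoid.\<close>

record 'a blueprint = "'a ring" +
  leq :: "'a \<Rightarrow> 'a \<Rightarrow> bool" (infixl \<open>\<preceq>\<index>\<close> 50)
  und :: "'a set"

locale ordered_semiring = semiring R + comm_monoid R for R (structure) +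
  assumes leq_refl: "x \<in> carrier R \<Longrightarrow> x \<preceq> x"
    and leq_antisym:
      "\<lbrakk>x \<in> carrier R; y \<in> carrier R; x \<preceq> y; y \<preceq> x\<rbrakk> \<Longrightarrow> x = y"
    and leq_trans:
      "\<lbrakk>x \<in> carrier R; y \<in> carrier R; z \<in> carrier R; x \<preceq> y; y \<preceq> z\<rbrakk> \<Longrightarrow> x \<preceq> z"
    and leq_add:
      "\<lbrakk>x \<in> carrier R; y \<in> carrier R; z \<in> carrier R; x \<preceq> y\<rbrakk> \<Longrightarrow> x \<oplus> z \<preceq> y \<oplus> z"
    and leq_mult:
      "\<lbrakk>x \<in> carrier R; y \<in> carrier R; z \<in> carrier R; x \<preceq> y\<rbrakk> \<Longrightarrow> x \<otimes> z \<preceq> y \<otimes> z"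

locale ordered_blueprint = ordered_semiring B for B (structure) +
  assumes und_subset: "und B \<subseteq> carrier B"
    and zero_und: "\<zero> \<in> und B"
    and one_und: "\<one> \<in> und B"
    and mult_und: "\<lbrakk>x \<in> und B; y \<in> und B\<rbrakk> \<Longrightarrow> x \<otimes> y \<in> und B"
    and und_generates: "x \<in> carrier B \<Longrightarrow> \<exists>xs. set xs \<subseteq> und B \<and> x = foldr (\<oplus>) xs \<zero>"

locale f1pm_algebra = ordered_blueprint B for B (structure) +
  fixes \<epsilon>
  assumes eps_und: "\<epsilon> \<in> und B"
    and eps_square: "\<epsilon> \<otimes> \<epsilon> = \<one>"
    and eps_leq: "\<zero> \<preceq> \<one> \<oplus> \<epsilon>"

definition bp_units :: "('a, 'z) blueprint_scheme \<Rightarrow> 'a set" where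
  "bp_units B = Units (B\<lparr>carrier := und B\<rparr>)"

text \<open>\<open>alg_le R H\<close> is the smallest preorder on the carrier of \<open>R\<close> that is compatible with addition
  and with left and right multiplication and contains both the order of \<open>R\<close> and \<open>H\<close>.
  (Reflexivity comes from the order of \<open>R\<close>.) It is used for commutative semirings as well as for
  the non-commutative tensor algebras below.\<close>

inductive alg_le :: "('a, 'z) blueprint_scheme \<Rightarrow> ('a \<times> 'a) set \<Rightarrow> 'a \<Rightarrow> 'a \<Rightarrow> bool"
  for R (structure) and H where
  order: "\<lbrakk>x \<in> carrier R; y \<in> carrier R; x \<preceq> y\<rbrakk> \<Longrightarrow> alg_le R H x y"
| gen: "\<lbrakk>x \<in> carrier R; y \<in> carrier R; (x, y) \<in> H\<rbrakk> \<Longrightarrow> alg_le R H x y"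
| trans: "\<lbrakk>alg_le R H x y; alg_le R H y z\<rbrakk> \<Longrightarrow> alg_le R H x z"
| add: "\<lbrakk>alg_le R H x y; z \<in> carrier R\<rbrakk> \<Longrightarrow> alg_le R H (x \<oplus> z) (y \<oplus> z)"
| mult_left: "\<lbrakk>alg_le R H x y; z \<in> carrier R\<rbrakk> \<Longrightarrow> alg_le R H (z \<otimes> x) (z \<otimes> y)"
| mult_right: "\<lbrakk>alg_le R H x y; z \<in> carrier R\<rbrakk> \<Longrightarrow> alg_le R H (x \<otimes> z) (y \<otimes> z)"

definition pre_class :: "'a set \<Rightarrow> ('a \<Rightarrow> 'a \<Rightarrow> bool) \<Rightarrow> 'a \<Rightarrow> 'a set" where
  "pre_class A r x = {y \<in> A. r x y \<and> r y x}"

definition bp_quot :: "('a, 'z) blueprint_scheme \<Rightarrow> ('a \<Rightarrow> 'a \<Rightarrow> bool) \<Rightarrow> 'a set blueprint" where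
  "bp_quot B r =
    \<lparr>carrier = pre_class (carrier B) r ` carrier B,
     mult = (\<lambda>X Y. \<Union>x\<in>X. \<Union>y\<in>Y. pre_class (carrier B) r (x \<otimes>\<^bsub>B\<^esub> y)),
     one = pre_class (carrier B) r \<one>\<^bsub>B\<^esub>,
     zero = pre_class (carrier B) r \<zero>\<^bsub>B\<^esub>,
     add = (\<lambda>X Y. \<Union>x\<in>X. \<Union>y\<in>Y. pre_class (carrier B) r (x \<oplus>\<^bsub>B\<^esub> y)),
     leq = (\<lambda>X Y. \<exists>x\<in>X. \<exists>y\<in>Y. r x y),
     und = pre_class (carrier B) r ` und B\<rparr>"


section \<open>Monomial blueprints\<close>

text \<open>The monoid semiring \<open>\<nat>[D]\<close>: the formal sum \<open>1.a\<^sub>1 + \<dots> + 1.a\<^sub>m\<close> is the multiset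
  \<open>{#a\<^sub>1, \<dots>, a\<^sub>m#}\<close>.\<close>

definition monoid_semiring :: "'d::{comm_monoid_mult,mult_zero} multiset blueprint" where
  "monoid_semiring =
    \<lparr>carrier = UNIV,
     mult = (\<lambda>X Y. \<Sum>\<^sub># (image_mset (\<lambda>a. image_mset (\<lambda>b. a * b) Y) X)),
     one = {#1#},
     zero = {#},
     add = (+),
     leq = (=),
     und = insert {#} (range (\<lambda>a. {#a#}))\<rparr>"

text \<open>\<open>D // \<langle>H\<rangle>\<close>, with the identification \<open>0 \<equiv> 1.0\<close> and the relations \<open>H\<close> imposed in one step.\<close>

definition monomial_le ::
    "('d::{comm_monoid_mult,mult_zero} multiset \<times> 'd multiset) set \<Rightarrow>
      'd multiset \<Rightarrow> 'd multiset \<Rightarrow> bool" where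
  "monomial_le H = alg_le monoid_semiring ({({#}, {#0#}), ({#0#}, {#})} \<union> H)"

definition monomial_bp ::
    "('d::{comm_monoid_mult,mult_zero} multiset \<times> 'd multiset) set \<Rightarrow>
      'd multiset set blueprint" where
  "monomial_bp H = bp_quot monoid_semiring (monomial_le H)"

definition monomial ::
    "('d::{comm_monoid_mult,mult_zero} multiset \<times> 'd multiset) set \<Rightarrow> 'd \<Rightarrow> 'd multiset set" where
  "monomial H a = pre_class UNIV (monomial_le H) {#a#}"

definition ring_rels :: "('r::comm_ring_1 multiset \<times> 'r multiset) set" where
  "ring_rels = {({#b#}, A) | b A. b = \<Sum>\<^sub># A}"

definition ring_mon :: "'r::comm_ring_1 multiset set blueprint" where
  "ring_mon = monomial_bp ring_rels"

definition ring_eps :: "'r::comm_ring_1 multiset set" where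
  "ring_eps = monomial ring_rels (-1)"

class idempotent_semifield = comm_semiring_1 +
  assumes one_add_one_idem: "1 + 1 = 1"
    and ex_mult_inverse: "x \<noteq> 0 \<Longrightarrow> \<exists>y. x * y = 1"

text \<open>The right-hand side has to be a non-empty sum: for the empty one the condition is void, and
  imposing \<open>1.b \<le> 0\<close> for all \<open>b\<close> would make the blueprint collapse.\<close>

definition semifield_rels ::
    "('s::idempotent_semifield multiset \<times> 's multiset) set" where
  "semifield_rels =
    {({#b#}, A) | b A. A \<noteq> {#} \<and> (\<forall>a\<in>#A. \<Sum>\<^sub># A = b + \<Sum>\<^sub># (A - {#a#}))}"

definition semifield_mon :: "'s::idempotent_semifield multiset set blueprint" where
  "semifield_mon = monomial_bp semifield_rels"

definition semifield_eps :: "'s::idempotent_semifield multiset set" where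
  "semifield_eps = monomial semifield_rels 1"


section \<open>Modules over blueprints\<close>

text \<open>As in the \<open>module\<close> record of HOL-Algebra, the fields \<open>mult\<close> and \<open>one\<close> are only meaningful
  for algebras.\<close>

record ('b, 'm) bmodule = "'m blueprint" +
  act :: "'b \<Rightarrow> 'm \<Rightarrow> 'm"

text \<open>\<open>mod_le B M H\<close> is the smallest additive \<open>B\<close>-preorder on \<open>M\<close> containing \<open>H\<close>.\<close>

inductive mod_le ::
    "('b, 'z) blueprint_scheme \<Rightarrow> ('b, 'm, 'y) bmodule_scheme \<Rightarrow> ('m \<times> 'm) set \<Rightarrow>
      'm \<Rightarrow> 'm \<Rightarrow> bool"
  for B M H where
  order: "\<lbrakk>x \<in> carrier M; y \<in> carrier M; x \<preceq>\<^bsub>M\<^esub> y\<rbrakk> \<Longrightarrow> mod_le B M H x y"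
| gen: "\<lbrakk>x \<in> carrier M; y \<in> carrier M; (x, y) \<in> H\<rbrakk> \<Longrightarrow> mod_le B M H x y"
| trans: "\<lbrakk>mod_le B M H x y; mod_le B M H y z\<rbrakk> \<Longrightarrow> mod_le B M H x z"
| add: "\<lbrakk>mod_le B M H x y; z \<in> carrier M\<rbrakk> \<Longrightarrow> mod_le B M H (x \<oplus>\<^bsub>M\<^esub> z) (y \<oplus>\<^bsub>M\<^esub> z)"
| act: "\<lbrakk>a \<in> carrier B; b \<in> carrier B; a \<preceq>\<^bsub>B\<^esub> b; mod_le B M H x y\<rbrakk>
    \<Longrightarrow> mod_le B M H (act M a x) (act M b y)"

definition bmod_quot ::
    "('b, 'm) bmodule \<Rightarrow> ('m \<Rightarrow> 'm \<Rightarrow> bool) \<Rightarrow> ('b, 'm set) bmodule" where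
  "bmod_quot M r =
    blueprint.extend (bp_quot M r)
      (bmodule.fields (\<lambda>b X. \<Union>x\<in>X. pre_class (carrier M) r (act M b x)))"

definition hull_le ::
    "('b, 'z) blueprint_scheme \<Rightarrow> ('b, 'm) bmodule \<Rightarrow> 'm \<Rightarrow> 'm \<Rightarrow> bool" where
  "hull_le B M = mod_le B M {(x, y). x \<preceq>\<^bsub>M\<^esub> y \<or> y \<preceq>\<^bsub>M\<^esub> x}"

definition mod_hull ::
    "('b, 'z) blueprint_scheme \<Rightarrow> ('b, 'm) bmodule \<Rightarrow> ('b, 'm set) bmodule" where
  "mod_hull B M = bmod_quot M (hull_le B M)"

definition hull_class ::
    "('b, 'z) blueprint_scheme \<Rightarrow> ('b, 'm) bmodule \<Rightarrow> 'm \<Rightarrow> 'm set" where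
  "hull_class B M = pre_class (carrier M) (hull_le B M)"

definition idem_le ::
    "('b, 'z) blueprint_scheme \<Rightarrow> ('b, 'm) bmodule \<Rightarrow> 'm \<Rightarrow> 'm \<Rightarrow> bool" where
  "idem_le B M = mod_le B M {(x, y). y = x \<oplus>\<^bsub>M\<^esub> x \<or> x = y \<oplus>\<^bsub>M\<^esub> y}"

definition mod_idem ::
    "('b, 'z) blueprint_scheme \<Rightarrow> ('b, 'm) bmodule \<Rightarrow> ('b, 'm set) bmodule" where
  "mod_idem B M = bmod_quot M (idem_le B M)"

definition idem_class ::
    "('b, 'z) blueprint_scheme \<Rightarrow> ('b, 'm) bmodule \<Rightarrow> 'm \<Rightarrow> 'm set" where
  "idem_class B M = pre_class (carrier M) (idem_le B M)"

text \<open>Isomorphism of ambient modules, the scalars being transported along \<open>\<sigma>\<close>.\<close>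

definition semilinear_iso ::
    "('k \<Rightarrow> 'b) \<Rightarrow> ('k, 'm) bmodule \<Rightarrow> ('b, 'w) bmodule \<Rightarrow> ('m \<Rightarrow> 'w) \<Rightarrow> bool" where
  "semilinear_iso \<sigma> M N \<Phi> \<longleftrightarrow>
    bij_betw \<Phi> (carrier M) (carrier N) \<and>
    \<Phi> \<zero>\<^bsub>M\<^esub> = \<zero>\<^bsub>N\<^esub> \<and>
    (\<forall>x\<in>carrier M. \<forall>y\<in>carrier M. \<Phi> (x \<oplus>\<^bsub>M\<^esub> y) = \<Phi> x \<oplus>\<^bsub>N\<^esub> \<Phi> y) \<and>
    (\<forall>a. \<forall>x\<in>carrier M. \<Phi> (act M a x) = act N (\<sigma> a) (\<Phi> x))"

definition free_bmod :: "('b, 'z) blueprint_scheme \<Rightarrow> nat \<Rightarrow> ('b, nat \<Rightarrow> 'b) bmodule" where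
  "free_bmod B n =
    \<lparr>carrier = {1..n} \<rightarrow>\<^sub>E carrier B,
     mult = undefined,
     one = undefined,
     zero = (\<lambda>i\<in>{1..n}. \<zero>\<^bsub>B\<^esub>),
     add = (\<lambda>x y. \<lambda>i\<in>{1..n}. x i \<oplus>\<^bsub>B\<^esub> y i),
     leq = (\<lambda>x y. \<forall>i\<in>{1..n}. x i \<preceq>\<^bsub>B\<^esub> y i),
     und = {1..n} \<rightarrow>\<^sub>E und B,
     act = (\<lambda>b x. \<lambda>i\<in>{1..n}. b \<otimes>\<^bsub>B\<^esub> x i)\<rparr>"

definition unit_vec :: "('b, 'z) blueprint_scheme \<Rightarrow> nat \<Rightarrow> nat \<Rightarrow> nat \<Rightarrow> 'b" where
  "unit_vec B n i = (\<lambda>j\<in>{1..n}. if j = i then \<one>\<^bsub>B\<^esub> else \<zero>\<^bsub>B\<^esub>)"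


section \<open>Tensor powers and tensor algebras\<close>

text \<open>Formal sums of terms \<open>(b, [x\<^sub>1, \<dots>, x\<^sub>l])\<close>, each standing for \<open>b (x\<^sub>1 \<otimes> \<dots> \<otimes> x\<^sub>l)\<close>. The explicit
  scalar is redundant for \<open>l > 0\<close>; for \<open>l = 0\<close> it makes the tensor power equal to \<open>B\<close>.\<close>

type_synonym ('b, 'm) formal_sum = "('b \<times> 'm list) multiset"

definition formal_sums ::
    "('b, 'z) blueprint_scheme \<Rightarrow> ('b, 'm) bmodule \<Rightarrow> nat \<Rightarrow> ('b, ('b, 'm) formal_sum) bmodule" where
  "formal_sums B M l =
    \<lparr>carrier = {A. \<forall>(b, xs)\<in>#A. b \<in> carrier B \<and> length xs = l \<and> set xs \<subseteq> carrier M},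
     mult = undefined,
     one = undefined,
     zero = {#},
     add = (+),
     leq = (=),
     und = {{#(b, xs)#} | b xs. b \<in> und B \<and> length xs = l \<and> set xs \<subseteq> und M},
     act = (\<lambda>b A. image_mset (\<lambda>(c, xs). (b \<otimes>\<^bsub>B\<^esub> c, xs)) A)\<rparr>"

definition multilinear_rels ::
    "('b, 'z) blueprint_scheme \<Rightarrow> ('b, 'm) bmodule \<Rightarrow>
      (('b, 'm) formal_sum \<times> ('b, 'm) formal_sum) set" where
  "multilinear_rels B M =
    {({#(a \<oplus>\<^bsub>B\<^esub> b, xs)#}, {#(a, xs), (b, xs)#}) | a b xs.
       a \<in> carrier B \<and> b \<in> carrier B} \<union>
    {({#(\<zero>\<^bsub>B\<^esub>, xs)#}, {#}) | xs. True} \<union>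
    {({#(b, us @ [x \<oplus>\<^bsub>M\<^esub> y] @ vs)#}, {#(b, us @ [x] @ vs), (b, us @ [y] @ vs)#}) | b us x y vs.
       x \<in> carrier M \<and> y \<in> carrier M} \<union>
    {({#(b, us @ [\<zero>\<^bsub>M\<^esub>] @ vs)#}, {#}) | b us vs. True} \<union>
    {({#(b, us @ [act M c x] @ vs)#}, {#(b \<otimes>\<^bsub>B\<^esub> c, us @ [x] @ vs)#}) | b us c x vs.
       b \<in> carrier B \<and> c \<in> carrier B \<and> x \<in> carrier M}"

definition monotone_rels ::
    "('b, 'z) blueprint_scheme \<Rightarrow> ('b, 'm) bmodule \<Rightarrow>
      (('b, 'm) formal_sum \<times> ('b, 'm) formal_sum) set" where
  "monotone_rels B M =
    {({#(\<one>\<^bsub>B\<^esub>, xs)#}, {#(\<one>\<^bsub>B\<^esub>, ys)#}) | xs ys. list_all2 (leq M) xs ys}"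

text \<open>The \<open>l\<close>-fold tensor power of \<open>M\<close> is formed in one step (HOL types do not allow iterating a binary
  tensor product a variable number of times), and the multilinearity relations and the
  order are imposed simultaneously.\<close>

definition tensor_le ::
    "('b, 'z) blueprint_scheme \<Rightarrow> ('b, 'm) bmodule \<Rightarrow> nat \<Rightarrow>
      ('b, 'm) formal_sum \<Rightarrow> ('b, 'm) formal_sum \<Rightarrow> bool" where
  "tensor_le B M l =
    mod_le B (formal_sums B M l)
      (multilinear_rels B M \<union> (multilinear_rels B M)\<inverse> \<union> monotone_rels B M)"

definition tensor_power ::
    "('b, 'z) blueprint_scheme \<Rightarrow> ('b, 'm) bmodule \<Rightarrow> nat \<Rightarrow>
      ('b, ('b, 'm) formal_sum set) bmodule" where
  "tensor_power B M l = bmod_quot (formal_sums B M l) (tensor_le B M l)"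

definition tensor_class ::
    "('b, 'z) blueprint_scheme \<Rightarrow> ('b, 'm) bmodule \<Rightarrow> nat \<Rightarrow>
      ('b, 'm) formal_sum \<Rightarrow> ('b, 'm) formal_sum set" where
  "tensor_class B M l = pre_class (carrier (formal_sums B M l)) (tensor_le B M l)"

definition concatenate ::
    "('b, 'z) blueprint_scheme \<Rightarrow> ('b, 'm) formal_sum \<Rightarrow> ('b, 'm) formal_sum \<Rightarrow>
      ('b, 'm) formal_sum" where
  "concatenate B A C =
    \<Sum>\<^sub># (image_mset (\<lambda>(a, xs). image_mset (\<lambda>(c, ys). (a \<otimes>\<^bsub>B\<^esub> c, xs @ ys)) C) A)"

type_synonym ('b, 'm) tensor = "nat \<Rightarrow> ('b, 'm) formal_sum set"

definition tensor_algebra ::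
    "('b, 'z) blueprint_scheme \<Rightarrow> ('b, 'm) bmodule \<Rightarrow> ('b, ('b, 'm) tensor) bmodule" where
  "tensor_algebra B M =
    \<lparr>carrier = {f. (\<forall>l. f l \<in> carrier (tensor_power B M l)) \<and>
       finite {l. f l \<noteq> \<zero>\<^bsub>tensor_power B M l\<^esub>}},
     mult = (\<lambda>f g l. \<Oplus>\<^bsub>tensor_power B M l\<^esub>i\<in>{..l}.
       \<Union>A\<in>f i. \<Union>C\<in>g (l - i). tensor_class B M l (concatenate B A C)),
     one = (\<lambda>l. if l = 0 then tensor_class B M 0 {#(\<one>\<^bsub>B\<^esub>, [])#} else \<zero>\<^bsub>tensor_power B M l\<^esub>),
     zero = (\<lambda>l. \<zero>\<^bsub>tensor_power B M l\<^esub>),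
     add = (\<lambda>f g l. f l \<oplus>\<^bsub>tensor_power B M l\<^esub> g l),
     leq = (\<lambda>f g. \<forall>l. f l \<preceq>\<^bsub>tensor_power B M l\<^esub> g l),
     und = {f. (\<forall>l. f l \<in> und (tensor_power B M l)) \<and>
       finite {l. f l \<noteq> \<zero>\<^bsub>tensor_power B M l\<^esub>}},
     act = (\<lambda>b f l. act (tensor_power B M l) b (f l))\<rparr>"

definition pure_tensor ::
    "('b, 'z) blueprint_scheme \<Rightarrow> ('b, 'm) bmodule \<Rightarrow> 'm list \<Rightarrow> ('b, 'm) tensor" where
  "pure_tensor B M xs =
    (\<lambda>l. if l = length xs then tensor_class B M l {#(\<one>\<^bsub>B\<^esub>, xs)#} else \<zero>\<^bsub>tensor_power B M l\<^esub>)"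

definition homogeneous ::
    "('b, 'z) blueprint_scheme \<Rightarrow> ('b, 'm) bmodule \<Rightarrow> nat \<Rightarrow> ('b, 'm) tensor set" where
  "homogeneous B M d =
    {f \<in> carrier (tensor_algebra B M). \<forall>l. l \<noteq> d \<longrightarrow> f l = \<zero>\<^bsub>tensor_power B M l\<^esub>}"

text \<open>Quotients of algebras by relations \<open>x \<equiv> y\<close> for \<open>(x, y) \<in> H\<close>.\<close>

definition alg_quot :: "('b, 'm) bmodule \<Rightarrow> ('m \<times> 'm) set \<Rightarrow> ('b, 'm set) bmodule" where
  "alg_quot T H = bmod_quot T (alg_le T (H \<union> H\<inverse>))"

definition alg_class :: "('b, 'm) bmodule \<Rightarrow> ('m \<times> 'm) set \<Rightarrow> 'm \<Rightarrow> 'm set" where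
  "alg_class T H = pre_class (carrier T) (alg_le T (H \<union> H\<inverse>))"


section \<open>Exterior powers over ordered blueprints\<close>

definition d_subsets :: "nat \<Rightarrow> nat \<Rightarrow> nat set set" where
  "d_subsets n d = {I. I \<subseteq> {1..n} \<and> card I = d}"

abbreviation free_tensors ::
    "('b, 'z) blueprint_scheme \<Rightarrow> nat \<Rightarrow> ('b, ('b, nat \<Rightarrow> 'b) tensor) bmodule" where
  "free_tensors B n \<equiv> tensor_algebra B (free_bmod B n)"

definition basis_tensor ::
    "('b, 'z) blueprint_scheme \<Rightarrow> nat \<Rightarrow> nat list \<Rightarrow> ('b, nat \<Rightarrow> 'b) tensor" where
  "basis_tensor B n is = pure_tensor B (free_bmod B n) (map (unit_vec B n) is)"

definition ext_rels ::
    "('b, 'z) blueprint_scheme \<Rightarrow> 'b \<Rightarrow> nat \<Rightarrow>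
      (('b, nat \<Rightarrow> 'b) tensor \<times> ('b, nat \<Rightarrow> 'b) tensor) set" where
  "ext_rels B \<epsilon> n =
    {(basis_tensor B n [i, i], \<zero>\<^bsub>free_tensors B n\<^esub>) | i. i \<in> {1..n}} \<union>
    {(basis_tensor B n [i, j], act (free_tensors B n) \<epsilon> (basis_tensor B n [j, i])) | i j.
       i \<in> {1..n} \<and> j \<in> {1..n} \<and> i \<noteq> j}"

definition ext_algebra ::
    "('b, 'z) blueprint_scheme \<Rightarrow> 'b \<Rightarrow> nat \<Rightarrow> ('b, ('b, nat \<Rightarrow> 'b) tensor set) bmodule" where
  "ext_algebra B \<epsilon> n = alg_quot (free_tensors B n) (ext_rels B \<epsilon> n)"

definition ext_basis ::
    "('b, 'z) blueprint_scheme \<Rightarrow> 'b \<Rightarrow> nat \<Rightarrow> nat set \<Rightarrow> ('b, nat \<Rightarrow> 'b) tensor set" where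
  "ext_basis B \<epsilon> n I =
    alg_class (free_tensors B n) (ext_rels B \<epsilon> n) (basis_tensor B n (sorted_list_of_set I))"

definition ext_vec ::
    "('b, 'z) blueprint_scheme \<Rightarrow> 'b \<Rightarrow> nat \<Rightarrow> nat \<Rightarrow> (nat set \<Rightarrow> 'b) \<Rightarrow>
      ('b, nat \<Rightarrow> 'b) tensor set" where
  "ext_vec B \<epsilon> n d v =
    (\<Oplus>\<^bsub>ext_algebra B \<epsilon> n\<^esub>I\<in>d_subsets n d. act (ext_algebra B \<epsilon> n) (v I) (ext_basis B \<epsilon> n I))"

inductive_set submodule_gen ::
    "('b, 'z) blueprint_scheme \<Rightarrow> ('b, 'm) bmodule \<Rightarrow> 'm set \<Rightarrow> 'm set"
  for B M X where
  zero: "\<zero>\<^bsub>M\<^esub> \<in> submodule_gen B M X"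
| gen: "x \<in> X \<Longrightarrow> x \<in> submodule_gen B M X"
| add: "\<lbrakk>x \<in> submodule_gen B M X; y \<in> submodule_gen B M X\<rbrakk>
    \<Longrightarrow> x \<oplus>\<^bsub>M\<^esub> y \<in> submodule_gen B M X"
| act: "\<lbrakk>b \<in> carrier B; x \<in> submodule_gen B M X\<rbrakk> \<Longrightarrow> act M b x \<in> submodule_gen B M X"

definition ext_power ::
    "('b, 'z) blueprint_scheme \<Rightarrow> 'b \<Rightarrow> nat \<Rightarrow> nat \<Rightarrow>
      ('b, ('b, nat \<Rightarrow> 'b) tensor set) bmodule" where
  "ext_power B \<epsilon> n d =
    (let H = {ext_vec B \<epsilon> n d v | v. v \<in> d_subsets n d \<rightarrow> und B}
     in (ext_algebra B \<epsilon> n)\<lparr>carrier := submodule_gen B (ext_algebra B \<epsilon> n) H, und := H\<rparr>)"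


section \<open>Exterior powers over fields and idempotent semifields\<close>

text \<open>With the discrete order, the constructions above specialise to the usual tensor algebra over a
  commutative semiring.\<close>

definition discrete_bp :: "'r::comm_semiring_1 blueprint" where
  "discrete_bp =
    \<lparr>carrier = UNIV, mult = (*), one = 1, zero = 0, add = (+), leq = (=), und = UNIV\<rparr>"

abbreviation discrete_tensors ::
    "nat \<Rightarrow> ('r, ('r::comm_semiring_1, nat \<Rightarrow> 'r) tensor) bmodule" where
  "discrete_tensors n \<equiv> free_tensors discrete_bp n"

definition field_ext_rels ::
    "nat \<Rightarrow> (('k::field, nat \<Rightarrow> 'k) tensor \<times> ('k, nat \<Rightarrow> 'k) tensor) set" where
  "field_ext_rels n =
    {(pure_tensor discrete_bp (free_bmod discrete_bp n) [x, x], \<zero>\<^bsub>discrete_tensors n\<^esub>) | x.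
       x \<in> carrier (free_bmod discrete_bp n)}"

definition field_ext_algebra :: "nat \<Rightarrow> ('k::field, ('k, nat \<Rightarrow> 'k) tensor set) bmodule" where
  "field_ext_algebra n = alg_quot (discrete_tensors n) (field_ext_rels n)"

definition field_ext_power ::
    "nat \<Rightarrow> nat \<Rightarrow> ('k::field, ('k, nat \<Rightarrow> 'k) tensor set) bmodule" where
  "field_ext_power n d = (field_ext_algebra n)\<lparr>carrier :=
     alg_class (discrete_tensors n) (field_ext_rels n) `
       homogeneous discrete_bp (free_bmod discrete_bp n) d\<rparr>"

definition field_ext_basis :: "nat \<Rightarrow> nat set \<Rightarrow> ('k::field, nat \<Rightarrow> 'k) tensor set" where
  "field_ext_basis n I = alg_class (discrete_tensors n) (field_ext_rels n)
     (basis_tensor discrete_bp n (sorted_list_of_set I))"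

definition field_ext_vec ::
    "nat \<Rightarrow> nat \<Rightarrow> (nat set \<Rightarrow> 'k::field) \<Rightarrow> ('k, nat \<Rightarrow> 'k) tensor set" where
  "field_ext_vec n d v =
    (\<Oplus>\<^bsub>field_ext_power n d\<^esub>I\<in>d_subsets n d. act (field_ext_power n d) (v I) (field_ext_basis n I))"

definition sym_rels ::
    "nat \<Rightarrow> (('s::idempotent_semifield, nat \<Rightarrow> 's) tensor \<times> ('s, nat \<Rightarrow> 's) tensor) set" where
  "sym_rels n =
    {(pure_tensor discrete_bp (free_bmod discrete_bp n) [x, y],
      pure_tensor discrete_bp (free_bmod discrete_bp n) [y, x]) | x y.
       x \<in> carrier (free_bmod discrete_bp n) \<and> y \<in> carrier (free_bmod discrete_bp n)}"

definition sym_algebra ::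
    "nat \<Rightarrow> ('s::idempotent_semifield, ('s, nat \<Rightarrow> 's) tensor set) bmodule" where
  "sym_algebra n = alg_quot (discrete_tensors n) (sym_rels n)"

definition sym_gen :: "nat \<Rightarrow> nat \<Rightarrow> ('s::idempotent_semifield, nat \<Rightarrow> 's) tensor set" where
  "sym_gen n i = alg_class (discrete_tensors n) (sym_rels n) (basis_tensor discrete_bp n [i])"

definition square_rels ::
    "nat \<Rightarrow> (('s::idempotent_semifield, nat \<Rightarrow> 's) tensor set \<times> ('s, nat \<Rightarrow> 's) tensor set) set" where
  "square_rels n =
    {(sym_gen n i \<otimes>\<^bsub>sym_algebra n\<^esub> sym_gen n i, \<zero>\<^bsub>sym_algebra n\<^esub>) | i. i \<in> {1..n}}"

definition trop_ext_algebra ::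
    "nat \<Rightarrow> ('s::idempotent_semifield, ('s, nat \<Rightarrow> 's) tensor set set) bmodule" where
  "trop_ext_algebra n = alg_quot (sym_algebra n) (square_rels n)"

definition trop_ext_power ::
    "nat \<Rightarrow> nat \<Rightarrow> ('s::idempotent_semifield, ('s, nat \<Rightarrow> 's) tensor set set) bmodule" where
  "trop_ext_power n d = (trop_ext_algebra n)\<lparr>carrier :=
     (\<lambda>f. alg_class (sym_algebra n) (square_rels n)
            (alg_class (discrete_tensors n) (sym_rels n) f)) `
       homogeneous discrete_bp (free_bmod discrete_bp n) d\<rparr>"

definition trop_ext_basis ::
    "nat \<Rightarrow> nat set \<Rightarrow> ('s::idempotent_semifield, nat \<Rightarrow> 's) tensor set set" where
  "trop_ext_basis n I = foldr (\<otimes>\<^bsub>trop_ext_algebra n\<^esub>)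
     (map (\<lambda>i. alg_class (sym_algebra n) (square_rels n) (sym_gen n i)) (sorted_list_of_set I))
     \<one>\<^bsub>trop_ext_algebra n\<^esub>"

definition trop_ext_vec ::
    "nat \<Rightarrow> nat \<Rightarrow> (nat set \<Rightarrow> 's::idempotent_semifield) \<Rightarrow> ('s, nat \<Rightarrow> 's) tensor set set" where
  "trop_ext_vec n d v =
    (\<Oplus>\<^bsub>trop_ext_power n d\<^esub>I\<in>d_subsets n d. act (trop_ext_power n d) (v I) (trop_ext_basis n I))"


section \<open>Matroids and Pluecker vectors\<close>

text \<open>For \<open>X = {x\<^sub>1 < \<dots>}\<close> and \<open>Y = {i\<^sub>1 < i\<^sub>2 < \<dots>}\<close>. The exponent of \<open>\<epsilon>\<close> is \<open>k\<close> plus the number of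
  inversions of \<open>(i\<^sub>k, x\<^sub>1, x\<^sub>2, \<dots>)\<close>, i.e. the factor for \<open>X \<union> {i\<^sub>k}\<close> is the value of the
  \<open>\<epsilon>\<close>-alternating extension of \<open>v\<close> at that tuple. Without the second summand the relation is not the Pluecker
  relation when \<open>\<epsilon> \<noteq> \<one>\<close>: for \<open>X = {2}\<close>, \<open>Y = {1, 2, 3}\<close> it would demand
  \<open>0 \<le> \<epsilon> v\<^sub>1\<^sub>2 v\<^sub>2\<^sub>3 + \<epsilon> v\<^sub>2\<^sub>3 v\<^sub>1\<^sub>2\<close>.\<close>

definition pluecker_rel ::
    "('b, 'z) blueprint_scheme \<Rightarrow> 'b \<Rightarrow> (nat set \<Rightarrow> 'b) \<Rightarrow> nat set \<Rightarrow> nat set \<Rightarrow> bool" where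
  "pluecker_rel B \<epsilon> v X Y \<longleftrightarrow>
    (let i = (\<lambda>k. sorted_list_of_set Y ! (k - 1)) in
      \<zero>\<^bsub>B\<^esub> \<preceq>\<^bsub>B\<^esub> (\<Oplus>\<^bsub>B\<^esub>k\<in>{k \<in> {1..card Y}. i k \<notin> X}.
        \<epsilon> [^]\<^bsub>B\<^esub> (k + card {x \<in> X. x < i k}) \<otimes>\<^bsub>B\<^esub> v (X \<union> {i k}) \<otimes>\<^bsub>B\<^esub> v (Y - {i k})))"

text \<open>The condition \<open>card X + 1 = d\<close> (and not \<open>card X = d - 1\<close>) makes the relations void for
  \<open>d = 0\<close>.\<close>

definition gp_functions ::
    "('b, 'z) blueprint_scheme \<Rightarrow> 'b \<Rightarrow> nat \<Rightarrow> nat \<Rightarrow> (nat set \<Rightarrow> 'b) set" where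
  "gp_functions B \<epsilon> n d =
    {\<Delta> \<in> d_subsets n d \<rightarrow>\<^sub>E und B.
       (\<exists>J\<in>d_subsets n d. \<Delta> J \<in> bp_units B) \<and>
       (\<forall>X Y. X \<subseteq> {1..n} \<and> card X + 1 = d \<and> Y \<in> d_subsets n (d + 1) \<longrightarrow>
         pluecker_rel B \<epsilon> \<Delta> X Y)}"

definition gp_class ::
    "('b, 'z) blueprint_scheme \<Rightarrow> nat \<Rightarrow> nat \<Rightarrow> (nat set \<Rightarrow> 'b) \<Rightarrow> (nat set \<Rightarrow> 'b) set" where
  "gp_class B n d \<Delta> = {\<lambda>I\<in>d_subsets n d. a \<otimes>\<^bsub>B\<^esub> \<Delta> I | a. a \<in> bp_units B}"

definition matroids ::
    "('b, 'z) blueprint_scheme \<Rightarrow> 'b \<Rightarrow> nat \<Rightarrow> nat \<Rightarrow> (nat set \<Rightarrow> 'b) set set" where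
  "matroids B \<epsilon> n d = gp_class B n d ` gp_functions B \<epsilon> n d"

definition pluecker_vectors ::
    "('b, 'z) blueprint_scheme \<Rightarrow> 'b \<Rightarrow> nat \<Rightarrow> nat \<Rightarrow> ('b, nat \<Rightarrow> 'b) tensor set set" where
  "pluecker_vectors B \<epsilon> n d =
    {w \<in> und (ext_power B \<epsilon> n d). \<exists>v. v \<in> d_subsets n d \<rightarrow> und B \<and> w = ext_vec B \<epsilon> n d v \<and>
       (\<exists>J\<in>d_subsets n d. v J \<in> bp_units B) \<and>
       (\<forall>X Y. X \<subseteq> {1..n} \<and> card X + 1 = d \<and> Y \<in> d_subsets n (d + 1) \<longrightarrow>
         pluecker_rel B \<epsilon> v X Y)}"

definition pluecker_class ::
    "('b, 'z) blueprint_scheme \<Rightarrow> 'b \<Rightarrow> nat \<Rightarrow> nat \<Rightarrow> ('b, nat \<Rightarrow> 'b) tensor set \<Rightarrow>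
      ('b, nat \<Rightarrow> 'b) tensor set set" where
  "pluecker_class B \<epsilon> n d w = {act (ext_power B \<epsilon> n d) a w | a. a \<in> bp_units B}"

definition words :: "nat \<Rightarrow> nat \<Rightarrow> nat list set" where
  "words n d = {xs. length xs = d \<and> set xs \<subseteq> {1..n}}"

definition alternating :: "nat \<Rightarrow> nat \<Rightarrow> (nat list \<Rightarrow> 'k::field) \<Rightarrow> bool" where
  "alternating n d p \<longleftrightarrow>
    (\<forall>xs\<in>words n d. \<not> distinct xs \<longrightarrow> p xs = 0) \<and>
    (\<forall>xs\<in>words n d. \<forall>\<pi>. \<pi> permutes {..<d} \<longrightarrow>
       p (permute_list \<pi> xs) = of_int (sign \<pi>) * p xs)"

definition field_gp_functions :: "nat \<Rightarrow> nat \<Rightarrow> (nat list \<Rightarrow> 'k::field) set" where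
  "field_gp_functions n d =
    {p \<in> words n d \<rightarrow>\<^sub>E UNIV.
       (\<exists>xs\<in>words n d. p xs \<noteq> 0) \<and> alternating n d p \<and>
       (\<forall>ys xs. ys \<in> words n (d + 1) \<and> set xs \<subseteq> {1..n} \<and> length xs + 1 = d \<longrightarrow>
         (\<Sum>k=1..d+1. (-1) ^ k * p (take (k - 1) ys @ drop k ys) * p (ys ! (k - 1) # xs)) = 0)}"

definition field_gp_class ::
    "nat \<Rightarrow> nat \<Rightarrow> (nat list \<Rightarrow> 'k::field) \<Rightarrow> (nat list \<Rightarrow> 'k) set" where
  "field_gp_class n d p = {\<lambda>xs\<in>words n d. a * p xs | a. a \<noteq> 0}"

definition field_matroids :: "nat \<Rightarrow> nat \<Rightarrow> (nat list \<Rightarrow> 'k::field) set set" where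
  "field_matroids n d = field_gp_class n d ` field_gp_functions n d"

definition trop_pluecker_vectors ::
    "nat \<Rightarrow> nat \<Rightarrow> ('s::idempotent_semifield, nat \<Rightarrow> 's) tensor set set set" where
  "trop_pluecker_vectors n d =
    {w \<in> carrier (trop_ext_power n d). w \<noteq> \<zero>\<^bsub>trop_ext_power n d\<^esub> \<and>
       (\<exists>v. w = trop_ext_vec n d v \<and>
         (\<forall>A X p. A \<in> d_subsets n (d + 1) \<and> X \<subseteq> {1..n} \<and> card X + 1 = d \<and> p \<in> A - X \<longrightarrow>
           (\<Sum>i\<in>A - X. v (A - {i}) * v (X \<union> {i})) =
           (\<Sum>i\<in>A - X - {p}. v (A - {i}) * v (X \<union> {i}))))}"

end

theory Submission
  imports Defs
begin

text \<open>
  Part (3) and the two base change statements rest on one fact: in each exterior power that occurs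
  (over an ordered blueprint, over a field, over an idempotent semifield) every element is
  \<open>\<Sum>\<^sub>I v\<^sub>I e\<^sub>I\<close> for exactly one family \<open>v\<close>, the operations are coordinatewise, and so is the order. The
  locale \<open>coordinatized\<close> records this, and everything after it is a computation with coordinates.

  That the \<open>e\<^sub>I\<close> span is the usual sorting of words, with \<open>\<epsilon>\<close> for each exchange of neighbours
  (\<open>word_in_span\<close>, \<open>tensor_in_span\<close>). Independence needs functionals that survive both the relations of
  the tensor powers and the two-sided congruence of the exterior algebra. A function \<open>\<chi>\<close> from words to
  scalars extends to a linear functional on formal sums of tensors, by expanding every vector in the
  standard basis, and such a functional is monotone for the order of the tensor power
  (\<open>functional_tle\<close>). Call \<open>\<chi>\<close> alternating if it vanishes on words with two equal neighbours and changes
  by \<open>\<epsilon>\<close> when two neighbours are exchanged. Feeding part of the word with a fixed tensor, from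
  the left or from the right, turns an alternating \<open>\<chi>\<close> into an alternating one; hence the preorder
  "no alternating functional decreases" is stable under multiplication from both sides and contains
  the preorder that defines the exterior algebra (\<open>alg_le_weight_sound\<close>). The function
  \<open>w \<mapsto> \<epsilon>\<^bsup>inv(w)\<^esup>\<close> on the words with letter set \<open>I\<close> is alternating, and its functional reads off
  \<open>v\<^sub>I\<close>. With the discrete order the same argument gives the freeness of the exterior powers of
  \<open>K\<^sup>n\<close> and \<open>S\<^sup>n\<close>.

  For (1) and (2), summing the entries of a multiset is a retraction from \<open>(K\<^sup>m\<^sup>o\<^sup>n)\<^sup>+\<close> to \<open>K\<close>, respectively
  from \<open>(S\<^sup>m\<^sup>o\<^sup>n)\<^sup>+\<close> to \<open>S\<close>. It is compatible with the preorders that define the hull and the idempotent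
  quotient if \<open>K\<close> carries equality and \<open>S\<close> its natural order, so these quotients can only identify
  elements whose coordinates have the same sums, and they do identify all of those. This gives the
  canonical isomorphisms and their values on all elements (\<open>canonical_iso_exists\<close>, \<open>canonical_iso_vec\<close>).

  It remains to translate the Pluecker relations. In \<open>K\<^sup>m\<^sup>o\<^sup>n\<close>, \<open>0 \<le> \<Sum> 1.a\<^sub>i\<close> means \<open>\<Sum> a\<^sub>i = 0\<close>, because the
  sum is invariant. In \<open>S\<^sup>m\<^sup>o\<^sup>n\<close> it means that no \<open>a\<^sub>i\<close> contributes to the sum of the others
  (\<open>semifield_null_iff\<close>); \<open>S\<close> need not be totally ordered, so instead of looking for maxima the proof
  tests a multiset by the multisets that make it null when they are added. Over a field, finally, an
  alternating function on words is determined by its values on increasing words, and the relation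
  for arbitrary words reduces to the one for sets up to a global sign (\<open>word_pluecker_iff\<close>). Part (3)
  is the uniqueness of coordinates, applied to \<open>\<Delta> \<mapsto> \<Sum>\<^sub>I \<Delta>\<^sub>I e\<^sub>I\<close>.
\<close>

section \<open>Quotients by compatible preorders\<close>

lemma bp_quot_simps [simp]:
  "carrier (bp_quot M r) = pre_class (carrier M) r ` carrier M"
  "mult (bp_quot M r) = (\<lambda>X Y. \<Union>x\<in>X. \<Union>y\<in>Y. pre_class (carrier M) r (x \<otimes>\<^bsub>M\<^esub> y))"
  "one (bp_quot M r) = pre_class (carrier M) r \<one>\<^bsub>M\<^esub>"
  "zero (bp_quot M r) = pre_class (carrier M) r \<zero>\<^bsub>M\<^esub>"
  "add (bp_quot M r) = (\<lambda>X Y. \<Union>x\<in>X. \<Union>y\<in>Y. pre_class (carrier M) r (x \<oplus>\<^bsub>M\<^esub> y))"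
  "leq (bp_quot M r) = (\<lambda>X Y. \<exists>x\<in>X. \<exists>y\<in>Y. r x y)"
  "und (bp_quot M r) = pre_class (carrier M) r ` und M"
  by (simp_all add: bp_quot_def)

lemma bmod_quot_simps [simp]:
  "carrier (bmod_quot M r) = carrier (bp_quot M r)"
  "mult (bmod_quot M r) = mult (bp_quot M r)"
  "one (bmod_quot M r) = one (bp_quot M r)"
  "zero (bmod_quot M r) = zero (bp_quot M r)"
  "add (bmod_quot M r) = add (bp_quot M r)"
  "leq (bmod_quot M r) = leq (bp_quot M r)"
  "und (bmod_quot M r) = und (bp_quot M r)"
  "act (bmod_quot M r) = (\<lambda>b X. \<Union>x\<in>X. pre_class (carrier M) r (act M b x))"
  by (simp_all add: bmod_quot_def bp_quot_def blueprint.extend_def bmodule.fields_def)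

lemma abelian_monoid_cong:
  assumes "abelian_monoid M" "carrier N = carrier M" "add N = add M" "zero N = zero M"
  shows "abelian_monoid N"
proof -
  note M = abelian_monoidE[OF assms(1)]
  show ?thesis by (rule abelian_monoidI; simp only: assms(2-4); rule M; assumption)
qed

text \<open>A preorder stable under addition is what the additive structure of a quotient needs; the
  multiplication and the action are added case by case below, because the preorders that occur are
  stable under different further operations.\<close>

locale add_preorder = abelian_monoid M for M :: "('m, 'z) blueprint_scheme" (structure) +
  fixes r :: "'m \<Rightarrow> 'm \<Rightarrow> bool"
  assumes r_carrier: "r x y \<Longrightarrow> x \<in> carrier M \<and> y \<in> carrier M"
    and r_refl: "x \<in> carrier M \<Longrightarrow> r x x"
    and r_trans: "r x y \<Longrightarrow> r y z \<Longrightarrow> r x z"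
    and r_add: "r x y \<Longrightarrow> z \<in> carrier M \<Longrightarrow> r (x \<oplus> z) (y \<oplus> z)"
begin

abbreviation cls where "cls \<equiv> pre_class (carrier M) r"

lemma mem_cls_iff: "y \<in> cls x \<longleftrightarrow> r x y \<and> r y x"
  unfolding pre_class_def using r_carrier[of x y] by blast

lemma cls_eq_iff:
  assumes "x \<in> carrier M" "y \<in> carrier M"
  shows "cls x = cls y \<longleftrightarrow> r x y \<and> r y x"
proof
  assume "cls x = cls y"
  moreover have "x \<in> cls x" using assms r_refl by (simp add: mem_cls_iff)
  ultimately show "r x y \<and> r y x" by (simp add: mem_cls_iff)
next
  assume "r x y \<and> r y x"
  then show "cls x = cls y" unfolding pre_class_def by (blast intro: r_trans)
qed

lemma cls_eqI: "r x y \<Longrightarrow> r y x \<Longrightarrow> cls x = cls y"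
  using cls_eq_iff[of x y] r_carrier[of x y] by simp

lemma UN_cls:
  assumes "x \<in> carrier M" and "\<And>y. r x y \<Longrightarrow> r y x \<Longrightarrow> F y = F x"
  shows "(\<Union>y\<in>cls x. F y) = F x"
proof -
  have "x \<in> cls x" using assms r_refl by (simp add: mem_cls_iff)
  moreover have "F y = F x" if "y \<in> cls x" for y
    using that assms(2) by (simp add: mem_cls_iff)
  ultimately show ?thesis by blast
qed

text \<open>The operations of a quotient are unions over all representatives; for a map that is constant on
  classes the union collapses to the value at one pair of representatives.\<close>

lemma UN2_cls:
  assumes "x \<in> carrier M" "y \<in> carrier M"
    and "\<And>x' y'. r x x' \<Longrightarrow> r x' x \<Longrightarrow> r y y' \<Longrightarrow> r y' y \<Longrightarrow> F x' y' = F x y"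
  shows "(\<Union>x'\<in>cls x. \<Union>y'\<in>cls y. F x' y') = F x y"
proof -
  have "(\<Union>y'\<in>cls y. F x' y') = F x' y" if "r x x'" "r x' x" for x'
  proof (rule UN_cls)
    fix y' assume *: "r y y'" "r y' y"
    show "F x' y' = F x' y"
      using assms(3)[OF that *] assms(3)[OF that r_refl[OF assms(2)] r_refl[OF assms(2)]]
      by (rule HOL.trans[OF _ sym])
  qed (rule assms(2))
  then have "(\<Union>x'\<in>cls x. \<Union>y'\<in>cls y. F x' y') = (\<Union>x'\<in>cls x. F x' y)"
    by (intro SUP_cong) (auto simp: mem_cls_iff)
  also have "\<dots> = F x y"
    by (rule UN_cls[OF assms(1)]) (rule assms(3)[OF _ _ r_refl[OF assms(2)] r_refl[OF assms(2)]])
  finally show ?thesis .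
qed

lemma r_add2: "r x x' \<Longrightarrow> r y y' \<Longrightarrow> r (x \<oplus> y) (x' \<oplus> y')"
proof -
  assume *: "r x x'" "r y y'"
  note carr = r_carrier[OF *(1)] r_carrier[OF *(2)]
  have "r (x \<oplus> y) (x' \<oplus> y)" using * carr by (simp add: r_add)
  moreover have "r (y \<oplus> x') (y' \<oplus> x')" using * carr by (simp add: r_add)
  then have "r (x' \<oplus> y) (x' \<oplus> y')" using carr by (simp add: a_comm)
  ultimately show ?thesis by (rule r_trans)
qed

lemma quot_add:
  assumes "x \<in> carrier M" "y \<in> carrier M"
  shows "cls x \<oplus>\<^bsub>bp_quot M r\<^esub> cls y = cls (x \<oplus> y)"
  unfolding bp_quot_simps
proof (rule UN2_cls)
  fix x' y' assume *: "r x x'" "r x' x" "r y y'" "r y' y"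
  then have "r (x \<oplus> y) (x' \<oplus> y')" "r (x' \<oplus> y') (x \<oplus> y)"
    by (simp_all add: r_add2)
  then show "cls (x' \<oplus> y') = cls (x \<oplus> y)"
    by (intro cls_eqI)
qed (use assms in auto)

lemma quot_leq:
  assumes "x \<in> carrier M" "y \<in> carrier M"
  shows "cls x \<preceq>\<^bsub>bp_quot M r\<^esub> cls y \<longleftrightarrow> r x y"
  using r_refl[OF assms(1)] r_refl[OF assms(2)] unfolding bp_quot_simps mem_cls_iff Bex_def
  by (blast intro: r_trans)

lemma quot_abelian_monoid: "abelian_monoid (bp_quot M r)"
proof (rule abelian_monoidI)
  fix X Y Z
  assume "X \<in> carrier (bp_quot M r)" "Y \<in> carrier (bp_quot M r)" "Z \<in> carrier (bp_quot M r)"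
  then obtain x y z where "x \<in> carrier M" "y \<in> carrier M" "z \<in> carrier M"
    "X = cls x" "Y = cls y" "Z = cls z" by auto
  then show "X \<oplus>\<^bsub>bp_quot M r\<^esub> Y \<oplus>\<^bsub>bp_quot M r\<^esub> Z = X \<oplus>\<^bsub>bp_quot M r\<^esub> (Y \<oplus>\<^bsub>bp_quot M r\<^esub> Z)"
    by (simp only: quot_add a_closed a_assoc)
next
  fix X Y assume "X \<in> carrier (bp_quot M r)" "Y \<in> carrier (bp_quot M r)"
  then obtain x y where xy: "x \<in> carrier M" "y \<in> carrier M" "X = cls x" "Y = cls y" by auto
  then show "X \<oplus>\<^bsub>bp_quot M r\<^esub> Y = Y \<oplus>\<^bsub>bp_quot M r\<^esub> X"
    by (simp only: quot_add a_comm)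
  from xy show "X \<oplus>\<^bsub>bp_quot M r\<^esub> Y \<in> carrier (bp_quot M r)"
    by (simp only: quot_add bp_quot_simps(1)) auto
next
  fix X assume "X \<in> carrier (bp_quot M r)"
  then obtain x where "x \<in> carrier M" "X = cls x" by auto
  then show "\<zero>\<^bsub>bp_quot M r\<^esub> \<oplus>\<^bsub>bp_quot M r\<^esub> X = X"
    by (simp only: bp_quot_simps(4) quot_add zero_closed l_zero)
qed auto

lemma quot_mult:
  assumes "\<And>x y. x \<in> carrier M \<Longrightarrow> y \<in> carrier M \<Longrightarrow> x \<otimes> y \<in> carrier M"
    and "\<And>x y z. r x y \<Longrightarrow> z \<in> carrier M \<Longrightarrow> r (z \<otimes> x) (z \<otimes> y)"
    and "\<And>x y z. r x y \<Longrightarrow> z \<in> carrier M \<Longrightarrow> r (x \<otimes> z) (y \<otimes> z)"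
    and "x \<in> carrier M" "y \<in> carrier M"
  shows "cls x \<otimes>\<^bsub>bp_quot M r\<^esub> cls y = cls (x \<otimes> y)"
  unfolding bp_quot_simps
proof (rule UN2_cls)
  fix x' y' assume *: "r x x'" "r x' x" "r y y'" "r y' y"
  note carr = r_carrier[OF *(1), THEN conjunct2] r_carrier[OF *(3), THEN conjunct2]
  have "r (x \<otimes> y) (x' \<otimes> y')"
    by (rule r_trans[OF assms(3)[OF *(1) assms(5)] assms(2)[OF *(3) carr(1)]])
  moreover have "r (x' \<otimes> y') (x \<otimes> y)"
    by (rule r_trans[OF assms(3)[OF *(2) carr(2)] assms(2)[OF *(4) assms(4)]])
  ultimately show "cls (x' \<otimes> y') = cls (x \<otimes> y)"
    by (intro cls_eqI)
qed (rule assms)+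

lemma quot_map:
  assumes "\<And>x y. r x y \<Longrightarrow> r (F x) (F y)" and "x \<in> carrier M"
  shows "(\<Union>x\<in>cls x. cls (F x)) = cls (F x)"
  using assms(2) by (rule UN_cls) (intro cls_eqI assms(1))

end

section \<open>The tensor algebra of a free module\<close>

lemma formal_sums_simps [simp]:
  "A \<in> carrier (formal_sums B M l) \<longleftrightarrow>
     (\<forall>(b, xs)\<in>#A. b \<in> carrier B \<and> length xs = l \<and> set xs \<subseteq> carrier M)"
  "zero (formal_sums B M l) = {#}"
  "add (formal_sums B M l) = (+)"
  "leq (formal_sums B M l) = (=)"
  "act (formal_sums B M l) = (\<lambda>b. image_mset (\<lambda>(c, xs). (b \<otimes>\<^bsub>B\<^esub> c, xs)))"
  by (auto simp: formal_sums_def)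

lemma formal_sums_abelian_monoid: "abelian_monoid (formal_sums B M l)"
  by (rule abelian_monoidI) (auto simp: add_ac)

lemma tensor_power_simps [simp]:
  "zero (tensor_power B M l) = tensor_class B M l {#}"
  "carrier (tensor_power B M l) = tensor_class B M l ` carrier (formal_sums B M l)"
  by (auto simp: tensor_power_def tensor_class_def image_iff)

lemma tensor_algebra_simps [simp]:
  "carrier (tensor_algebra B M) = {f. (\<forall>l. f l \<in> carrier (tensor_power B M l)) \<and>
       finite {l. f l \<noteq> \<zero>\<^bsub>tensor_power B M l\<^esub>}}"
  "mult (tensor_algebra B M) = (\<lambda>f g l. \<Oplus>\<^bsub>tensor_power B M l\<^esub>i\<in>{..l}.
       \<Union>A\<in>f i. \<Union>C\<in>g (l - i). tensor_class B M l (concatenate B A C))"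
  "one (tensor_algebra B M) = (\<lambda>l. if l = 0 then tensor_class B M 0 {#(\<one>\<^bsub>B\<^esub>, [])#} else \<zero>\<^bsub>tensor_power B M l\<^esub>)"
  "zero (tensor_algebra B M) = (\<lambda>l. \<zero>\<^bsub>tensor_power B M l\<^esub>)"
  "add (tensor_algebra B M) = (\<lambda>f g l. f l \<oplus>\<^bsub>tensor_power B M l\<^esub> g l)"
  "leq (tensor_algebra B M) = (\<lambda>f g. \<forall>l. f l \<preceq>\<^bsub>tensor_power B M l\<^esub> g l)"
  "act (tensor_algebra B M) = (\<lambda>b f l. act (tensor_power B M l) b (f l))"
  by (auto simp: tensor_algebra_def)

lemma free_bmod_simps [simp]:
  "carrier (free_bmod B n) = {1..n} \<rightarrow>\<^sub>E carrier B"
  "zero (free_bmod B n) = (\<lambda>i\<in>{1..n}. \<zero>\<^bsub>B\<^esub>)"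
  "add (free_bmod B n) = (\<lambda>x y. \<lambda>i\<in>{1..n}. x i \<oplus>\<^bsub>B\<^esub> y i)"
  "leq (free_bmod B n) = (\<lambda>x y. \<forall>i\<in>{1..n}. x i \<preceq>\<^bsub>B\<^esub> y i)"
  "act (free_bmod B n) = (\<lambda>b x. \<lambda>i\<in>{1..n}. b \<otimes>\<^bsub>B\<^esub> x i)"
  by (simp_all add: free_bmod_def)

locale free_tensor_algebra = ordered_semiring B
  for B :: "('b, 'z) blueprint_scheme" (structure) + fixes n :: nat
begin

abbreviation "V \<equiv> free_bmod B n"
abbreviation "FS l \<equiv> formal_sums B V l"
abbreviation "T \<equiv> tensor_algebra B V"
abbreviation "tle l \<equiv> tensor_le B V l"
abbreviation "tcls l \<equiv> tensor_class B V l"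

lemma tle_refl: "A \<in> carrier (FS l) \<Longrightarrow> tle l A A"
  unfolding tensor_le_def by (rule mod_le.order) auto

lemma tle_carrier:
  assumes "tle l A C" shows "A \<in> carrier (FS l) \<and> C \<in> carrier (FS l)"
  using assms unfolding tensor_le_def
  by (induction rule: mod_le.induct) (fastforce simp del: free_bmod_simps)+

lemma tle_multilinear:
  assumes "(x, y) \<in> multilinear_rels B V" "x \<in> carrier (FS l)" "y \<in> carrier (FS l)"
  shows "tle l x y" "tle l y x"
  using assms unfolding tensor_le_def by (blast intro: mod_le.gen)+

lemma tle_act: "tle l A C \<Longrightarrow> b \<in> carrier B \<Longrightarrow> c \<in> carrier B \<Longrightarrow> b \<preceq> c \<Longrightarrow>
    tle l (act (FS l) b A) (act (FS l) c C)"
  unfolding tensor_le_def by (rule mod_le.act)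

lemma tle_trans: "tle l A C \<Longrightarrow> tle l C D \<Longrightarrow> tle l A D"
  unfolding tensor_le_def by (rule mod_le.trans)

lemma add_preorder_tle: "add_preorder (FS l) (tle l)"
proof (intro add_preorder.intro add_preorder_axioms.intro formal_sums_abelian_monoid)
  fix x y z assume "tle l x y" "z \<in> carrier (FS l)"
  then show "tle l (x \<oplus>\<^bsub>FS l\<^esub> z) (y \<oplus>\<^bsub>FS l\<^esub> z)"
    unfolding tensor_le_def by (rule mod_le.add)
qed (use tle_carrier in \<open>blast intro: tle_refl tle_trans\<close>)+

sublocale tp: add_preorder "FS l" "tle l" for l by (rule add_preorder_tle)

lemma tle_add: "tle l A A' \<Longrightarrow> tle l C C' \<Longrightarrow> tle l (A + C) (A' + C')"
  using tp.r_add2[of l A A' C C'] by simp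

lemma tcls_eq_iff:
  "A \<in> carrier (FS l) \<Longrightarrow> C \<in> carrier (FS l) \<Longrightarrow> tcls l A = tcls l C \<longleftrightarrow> tle l A C \<and> tle l C A"
  unfolding tensor_class_def by (rule tp.cls_eq_iff)

lemma tcls_add:
  "A \<in> carrier (FS l) \<Longrightarrow> C \<in> carrier (FS l) \<Longrightarrow>
    tcls l A \<oplus>\<^bsub>tensor_power B V l\<^esub> tcls l C = tcls l (A + C)"
  unfolding tensor_class_def tensor_power_def using tp.quot_add[of A l C] by simp

lemma tcls_leq:
  "A \<in> carrier (FS l) \<Longrightarrow> C \<in> carrier (FS l) \<Longrightarrow>
    tcls l A \<preceq>\<^bsub>tensor_power B V l\<^esub> tcls l C \<longleftrightarrow> tle l A C"
  unfolding tensor_class_def tensor_power_def using tp.quot_leq[of A l C] by simp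

lemma tcls_act:
  assumes "b \<in> carrier B" "A \<in> carrier (FS l)"
  shows "act (tensor_power B V l) b (tcls l A) = tcls l (act (FS l) b A)"
  unfolding tensor_class_def tensor_power_def bmod_quot_simps
proof (rule tp.quot_map[OF _ assms(2)])
  show "tle l (act (FS l) b x) (act (FS l) b y)" if "tle l x y" for x y
    using that by (rule tle_act) (simp_all only: assms(1) leq_refl)
qed

lemma tensor_power_abelian_monoid: "abelian_monoid (tensor_power B V l)"
  unfolding tensor_power_def
  by (rule abelian_monoid_cong[OF tp.quot_abelian_monoid bmod_quot_simps(1,5,4)])

text \<open>The map \<open>t \<mapsto> c (us \<otimes> t \<otimes> zs)\<close>: left and right multiplication by a fixed pure tensor at once.\<close>

definition wrap :: "'b \<Rightarrow> (nat \<Rightarrow> 'b) list \<Rightarrow> (nat \<Rightarrow> 'b) list \<Rightarrow>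
    ('b, nat \<Rightarrow> 'b) formal_sum \<Rightarrow> ('b, nat \<Rightarrow> 'b) formal_sum" where
  "wrap c us zs = image_mset (\<lambda>(a, xs). (c \<otimes> a, us @ xs @ zs))"

lemma wrap_carrier:
  assumes "c \<in> carrier B" "set us \<subseteq> carrier V" "set zs \<subseteq> carrier V" "A \<in> carrier (FS l)"
  shows "wrap c us zs A \<in> carrier (FS (length us + l + length zs))"
  using assms unfolding wrap_def by (fastforce simp del: free_bmod_simps)

lemma multilinear_cases:
  assumes "(x, y) \<in> multilinear_rels B V"
  obtains (1) a b xs where "x = {#(a \<oplus> b, xs)#}" "y = {#(a, xs), (b, xs)#}" "a \<in> carrier B" "b \<in> carrier B"
    | (2) xs where "x = {#(\<zero>, xs)#}" "y = {#}"
    | (3) b us v w vs where "x = {#(b, us @ [v \<oplus>\<^bsub>V\<^esub> w] @ vs)#}"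
        "y = {#(b, us @ [v] @ vs), (b, us @ [w] @ vs)#}" "v \<in> carrier V" "w \<in> carrier V"
    | (4) b us vs where "x = {#(b, us @ [\<zero>\<^bsub>V\<^esub>] @ vs)#}" "y = {#}"
    | (5) b us d v vs where "x = {#(b, us @ [act V d v] @ vs)#}" "y = {#(b \<otimes> d, us @ [v] @ vs)#}"
        "b \<in> carrier B" "d \<in> carrier B" "v \<in> carrier V"
  using assms unfolding multilinear_rels_def by blast

text \<open>The multilinearity relations allow arbitrary vectors on both sides of the changed position, so each
  family of relations is mapped into itself.\<close>

lemma wrap_multilinear:
  assumes "(x, y) \<in> multilinear_rels B V" "x \<in> carrier (FS l)" "y \<in> carrier (FS l)"
    and "c \<in> carrier B"
  shows "(wrap c us zs x, wrap c us zs y) \<in> multilinear_rels B V"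
proof -
  from assms(1) show ?thesis
  proof (cases rule: multilinear_cases)
    case (1 a b xs)
    have "wrap c us zs x = {#((c \<otimes> a) \<oplus> (c \<otimes> b), us @ xs @ zs)#}"
      "wrap c us zs y = {#(c \<otimes> a, us @ xs @ zs), (c \<otimes> b, us @ xs @ zs)#}"
      using 1 assms(4) by (simp_all add: wrap_def r_distr)
    moreover have "c \<otimes> a \<in> carrier B" "c \<otimes> b \<in> carrier B" using 1 assms(4) by simp_all
    ultimately show ?thesis unfolding multilinear_rels_def by blast
  next
    case (2 xs)
    then have "wrap c us zs x = {#(\<zero>, us @ xs @ zs)#}" "wrap c us zs y = {#}"
      using assms(4) by (simp_all add: wrap_def)
    then show ?thesis unfolding multilinear_rels_def by blast
  next
    case (3 b us' v w vs)
    let ?us = "us @ us'" and ?vs = "vs @ zs"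
    have "wrap c us zs x = {#(c \<otimes> b, ?us @ [v \<oplus>\<^bsub>V\<^esub> w] @ ?vs)#}"
      "wrap c us zs y = {#(c \<otimes> b, ?us @ [v] @ ?vs), (c \<otimes> b, ?us @ [w] @ ?vs)#}"
      using 3 by (simp_all add: wrap_def)
    then show ?thesis unfolding multilinear_rels_def using 3(3,4) by blast
  next
    case (4 b us' vs)
    let ?us = "us @ us'" and ?vs = "vs @ zs"
    have "wrap c us zs x = {#(c \<otimes> b, ?us @ [\<zero>\<^bsub>V\<^esub>] @ ?vs)#}" "wrap c us zs y = {#}"
      using 4 by (simp_all add: wrap_def)
    then show ?thesis unfolding multilinear_rels_def by blast
  next
    case (5 b us' d v vs)
    let ?us = "us @ us'" and ?vs = "vs @ zs"
    have "wrap c us zs x = {#(c \<otimes> b, ?us @ [act V d v] @ ?vs)#}"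
      "wrap c us zs y = {#((c \<otimes> b) \<otimes> d, ?us @ [v] @ ?vs)#}"
      using 5 assms(4) by (simp_all add: wrap_def m_assoc)
    moreover have "c \<otimes> b \<in> carrier B" using 5 assms(4) by simp
    ultimately show ?thesis unfolding multilinear_rels_def using 5(3-5) by blast
  qed
qed

lemma wrap_act:
  assumes "b \<in> carrier B" "c \<in> carrier B" "A \<in> carrier (FS l)"
  shows "wrap c us zs (act (FS l) b A) = act (FS m) b (wrap c us zs A)"
  using assms unfolding wrap_def
  by (auto simp: image_mset.compositionality o_def m_lcomm intro!: image_mset_cong)

text \<open>This is what makes concatenation well defined on tensor classes: it suffices to treat one pure
  tensor at a time.\<close>

lemma tle_wrap:
  assumes "c \<in> carrier B" "set us \<subseteq> carrier V" "set zs \<subseteq> carrier V" "tle l A C"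
  shows "tle (length us + l + length zs) (wrap c us zs A) (wrap c us zs C)"
  using assms(4) unfolding tensor_le_def
proof (induction rule: mod_le.induct)
  case (order x y)
  then show ?case
    using wrap_carrier[OF assms(1-3), of x l] tle_refl unfolding tensor_le_def by simp
next
  case (gen x y)
  note carr = gen(1,2)[THEN wrap_carrier[OF assms(1-3)]]
  from gen(3) consider "(x, y) \<in> multilinear_rels B V" | "(y, x) \<in> multilinear_rels B V"
    | xs ys where "x = {#(\<one>, xs)#}" "y = {#(\<one>, ys)#}" "list_all2 (leq V) xs ys"
    unfolding monotone_rels_def by blast
  then show ?case
  proof cases
    case 3
    let ?l = "length us + l + length zs"
    have 1: "{#(\<one>, us @ xs @ zs)#} \<in> carrier (FS ?l)" "{#(\<one>, us @ ys @ zs)#} \<in> carrier (FS ?l)"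
      using gen(1,2) assms 3 by (auto simp del: free_bmod_simps)
    have r: "list_all2 (leq V) vs vs" if "set vs \<subseteq> carrier V" for vs
      using that by (intro list.rel_refl_strong) (auto simp: PiE_iff intro!: leq_refl)
    have "({#(\<one>, us @ xs @ zs)#}, {#(\<one>, us @ ys @ zs)#}) \<in> monotone_rels B V"
      unfolding monotone_rels_def using 3(3) assms(2,3)
      by (auto intro!: list_all2_appendI r simp del: free_bmod_simps)
    then have "tle ?l {#(\<one>, us @ xs @ zs)#} {#(\<one>, us @ ys @ zs)#}"
      unfolding tensor_le_def using 1 by (intro mod_le.gen) auto
    from tle_act[OF this assms(1) assms(1) leq_refl[OF assms(1)]] show ?thesis
      using 3 unfolding wrap_def tensor_le_def by simp
  next
    case 1
    from tle_multilinear(1)[OF wrap_multilinear[OF this gen(1,2) assms(1)] carr] show ?thesis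
      unfolding tensor_le_def .
  next
    case 2
    from tle_multilinear(2)[OF wrap_multilinear[OF this gen(2,1) assms(1)] carr(2,1)] show ?thesis
      unfolding tensor_le_def .
  qed
next
  case (trans x y z)
  then show ?case by (blast intro: mod_le.trans)
next
  case (add x y z)
  have "wrap c us zs z \<in> carrier (FS (length us + l + length zs))"
    by (rule wrap_carrier) (use assms add in auto)
  from mod_le.add[OF add.IH this] show ?case by (simp add: wrap_def)
next
  case (act a b x y)
  have "x \<in> carrier (FS l)" "y \<in> carrier (FS l)" using act tle_carrier unfolding tensor_le_def by blast+
  then show ?case
    unfolding wrap_act[OF act(1) assms(1) \<open>x \<in> _\<close>, of us zs "length us + l + length zs"]
      wrap_act[OF act(2) assms(1) \<open>y \<in> _\<close>, of us zs "length us + l + length zs"]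
    by (intro mod_le.act[OF act(1-3) act.IH])
qed

lemma concatenate_simps [simp]:
  "concatenate B {#} C = {#}" "concatenate B A {#} = {#}"
  "concatenate B (A + A') C = concatenate B A C + concatenate B A' C"
  "concatenate B A (C + C') = concatenate B A C + concatenate B A C'"
proof -
  show "concatenate B A {#} = {#}" by (induction A) (auto simp: concatenate_def)
  show "concatenate B A (C + C') = concatenate B A C + concatenate B A C'"
    by (induction A) (auto simp: concatenate_def)
qed (auto simp: concatenate_def)

lemma concatenate_single_left: "concatenate B {#(a, xs)#} C = wrap a xs [] C"
  by (simp add: concatenate_def wrap_def)

lemma concatenate_single_right:
  assumes "c \<in> carrier B" "A \<in> carrier (FS l)"
  shows "concatenate B A {#(c, ys)#} = wrap c [] ys A"
  using assms by (induction A) (auto simp: concatenate_def wrap_def m_comm)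

lemma FS_add_mset:
  "add_mset (a, xs) A \<in> carrier (FS l) \<longleftrightarrow>
    a \<in> carrier B \<and> length xs = l \<and> set xs \<subseteq> carrier V \<and> A \<in> carrier (FS l)"
  by auto

lemma concatenate_add_left: "concatenate B (add_mset x A) C = concatenate B A C + concatenate B {#x#} C"
  using concatenate_simps(3)[of A "{#x#}" C] by simp

lemma concatenate_add_right: "concatenate B A (add_mset x C) = concatenate B A C + concatenate B A {#x#}"
  using concatenate_simps(4)[of A C "{#x#}"] by simp

lemma FS_plus: "A \<in> carrier (FS l) \<Longrightarrow> C \<in> carrier (FS l) \<Longrightarrow> A + C \<in> carrier (FS l)"
  by (auto simp del: free_bmod_simps)

lemma concatenate_carrier:
  assumes "A \<in> carrier (FS i)" "C \<in> carrier (FS j)"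
  shows "concatenate B A C \<in> carrier (FS (i + j))"
  using assms(1)
proof (induction A)
  case (add x A)
  obtain a xs where x: "x = (a, xs)" by fastforce
  have "wrap a xs [] C \<in> carrier (FS (i + j))"
    using wrap_carrier[OF _ _ _ assms(2), of a xs "[]"] add.prems unfolding x FS_add_mset by simp
  then show ?case
    using add unfolding x FS_add_mset concatenate_add_left[of "(a, xs)" A] concatenate_single_left
    by (intro FS_plus) auto
qed auto

lemma tle_concatenate_left:
  assumes "A \<in> carrier (FS i)" "tle j C C'"
  shows "tle (i + j) (concatenate B A C) (concatenate B A C')"
  using assms(1)
proof (induction A)
  case empty
  show ?case by (simp add: tle_refl)
next
  case (add x A)
  obtain a xs where x: "x = (a, xs)" by fastforce
  have "tle (i + j) (wrap a xs [] C) (wrap a xs [] C')"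
    using tle_wrap[OF _ _ _ assms(2), of a xs "[]"] add.prems unfolding x FS_add_mset by simp
  then show ?case
    using add unfolding x FS_add_mset concatenate_add_left[of "(a, xs)" A] concatenate_single_left
    by (intro tle_add) auto
qed

lemma tle_concatenate_right:
  assumes "C \<in> carrier (FS j)" "tle i A A'"
  shows "tle (i + j) (concatenate B A C) (concatenate B A' C)"
  using assms(1)
proof (induction C)
  case empty
  show ?case by (simp add: tle_refl)
next
  case (add x C)
  obtain a xs where x: "x = (a, xs)" by fastforce
  have a: "a \<in> carrier B" using add.prems unfolding x FS_add_mset by simp
  have "tle (i + j) (wrap a [] xs A) (wrap a [] xs A')"
    using tle_wrap[OF a _ _ assms(2), of "[]" xs] add.prems unfolding x FS_add_mset by simp
  moreover have "tle (i + j) (concatenate B A C) (concatenate B A' C)"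
    using add unfolding x FS_add_mset by blast
  moreover note carr = tle_carrier[OF assms(2), THEN conjunct1] tle_carrier[OF assms(2), THEN conjunct2]
  ultimately show ?case
    unfolding x concatenate_add_right[of _ "(a, xs)" C] concatenate_single_right[OF a carr(1)]
      concatenate_single_right[OF a carr(2)] by (intro tle_add)
qed

end

section \<open>Linear functionals on formal sums of tensors\<close>

context abelian_monoid
begin

text \<open>The test for membership in the carrier makes the folded function left-commutative on all of the
  type, so that folding over a multiset is defined.\<close>

definition msum :: "('c \<Rightarrow> 'a) \<Rightarrow> 'c multiset \<Rightarrow> 'a" where
  "msum f A = fold_mset (\<lambda>x s. if f x \<in> carrier G \<and> s \<in> carrier G then f x \<oplus> s else s) \<zero> A"

lemma msum_empty [simp]: "msum f {#} = \<zero>"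
  by (simp add: msum_def)

lemma msum_add_mset_aux:
  "msum f (add_mset x A) = (if f x \<in> carrier G \<and> msum f A \<in> carrier G then f x \<oplus> msum f A else msum f A)"
proof -
  interpret comp_fun_commute "\<lambda>x s. if f x \<in> carrier G \<and> s \<in> carrier G then f x \<oplus> s else s"
    by standard (auto simp: fun_eq_iff a_lcomm)
  show ?thesis by (simp add: msum_def)
qed

lemma msum_closed [simp]: "msum f A \<in> carrier G"
  by (induction A) (auto simp: msum_add_mset_aux)

lemma msum_add_mset [simp]: "f x \<in> carrier G \<Longrightarrow> msum f (add_mset x A) = f x \<oplus> msum f A"
  by (simp add: msum_add_mset_aux)

lemma msum_union:
  "(\<And>x. x \<in># A \<Longrightarrow> f x \<in> carrier G) \<Longrightarrow> msum f (A + C) = msum f A \<oplus> msum f C"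
  by (induction A) (auto simp: a_assoc)

end

context ordered_semiring
begin

lemma add_mono:
  assumes "x \<in> carrier R" "x' \<in> carrier R" "y \<in> carrier R" "y' \<in> carrier R" "x \<preceq> x'" "y \<preceq> y'"
  shows "x \<oplus> y \<preceq> x' \<oplus> y'"
proof -
  have "x \<oplus> y \<preceq> x' \<oplus> y" using assms by (intro leq_add)
  moreover have "y \<oplus> x' \<preceq> y' \<oplus> x'" using assms by (intro leq_add)
  ultimately show ?thesis
    using leq_trans[of "x \<oplus> y" "x' \<oplus> y" "x' \<oplus> y'"] assms by (simp add: a_comm)
qed

lemma mult_mono:
  assumes "x \<in> carrier R" "x' \<in> carrier R" "y \<in> carrier R" "y' \<in> carrier R" "x \<preceq> x'" "y \<preceq> y'"
  shows "x \<otimes> y \<preceq> x' \<otimes> y'"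
proof -
  have "x \<otimes> y \<preceq> x' \<otimes> y" using assms by (intro leq_mult)
  moreover have "y \<otimes> x' \<preceq> y' \<otimes> x'" using assms by (intro leq_mult)
  ultimately show ?thesis
    using leq_trans[of "x \<otimes> y" "x' \<otimes> y" "x' \<otimes> y'"] assms by (simp add: m_comm)
qed

lemma finsum_mono:
  assumes "\<And>i. i \<in> A \<Longrightarrow> f i \<in> carrier R" "\<And>i. i \<in> A \<Longrightarrow> g i \<in> carrier R"
    and "\<And>i. i \<in> A \<Longrightarrow> f i \<preceq> g i"
  shows "finsum R f A \<preceq> finsum R g A"
  using assms
proof (induction A rule: infinite_finite_induct)
  case (insert x A)
  have "f \<in> A \<rightarrow> carrier R" "g \<in> A \<rightarrow> carrier R" using insert.prems by auto
  then show ?case using insert by (simp add: add_mono)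
qed (simp_all add: leq_refl)

end

text \<open>The value at \<open>x\<^sub>1 \<otimes> \<dots> \<otimes> x\<^sub>l\<close> of the linear functional that takes the basis tensor of a word \<open>w\<close> to
  \<open>\<chi> w\<close>, obtained by expanding one vector after the other.\<close>

primrec expand :: "('b, 'z) blueprint_scheme \<Rightarrow> nat \<Rightarrow> (nat \<Rightarrow> 'b) list \<Rightarrow> (nat list \<Rightarrow> 'b) \<Rightarrow> 'b" where
  "expand B n [] \<chi> = \<chi> []"
| "expand B n (x # xs) \<chi> = (\<Oplus>\<^bsub>B\<^esub>i\<in>{1..n}. x i \<otimes>\<^bsub>B\<^esub> expand B n xs (\<lambda>w. \<chi> (i # w)))"

context free_tensor_algebra
begin

declare free_bmod_simps [simp del]

abbreviation "weight \<chi> \<equiv> \<forall>w. \<chi> w \<in> carrier B"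

lemma vec_closed [simp]: "x \<in> carrier V \<Longrightarrow> i \<in> {1..n} \<Longrightarrow> x i \<in> carrier B"
  by (auto simp: PiE_iff free_bmod_simps)

lemma weight_Cons: "weight \<chi> \<Longrightarrow> weight (\<lambda>w. \<chi> (i # w))"
  by auto

lemma expand_closed: "weight \<chi> \<Longrightarrow> set xs \<subseteq> carrier V \<Longrightarrow> expand B n xs \<chi> \<in> carrier B"
proof (induction xs arbitrary: \<chi>)
  case (Cons x xs)
  then have "expand B n xs (\<lambda>w. \<chi> (i # w)) \<in> carrier B" for i
    by (intro Cons.IH) auto
  then show ?case using Cons.prems by (auto intro!: finsum_closed)
qed auto

lemma expand_zero: "set xs \<subseteq> carrier V \<Longrightarrow> expand B n xs (\<lambda>_. \<zero>) = \<zero>"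
proof (induction xs)
  case (Cons x xs)
  then have "expand B n (x # xs) (\<lambda>_. \<zero>) = (\<Oplus>i\<in>{1..n}. \<zero>)"
    unfolding expand.simps by (intro finsum_cong') auto
  then show ?case by simp
qed auto

lemma expand_add:
  "weight \<chi> \<Longrightarrow> weight \<chi>' \<Longrightarrow> set xs \<subseteq> carrier V \<Longrightarrow>
    expand B n xs (\<lambda>w. \<chi> w \<oplus> \<chi>' w) = expand B n xs \<chi> \<oplus> expand B n xs \<chi>'"
proof (induction xs arbitrary: \<chi> \<chi>')
  case (Cons x xs)
  have x: "x \<in> carrier V" and xs: "set xs \<subseteq> carrier V" using Cons.prems by auto
  note cl = expand_closed[OF weight_Cons xs] vec_closed[OF x]
  have "expand B n (x # xs) (\<lambda>w. \<chi> w \<oplus> \<chi>' w) =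
      (\<Oplus>i\<in>{1..n}. x i \<otimes> expand B n xs (\<lambda>w. \<chi> (i # w)) \<oplus> x i \<otimes> expand B n xs (\<lambda>w. \<chi>' (i # w)))"
    unfolding expand.simps
    using Cons.IH[OF weight_Cons[OF Cons.prems(1)] weight_Cons[OF Cons.prems(2)] xs] cl Cons.prems(1,2)
    by (intro finsum_cong') (auto simp: r_distr)
  also have "\<dots> = expand B n (x # xs) \<chi> \<oplus> expand B n (x # xs) \<chi>'"
    unfolding expand.simps using cl Cons.prems(1,2) by (intro finsum_addf) auto
  finally show ?case .
qed auto

lemma expand_scale:
  "weight \<chi> \<Longrightarrow> c \<in> carrier B \<Longrightarrow> set xs \<subseteq> carrier V \<Longrightarrow> expand B n xs (\<lambda>w. c \<otimes> \<chi> w) = c \<otimes> expand B n xs \<chi>"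
proof (induction xs arbitrary: \<chi>)
  case (Cons x xs)
  have x: "x \<in> carrier V" and xs: "set xs \<subseteq> carrier V" using Cons.prems by auto
  note cl = expand_closed[OF weight_Cons[OF Cons.prems(1)] xs] vec_closed[OF x]
  have "expand B n (x # xs) (\<lambda>w. c \<otimes> \<chi> w) = (\<Oplus>i\<in>{1..n}. c \<otimes> (x i \<otimes> expand B n xs (\<lambda>w. \<chi> (i # w))))"
    unfolding expand.simps
    using Cons.IH[OF weight_Cons[OF Cons.prems(1)] Cons.prems(2) xs] cl Cons.prems(2)
    by (intro finsum_cong') (auto simp: m_lcomm)
  also have "\<dots> = c \<otimes> expand B n (x # xs) \<chi>"
    unfolding expand.simps using cl Cons.prems(2) by (intro finsum_rdistr[symmetric]) auto
  finally show ?case .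
qed auto

lemma expand_mono:
  "weight \<chi> \<Longrightarrow> weight \<chi>' \<Longrightarrow> (\<And>w. \<chi> w \<preceq> \<chi>' w) \<Longrightarrow> set xs \<subseteq> carrier V \<Longrightarrow> expand B n xs \<chi> \<preceq> expand B n xs \<chi>'"
proof (induction xs arbitrary: \<chi> \<chi>')
  case (Cons x xs)
  have x: "x \<in> carrier V" and xs: "set xs \<subseteq> carrier V" using Cons.prems by auto
  note cl = expand_closed[OF weight_Cons xs] vec_closed[OF x]
  have "expand B n xs (\<lambda>w. \<chi> (i # w)) \<preceq> expand B n xs (\<lambda>w. \<chi>' (i # w))" for i
    using Cons.prems by (intro Cons.IH) auto
  then show ?case
    unfolding expand.simps using cl Cons.prems(1,2) by (intro finsum_mono mult_mono leq_refl) auto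
qed auto

text \<open>A functional on a product is evaluated by letting the right factor produce a new function of words
  for the left factor. This is the source of all multiplicativity statements below.\<close>

lemma expand_append: "expand B n (xs @ ys) \<chi> = expand B n xs (\<lambda>w. expand B n ys (\<lambda>u. \<chi> (w @ u)))"
  by (induction xs arbitrary: \<chi>) auto

lemma weight_expand: "weight \<chi> \<Longrightarrow> set ys \<subseteq> carrier V \<Longrightarrow> weight (\<lambda>w. expand B n ys (\<lambda>u. \<chi> (w @ u)))"
  by (auto intro: expand_closed)

lemma expand_mono_vec:
  "list_all2 (leq V) xs ys \<Longrightarrow> weight \<chi> \<Longrightarrow> set xs \<subseteq> carrier V \<Longrightarrow> set ys \<subseteq> carrier V \<Longrightarrow>
    expand B n xs \<chi> \<preceq> expand B n ys \<chi>"
proof (induction xs ys arbitrary: \<chi> rule: list_all2_induct)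
  case (Cons x xs y ys)
  have x: "x \<in> carrier V" and xs: "set xs \<subseteq> carrier V" and y: "y \<in> carrier V" and ys: "set ys \<subseteq> carrier V"
    using Cons.prems by auto
  note cl = expand_closed[OF weight_Cons[OF Cons.prems(1)] xs] expand_closed[OF weight_Cons[OF Cons.prems(1)] ys]
     vec_closed[OF x] vec_closed[OF y]
  have "expand B n xs (\<lambda>w. \<chi> (i # w)) \<preceq> expand B n ys (\<lambda>w. \<chi> (i # w))" for i
    using Cons.prems by (intro Cons.IH) auto
  moreover have "x i \<preceq> y i" if "i \<in> {1..n}" for i
    using Cons.hyps(1) that by (simp add: free_bmod_simps)
  ultimately show ?case
    unfolding expand.simps using cl by (intro finsum_mono mult_mono m_closed) auto
qed (auto intro: leq_refl)

lemma V_add_closed: "x \<in> carrier V \<Longrightarrow> y \<in> carrier V \<Longrightarrow> x \<oplus>\<^bsub>V\<^esub> y \<in> carrier V"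
  by (auto simp: PiE_iff free_bmod_simps)

lemma V_act_closed: "x \<in> carrier V \<Longrightarrow> b \<in> carrier B \<Longrightarrow> act V b x \<in> carrier V"
  by (auto simp: PiE_iff free_bmod_simps)

lemma V_zero_closed: "\<zero>\<^bsub>V\<^esub> \<in> carrier V"
  by (auto simp: free_bmod_simps)

lemma expand_vec_add:
  assumes "weight \<chi>" "set us \<subseteq> carrier V" "set vs \<subseteq> carrier V" "x \<in> carrier V" "y \<in> carrier V"
  shows "expand B n (us @ [x \<oplus>\<^bsub>V\<^esub> y] @ vs) \<chi> = expand B n (us @ [x] @ vs) \<chi> \<oplus> expand B n (us @ [y] @ vs) \<chi>"
proof -
  have "expand B n ((x \<oplus>\<^bsub>V\<^esub> y) # vs) \<psi> = expand B n (x # vs) \<psi> \<oplus> expand B n (y # vs) \<psi>" if "weight \<psi>" for \<psi>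
  proof -
    note cl = expand_closed[OF weight_Cons[OF that] assms(3)] vec_closed[OF assms(4)] vec_closed[OF assms(5)]
    have "expand B n ((x \<oplus>\<^bsub>V\<^esub> y) # vs) \<psi> =
        (\<Oplus>i\<in>{1..n}. x i \<otimes> expand B n vs (\<lambda>w. \<psi> (i # w)) \<oplus> y i \<otimes> expand B n vs (\<lambda>w. \<psi> (i # w)))"
      unfolding expand.simps using cl by (intro finsum_cong') (auto simp: l_distr free_bmod_simps)
    also have "\<dots> = expand B n (x # vs) \<psi> \<oplus> expand B n (y # vs) \<psi>"
      unfolding expand.simps using cl by (intro finsum_addf) auto
    finally show ?thesis .
  qed
  from this[of "\<lambda>u. \<chi> (_ @ u)"] assms(1)
  have "expand B n (us @ [x \<oplus>\<^bsub>V\<^esub> y] @ vs) \<chi> =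
      expand B n us (\<lambda>w. expand B n (x # vs) (\<lambda>u. \<chi> (w @ u)) \<oplus> expand B n (y # vs) (\<lambda>u. \<chi> (w @ u)))"
    unfolding expand_append[of us] append_Cons append_Nil by (intro arg_cong[of _ _ "expand B n us"] ext) (auto simp del: expand.simps)
  also have "\<dots> = expand B n (us @ [x] @ vs) \<chi> \<oplus> expand B n (us @ [y] @ vs) \<chi>"
    unfolding expand_append[of us] append_Cons append_Nil
    by (rule expand_add) (use assms in \<open>auto simp del: expand.simps intro!: expand_closed\<close>)
  finally show ?thesis .
qed

lemma expand_vec_zero:
  assumes "weight \<chi>" "set us \<subseteq> carrier V" "set vs \<subseteq> carrier V"
  shows "expand B n (us @ [\<zero>\<^bsub>V\<^esub>] @ vs) \<chi> = \<zero>"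
proof -
  have "expand B n (\<zero>\<^bsub>V\<^esub> # vs) \<psi> = \<zero>" if "weight \<psi>" for \<psi>
  proof -
    have "expand B n (\<zero>\<^bsub>V\<^esub> # vs) \<psi> = (\<Oplus>i\<in>{1..n}. \<zero>)"
      unfolding expand.simps using expand_closed[OF weight_Cons[OF that] assms(3)]
      by (intro finsum_cong') (auto simp: free_bmod_simps)
    then show ?thesis by simp
  qed
  from this[of "\<lambda>u. \<chi> (_ @ u)"] assms(1) have "expand B n (us @ [\<zero>\<^bsub>V\<^esub>] @ vs) \<chi> = expand B n us (\<lambda>w. \<zero>)"
    unfolding expand_append[of us] append_Cons append_Nil by (intro arg_cong[of _ _ "expand B n us"] ext) (auto simp del: expand.simps)
  then show ?thesis using expand_zero[OF assms(2)] by simp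
qed

lemma expand_vec_act:
  assumes "weight \<chi>" "set us \<subseteq> carrier V" "set vs \<subseteq> carrier V" "x \<in> carrier V" "c \<in> carrier B"
  shows "expand B n (us @ [act V c x] @ vs) \<chi> = c \<otimes> expand B n (us @ [x] @ vs) \<chi>"
proof -
  have "expand B n (act V c x # vs) \<psi> = c \<otimes> expand B n (x # vs) \<psi>" if "weight \<psi>" for \<psi>
  proof -
    note cl = expand_closed[OF weight_Cons[OF that] assms(3)] vec_closed[OF assms(4)]
    have "expand B n (act V c x # vs) \<psi> = (\<Oplus>i\<in>{1..n}. c \<otimes> (x i \<otimes> expand B n vs (\<lambda>w. \<psi> (i # w))))"
      unfolding expand.simps using cl assms(5) by (intro finsum_cong') (auto simp: m_assoc free_bmod_simps)
    also have "\<dots> = c \<otimes> expand B n (x # vs) \<psi>"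
      unfolding expand.simps using cl assms(5) by (intro finsum_rdistr[symmetric]) auto
    finally show ?thesis .
  qed
  from this[of "\<lambda>u. \<chi> (_ @ u)"] assms(1)
  have "expand B n (us @ [act V c x] @ vs) \<chi> = expand B n us (\<lambda>w. c \<otimes> expand B n (x # vs) (\<lambda>u. \<chi> (w @ u)))"
    unfolding expand_append[of us] append_Cons append_Nil by (intro arg_cong[of _ _ "expand B n us"] ext) (auto simp del: expand.simps)
  also have "\<dots> = c \<otimes> expand B n (us @ [x] @ vs) \<chi>"
    unfolding expand_append[of us] append_Cons append_Nil
    by (rule expand_scale) (use assms in \<open>auto simp del: expand.simps intro!: expand_closed\<close>)
  finally show ?thesis .
qed

lemma unit_vec_closed: "unit_vec B n i \<in> carrier V"
  by (auto simp: unit_vec_def free_bmod_simps)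

lemma expand_unit_vec: "weight \<chi> \<Longrightarrow> set w \<subseteq> {1..n} \<Longrightarrow> expand B n (map (unit_vec B n) w) \<chi> = \<chi> w"
proof (induction w arbitrary: \<chi>)
  case (Cons i w)
  let ?f = "\<lambda>j. expand B n (map (unit_vec B n) w) (\<lambda>u. \<chi> (j # u))"
  have cl: "?f j \<in> carrier B" for j
    by (rule expand_closed[OF weight_Cons[OF Cons.prems(1)]]) (auto simp: unit_vec_closed)
  have "expand B n (map (unit_vec B n) (i # w)) \<chi> = (\<Oplus>j\<in>{1..n}. if i = j then ?f j else \<zero>)"
    unfolding list.map expand.simps using cl by (intro finsum_cong') (auto simp: unit_vec_def)
  also have "\<dots> = ?f i"
    using cl Cons.prems by (intro finsum_singleton) auto
  finally show ?case using Cons.IH[OF weight_Cons[OF Cons.prems(1)], of i] Cons.prems by simp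
qed auto

definition functional :: "(nat list \<Rightarrow> 'b) \<Rightarrow> ('b, nat \<Rightarrow> 'b) formal_sum \<Rightarrow> 'b" where
  "functional \<chi> = msum (\<lambda>(b, xs). b \<otimes> expand B n xs \<chi>)"

lemma functional_empty [simp]: "functional \<chi> {#} = \<zero>"
  and functional_closed [simp]: "functional \<chi> A \<in> carrier B"
  by (simp_all add: functional_def)

lemma functional_add_mset:
  assumes "weight \<chi>" "b \<in> carrier B" "set xs \<subseteq> carrier V"
  shows "functional \<chi> (add_mset (b, xs) A) = b \<otimes> expand B n xs \<chi> \<oplus> functional \<chi> A"
  using expand_closed[OF assms(1,3)] assms(2) by (simp add: functional_def)

lemma functional_union:
  assumes "weight \<chi>" "A \<in> carrier (FS l)"
  shows "functional \<chi> (A + C) = functional \<chi> A \<oplus> functional \<chi> C"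
  unfolding functional_def
  by (rule msum_union) (use assms in \<open>auto intro!: expand_closed\<close>)

lemma functional_mono_weight:
  assumes "weight \<chi>" "weight \<chi>'" "\<And>w. \<chi> w \<preceq> \<chi>' w" "A \<in> carrier (FS l)"
  shows "functional \<chi> A \<preceq> functional \<chi>' A"
  using assms(4)
proof (induction A)
  case (add x A)
  obtain b xs where x: "x = (b, xs)" by fastforce
  have b: "b \<in> carrier B" "set xs \<subseteq> carrier V" "A \<in> carrier (FS l)"
    using add.prems unfolding x FS_add_mset by auto
  show ?case
    unfolding x functional_add_mset[OF assms(1) b(1,2)] functional_add_mset[OF assms(2) b(1,2)]
    using b add.IH expand_closed[OF assms(1) b(2)] expand_closed[OF assms(2) b(2)] expand_mono[OF assms(1-3) b(2)]
    by (intro add_mono mult_mono leq_refl m_closed functional_closed) auto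
qed (simp add: leq_refl)

lemma functional_scale_weight:
  assumes "weight \<chi>" "c \<in> carrier B" "A \<in> carrier (FS l)"
  shows "functional (\<lambda>w. c \<otimes> \<chi> w) A = c \<otimes> functional \<chi> A"
  using assms(3)
proof (induction A)
  case (add x A)
  obtain b xs where x: "x = (b, xs)" by fastforce
  have b: "b \<in> carrier B" "set xs \<subseteq> carrier V" "A \<in> carrier (FS l)"
    using add.prems unfolding x FS_add_mset by auto
  have w: "weight (\<lambda>w. c \<otimes> \<chi> w)" using assms by auto
  show ?case
    unfolding x functional_add_mset[OF assms(1) b(1,2)] functional_add_mset[OF w b(1,2)]
      add.IH[OF b(3)] expand_scale[OF assms(1,2) b(2)]
    using b expand_closed[OF assms(1) b(2)] assms(2)
    by (simp add: r_distr m_lcomm)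
qed (use assms in simp)

lemma functional_zero_weight:
  assumes "A \<in> carrier (FS l)"
  shows "functional (\<lambda>w. \<zero>) A = \<zero>"
  using functional_scale_weight[of "\<lambda>_. \<zero>" \<zero> A l] assms by simp

lemma functional_act:
  assumes "weight \<chi>" "c \<in> carrier B" "A \<in> carrier (FS l)"
  shows "functional \<chi> (act (FS m) c A) = c \<otimes> functional \<chi> A"
  using assms(3)
proof (induction A)
  case (add x A)
  obtain b xs where x: "x = (b, xs)" by fastforce
  have b: "b \<in> carrier B" "set xs \<subseteq> carrier V" "A \<in> carrier (FS l)"
    using add.prems unfolding x FS_add_mset by auto
  have "act (FS m) c (add_mset x A) = add_mset (c \<otimes> b, xs) (act (FS m) c A)" by (simp add: x)
  moreover have "c \<otimes> b \<in> carrier B" using b assms by simp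
  ultimately show ?case
    using functional_add_mset[OF assms(1) _ b(2)] expand_closed[OF assms(1) b(2)] b add.IH[OF b(3)] assms(2)
    by (simp add: x r_distr m_assoc)
qed (use assms in simp)

text \<open>Expanding in the standard basis is multilinear and monotone in the vectors, hence respects every
  generator of the preorder of the tensor power. This is where the freeness of the tensor power on the words comes from.\<close>

lemma functional_tle:
  assumes "weight \<chi>" "tle l A C"
  shows "functional \<chi> A \<preceq> functional \<chi> C"
  using assms(2) unfolding tensor_le_def
proof (induction rule: mod_le.induct)
  case (order x y)
  then show ?case by (simp add: leq_refl)
next
  case (gen x y)
  have multi: "functional \<chi> x = functional \<chi> y"
    if "(x, y) \<in> multilinear_rels B V" "x \<in> carrier (FS l)" "y \<in> carrier (FS l)" for x y
  proof -
    note fa = functional_add_mset[OF assms(1)]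
    from that(1) show ?thesis
    proof (cases rule: multilinear_cases)
      case (1 a b xs)
      then have xs: "set xs \<subseteq> carrier V" using that(2) unfolding 1(1) FS_add_mset by blast
      show ?thesis using 1(3,4) expand_closed[OF assms(1) xs] by (simp add: 1(1,2) fa[OF _ xs] l_distr)
    next
      case (2 xs)
      then have xs: "set xs \<subseteq> carrier V" using that(2) unfolding 2(1) FS_add_mset by blast
      show ?thesis using expand_closed[OF assms(1) xs] by (simp add: 2 fa[OF _ xs])
    next
      case (3 b us v w vs)
      then have s: "set us \<subseteq> carrier V" "set vs \<subseteq> carrier V" and b: "b \<in> carrier B"
        using that(2) unfolding 3(1) FS_add_mset by auto
      have s': "set (us @ [v] @ vs) \<subseteq> carrier V" "set (us @ [w] @ vs) \<subseteq> carrier V"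
         "set (us @ [v \<oplus>\<^bsub>V\<^esub> w] @ vs) \<subseteq> carrier V"
        using s 3(3,4) V_add_closed[OF 3(3,4)] by simp_all
      show ?thesis
        unfolding 3(1,2) fa[OF b s'(1)] fa[OF b s'(2)] fa[OF b s'(3)] expand_vec_add[OF assms(1) s 3(3,4)]
        using b expand_closed[OF assms(1) s'(1)] expand_closed[OF assms(1) s'(2)] by (simp only: r_distr functional_empty r_zero a_closed m_closed)
    next
      case (4 b us vs)
      then have s: "set us \<subseteq> carrier V" "set vs \<subseteq> carrier V" and b: "b \<in> carrier B"
        using that(2) unfolding 4(1) FS_add_mset by auto
      have s': "set (us @ [\<zero>\<^bsub>V\<^esub>] @ vs) \<subseteq> carrier V"
        using s V_zero_closed by simp
      show ?thesis
        unfolding 4(1,2) fa[OF b s'] expand_vec_zero[OF assms(1) s] using b by simp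
    next
      case (5 b us d v vs)
      then have s: "set us \<subseteq> carrier V" "set vs \<subseteq> carrier V"
        using that(2) unfolding 5(1) FS_add_mset by auto
      have s': "set (us @ [v] @ vs) \<subseteq> carrier V" "set (us @ [act V d v] @ vs) \<subseteq> carrier V"
        using s 5 V_act_closed[OF 5(5,4)] by simp_all
      have bd: "b \<otimes> d \<in> carrier B" using 5 by simp
      show ?thesis
        unfolding 5(1,2) fa[OF bd s'(1)] fa[OF 5(3) s'(2)] expand_vec_act[OF assms(1) s 5(5,4)]
        using 5(3,4) expand_closed[OF assms(1) s'(1)] by (simp only: m_assoc)
    qed
  qed
  from gen(3) consider "(x, y) \<in> multilinear_rels B V" | "(y, x) \<in> multilinear_rels B V"
    | xs ys where "x = {#(\<one>, xs)#}" "y = {#(\<one>, ys)#}" "list_all2 (leq V) xs ys"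
    unfolding monotone_rels_def by blast
  then show ?case
  proof cases
    case 1
    from multi[OF this gen(1,2)] show ?thesis by (simp add: leq_refl)
  next
    case 2
    from multi[OF this gen(2,1)] show ?thesis by (simp add: leq_refl)
  next
    case (3 xs ys)
    have s: "set xs \<subseteq> carrier V" "set ys \<subseteq> carrier V" using gen(1,2) unfolding 3(1,2) FS_add_mset by blast+
    show ?thesis
      using expand_mono_vec[OF 3(3) assms(1) s] expand_closed[OF assms(1) s(1)] expand_closed[OF assms(1) s(2)]
      by (simp add: 3(1,2) functional_add_mset[OF assms(1) _ s(1)] functional_add_mset[OF assms(1) _ s(2)])
  qed
next
  case (trans x y z)
  show ?case by (rule leq_trans[OF _ _ _ trans.IH]) simp_all
next
  case (add x y z)
  have "x \<in> carrier (FS l)" "y \<in> carrier (FS l)" using add tle_carrier unfolding tensor_le_def by blast+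
  then show ?case
    using functional_union[OF assms(1)] add.IH by (simp add: leq_add del: formal_sums_simps(1))
next
  case (act a b x y)
  have "x \<in> carrier (FS l)" "y \<in> carrier (FS l)" using act tle_carrier unfolding tensor_le_def by blast+
  then show ?case
    unfolding functional_act[OF assms(1) act(1) \<open>x \<in> _\<close>] functional_act[OF assms(1) act(2) \<open>y \<in> _\<close>]
    using act by (intro mult_mono) simp_all
qed

lemma functional_wrap:
  assumes "weight \<chi>" "a \<in> carrier B" "set xs \<subseteq> carrier V" "C \<in> carrier (FS j)"
  shows "functional \<chi> (wrap a xs [] C) = a \<otimes> expand B n xs (\<lambda>w. functional (\<lambda>u. \<chi> (w @ u)) C)"
  using assms(4)
proof (induction C)
  case empty
  then show ?case using assms by (simp add: wrap_def expand_zero)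
next
  case (add x C)
  obtain c ys where x: "x = (c, ys)" by fastforce
  have c: "c \<in> carrier B" "set ys \<subseteq> carrier V" "C \<in> carrier (FS j)"
    using add.prems unfolding x FS_add_mset by auto
  have w: "weight (\<lambda>u. \<chi> (w @ u))" for w using assms by auto
  have w': "weight (\<lambda>w. expand B n ys (\<lambda>u. \<chi> (w @ u)))" by (rule weight_expand) (use assms c in auto)
  have "wrap a xs [] (add_mset x C) = add_mset (a \<otimes> c, xs @ ys) (wrap a xs [] C)"
    by (simp add: wrap_def x)
  moreover have "a \<otimes> c \<in> carrier B" "set (xs @ ys) \<subseteq> carrier V" using assms c by (auto)
  ultimately have "functional \<chi> (wrap a xs [] (add_mset x C)) =
     (a \<otimes> c) \<otimes> expand B n (xs @ ys) \<chi> \<oplus> a \<otimes> expand B n xs (\<lambda>w. functional (\<lambda>u. \<chi> (w @ u)) C)"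
    using functional_add_mset[OF assms(1)] add.IH[OF c(3)] by simp
  also have "\<dots> = a \<otimes> (c \<otimes> expand B n xs (\<lambda>w. expand B n ys (\<lambda>u. \<chi> (w @ u))) \<oplus> expand B n xs (\<lambda>w. functional (\<lambda>u. \<chi> (w @ u)) C))"
    using assms(2) c expand_closed[OF w' assms(3)] expand_closed[OF _ assms(3), of "\<lambda>w. functional (\<lambda>u. \<chi> (w @ u)) C"]
    by (simp add: expand_append m_assoc r_distr)
  also have "c \<otimes> expand B n xs (\<lambda>w. expand B n ys (\<lambda>u. \<chi> (w @ u))) \<oplus> expand B n xs (\<lambda>w. functional (\<lambda>u. \<chi> (w @ u)) C) =
      expand B n xs (\<lambda>w. c \<otimes> expand B n ys (\<lambda>u. \<chi> (w @ u)) \<oplus> functional (\<lambda>u. \<chi> (w @ u)) C)"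
    using w' c(1) by (subst expand_add) (auto simp: assms(3) expand_scale)
  also have "\<dots> = expand B n xs (\<lambda>w. functional (\<lambda>u. \<chi> (w @ u)) (add_mset x C))"
    unfolding x functional_add_mset[OF w c(1,2)] ..
  finally show ?case .
qed

text \<open>The functional of a product is a functional of the left factor, with a function of words that
  depends on the right factor.\<close>

lemma functional_concatenate:
  assumes "weight \<chi>" "A \<in> carrier (FS i)" "C \<in> carrier (FS j)"
  shows "functional \<chi> (concatenate B A C) = functional (\<lambda>w. functional (\<lambda>u. \<chi> (w @ u)) C) A"
  using assms(2)
proof (induction A)
  case (add x A)
  obtain a xs where x: "x = (a, xs)" by fastforce
  have a: "a \<in> carrier B" "set xs \<subseteq> carrier V" "A \<in> carrier (FS i)"
    using add.prems unfolding x FS_add_mset by auto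
  have w: "weight (\<lambda>w. functional (\<lambda>u. \<chi> (w @ u)) C)" by auto
  have "functional \<chi> (concatenate B (add_mset x A) C) =
      functional \<chi> (concatenate B A C) \<oplus> functional \<chi> (wrap a xs [] C)"
    unfolding concatenate_add_left[of x A] unfolding x concatenate_single_left
    by (rule functional_union[OF assms(1) concatenate_carrier[OF a(3) assms(3)]])
  then show ?case
    unfolding x functional_add_mset[OF w a(1,2)] functional_wrap[OF assms(1) a(1,2) assms(3)] add.IH[OF a(3)]
    using a expand_closed[OF w a(2)] by (simp add: a_comm)
qed simp

end

section \<open>Graded normal form of the tensor algebra\<close>

declare tensor_algebra_simps [simp del] tensor_power_simps [simp del] formal_sums_simps(1) [simp del]

context free_tensor_algebra
begin

text \<open>Elements of the tensor algebra are sequences of classes. Working with sequences of representatives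
  turns all operations into operations on multisets.\<close>

definition graded :: "(nat \<Rightarrow> ('b, nat \<Rightarrow> 'b) formal_sum) \<Rightarrow> bool" where
  "graded F \<longleftrightarrow> (\<forall>l. F l \<in> carrier (FS l)) \<and> finite {l. F l \<noteq> {#}}"

definition tens :: "(nat \<Rightarrow> ('b, nat \<Rightarrow> 'b) formal_sum) \<Rightarrow> ('b, nat \<Rightarrow> 'b) tensor" where
  "tens F = (\<lambda>l. tcls l (F l))"

definition in_degree :: "nat \<Rightarrow> ('b, nat \<Rightarrow> 'b) formal_sum \<Rightarrow> ('b, nat \<Rightarrow> 'b) tensor" where
  "in_degree l A = tens (\<lambda>m. if m = l then A else {#})"

lemma gradedD: "graded F \<Longrightarrow> F l \<in> carrier (FS l)"
  by (simp add: graded_def)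

lemma FS_empty [simp]: "{#} \<in> carrier (FS l)"
  by (simp add: formal_sums_simps)

lemma FS_single [simp]:
  "{#(a, xs)#} \<in> carrier (FS l) \<longleftrightarrow> a \<in> carrier B \<and> length xs = l \<and> set xs \<subseteq> carrier V"
  by (auto simp: formal_sums_simps)

lemma FS_act: "b \<in> carrier B \<Longrightarrow> A \<in> carrier (FS l) \<Longrightarrow> act (FS l) b A \<in> carrier (FS l)"
  using tle_carrier[OF tle_act[OF tle_refl _ _ leq_refl]] by blast

lemma FS_sum: "(\<And>i. i \<in> S \<Longrightarrow> A i \<in> carrier (FS l)) \<Longrightarrow> (\<Sum>i\<in>S. A i) \<in> carrier (FS l)"
  by (induction S rule: infinite_finite_induct) (auto intro: FS_plus)

text \<open>Choosing the empty sum in the degrees where the class is zero keeps the support finite.\<close>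

lemma T_carrier: "carrier T = tens ` Collect graded"
proof (intro equalityI subsetI)
  fix f assume "f \<in> carrier T"
  then have f: "\<And>l. f l \<in> tcls l ` carrier (FS l)" "finite {l. f l \<noteq> tcls l {#}}"
    by (auto simp: tensor_algebra_simps tensor_power_simps)
  \<comment> \<open>Representatives of the components of \<open>f\<close>.\<close>
  define F where "F l = (if f l = tcls l {#} then {#} else (SOME A. A \<in> carrier (FS l) \<and> f l = tcls l A))" for l
  have F: "F l \<in> carrier (FS l) \<and> f l = tcls l (F l)" for l
  proof (cases "f l = tcls l {#}")
    case False
    then show ?thesis using f(1)[of l] unfolding F_def by simp (rule someI_ex, blast)
  qed (simp add: F_def)
  have "{l. F l \<noteq> {#}} \<subseteq> {l. f l \<noteq> tcls l {#}}" by (auto simp: F_def)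
  then have "graded F" using F f(2) finite_subset by (auto simp: graded_def)
  moreover have "f = tens F" using F by (auto simp: tens_def)
  ultimately show "f \<in> tens ` Collect graded" by blast
next
  fix f assume "f \<in> tens ` Collect graded"
  then obtain F where F: "graded F" "f = tens F" by blast
  have "{l. tcls l (F l) \<noteq> tcls l {#}} \<subseteq> {l. F l \<noteq> {#}}" by auto
  then have "finite {l. tcls l (F l) \<noteq> tcls l {#}}" using F(1) finite_subset by (auto simp: graded_def)
  then show "f \<in> carrier T" using F by (auto simp: tensor_algebra_simps tensor_power_simps tens_def gradedD)
qed

lemma tens_carrier [simp]: "graded F \<Longrightarrow> tens F \<in> carrier T"
  by (simp add: T_carrier)

lemma T_cases:
  assumes "f \<in> carrier T" obtains F where "graded F" "f = tens F"
  using assms by (auto simp: T_carrier)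

lemma tens_zero: "\<zero>\<^bsub>T\<^esub> = tens (\<lambda>_. {#})"
  by (simp add: tensor_algebra_simps tensor_power_simps tens_def)

lemma tens_one: "\<one>\<^bsub>T\<^esub> = in_degree 0 {#(\<one>, [])#}"
  by (rule ext) (simp add: tensor_algebra_simps tensor_power_simps tens_def in_degree_def)

lemma tens_add: "graded F \<Longrightarrow> graded G \<Longrightarrow> tens F \<oplus>\<^bsub>T\<^esub> tens G = tens (\<lambda>l. F l + G l)"
  by (simp add: tensor_algebra_simps tens_def tcls_add gradedD)

lemma tens_leq: "graded F \<Longrightarrow> graded G \<Longrightarrow> tens F \<preceq>\<^bsub>T\<^esub> tens G \<longleftrightarrow> (\<forall>l. tle l (F l) (G l))"
  by (simp add: tensor_algebra_simps tens_def tcls_leq gradedD)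

lemma tens_act:
  "b \<in> carrier B \<Longrightarrow> graded F \<Longrightarrow> act T b (tens F) = tens (\<lambda>l. act (FS l) b (F l))"
  unfolding tensor_algebra_simps tens_def by (simp only: tcls_act gradedD)

lemma tcls_concatenate:
  assumes "A \<in> carrier (FS i)" "C \<in> carrier (FS j)"
  shows "(\<Union>A'\<in>tcls i A. \<Union>C'\<in>tcls j C. tcls (i + j) (concatenate B A' C')) =
    tcls (i + j) (concatenate B A C)"
proof -
  have "(\<Union>C'\<in>tcls j C. tcls (i + j) (concatenate B A' C')) = tcls (i + j) (concatenate B A C)"
    if "A' \<in> tcls i A" for A'
  proof -
    have A': "tle i A A'" "tle i A' A" using that unfolding tensor_class_def by (simp_all add: tp.mem_cls_iff)
    then have A'_carrier: "A' \<in> carrier (FS i)" using tle_carrier by blast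
    have "(\<Union>C'\<in>tcls j C. tcls (i + j) (concatenate B A' C')) = tcls (i + j) (concatenate B A' C)"
      unfolding tensor_class_def
      by (rule tp.UN_cls[OF assms(2)]) (intro tp.cls_eqI tle_concatenate_left A'_carrier)
    also have "\<dots> = tcls (i + j) (concatenate B A C)"
      unfolding tensor_class_def by (intro tp.cls_eqI tle_concatenate_right A' assms(2))
    finally show ?thesis .
  qed
  moreover have "A \<in> tcls i A"
    unfolding tensor_class_def using assms(1) by (simp add: tp.mem_cls_iff tle_refl)
  ultimately show ?thesis by auto
qed

lemma finsum_tcls:
  assumes "finite S" "\<And>i. i \<in> S \<Longrightarrow> A i \<in> carrier (FS l)"
  shows "(\<Oplus>\<^bsub>tensor_power B V l\<^esub>i\<in>S. tcls l (A i)) = tcls l (\<Sum>i\<in>S. A i)"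
proof -
  interpret P: abelian_monoid "tensor_power B V l" by (rule tensor_power_abelian_monoid)
  show ?thesis
    using assms
  proof (induction S)
    case (insert i S)
    have "(\<Oplus>\<^bsub>tensor_power B V l\<^esub>j\<in>insert i S. tcls l (A j)) =
        tcls l (A i) \<oplus>\<^bsub>tensor_power B V l\<^esub> (\<Oplus>\<^bsub>tensor_power B V l\<^esub>j\<in>S. tcls l (A j))"
      using insert by (intro P.finsum_insert) (auto simp: tensor_power_simps)
    also have "\<dots> = tcls l (A i + (\<Sum>i\<in>S. A i))"
      using insert by (simp add: tcls_add FS_sum)
    finally show ?case using insert by simp
  qed (simp add: tensor_power_simps)
qed

definition graded_mult where
  "graded_mult F G = (\<lambda>l. \<Sum>i\<le>l. concatenate B (F i) (G (l - i)))"

lemma concatenate_carrier': "graded F \<Longrightarrow> graded G \<Longrightarrow> i \<le> l \<Longrightarrow> concatenate B (F i) (G (l - i)) \<in> carrier (FS l)"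
  using concatenate_carrier[OF gradedD[of F i] gradedD[of G "l - i"]] by simp

lemma tens_mult:
  assumes "graded F" "graded G"
  shows "tens F \<otimes>\<^bsub>T\<^esub> tens G = tens (graded_mult F G)"
proof
  fix l
  have "(\<Union>A'\<in>tcls i (F i). \<Union>C'\<in>tcls (l - i) (G (l - i)). tcls l (concatenate B A' C')) =
      tcls l (concatenate B (F i) (G (l - i)))" if "i \<le> l" for i
    using tcls_concatenate[OF gradedD[OF assms(1), of i] gradedD[OF assms(2), of "l - i"]] that by simp
  then have "(tens F \<otimes>\<^bsub>T\<^esub> tens G) l =
      (\<Oplus>\<^bsub>tensor_power B V l\<^esub>i\<in>{..l}. tcls l (concatenate B (F i) (G (l - i))))"
    unfolding tensor_algebra_simps tens_def
    by (intro abelian_monoid.finsum_cong'[OF tensor_power_abelian_monoid])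
      (auto simp: tensor_power_simps concatenate_carrier'[OF assms])
  also have "\<dots> = tens (graded_mult F G) l"
    unfolding graded_mult_def tens_def by (rule finsum_tcls) (auto simp: concatenate_carrier'[OF assms])
  finally show "(tens F \<otimes>\<^bsub>T\<^esub> tens G) l = tens (graded_mult F G) l" .
qed

lemma graded_zero [simp]: "graded (\<lambda>_. {#})"
  by (simp add: graded_def)

lemma graded_add [simp]: "graded F \<Longrightarrow> graded G \<Longrightarrow> graded (\<lambda>l. F l + G l)"
  unfolding graded_def
  by (auto intro: FS_plus finite_subset[of _ "{l. F l \<noteq> {#}} \<union> {l. G l \<noteq> {#}}"])

lemma graded_act [simp]: "b \<in> carrier B \<Longrightarrow> graded F \<Longrightarrow> graded (\<lambda>l. act (FS l) b (F l))"
  unfolding graded_def using FS_act by auto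

lemma graded_in_degree [simp]: "A \<in> carrier (FS l) \<Longrightarrow> graded (\<lambda>m. if m = l then A else {#})"
  unfolding graded_def by (auto intro: finite_subset[of _ "{l}"])

lemma graded_graded_mult [simp]:
  assumes "graded F" "graded G" shows "graded (graded_mult F G)"
proof -
  have "{l. graded_mult F G l \<noteq> {#}} \<subseteq> (\<lambda>(i, j). i + j) ` ({l. F l \<noteq> {#}} \<times> {l. G l \<noteq> {#}})"
  proof
    fix l assume "l \<in> {l. graded_mult F G l \<noteq> {#}}"
    then obtain i where "i \<le> l" "concatenate B (F i) (G (l - i)) \<noteq> {#}"
      unfolding graded_mult_def by (auto dest: sum.not_neutral_contains_not_neutral)
    then have "F i \<noteq> {#}" "G (l - i) \<noteq> {#}" "l = i + (l - i)" by auto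
    then show "l \<in> (\<lambda>(i, j). i + j) ` ({l. F l \<noteq> {#}} \<times> {l. G l \<noteq> {#}})" by force
  qed
  then have "finite {l. graded_mult F G l \<noteq> {#}}"
    by (rule finite_subset) (use assms in \<open>auto simp: graded_def\<close>)
  moreover have "graded_mult F G l \<in> carrier (FS l)" for l
    unfolding graded_mult_def by (rule FS_sum) (auto simp: concatenate_carrier'[OF assms])
  ultimately show ?thesis by (simp add: graded_def)
qed

lemma T_closed [simp]:
  "f \<in> carrier T \<Longrightarrow> g \<in> carrier T \<Longrightarrow> f \<oplus>\<^bsub>T\<^esub> g \<in> carrier T"
  "f \<in> carrier T \<Longrightarrow> g \<in> carrier T \<Longrightarrow> f \<otimes>\<^bsub>T\<^esub> g \<in> carrier T"
  "b \<in> carrier B \<Longrightarrow> f \<in> carrier T \<Longrightarrow> act T b f \<in> carrier T"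
  "\<zero>\<^bsub>T\<^esub> \<in> carrier T" "\<one>\<^bsub>T\<^esub> \<in> carrier T"
      apply (elim T_cases, simp add: tens_add)
     apply (elim T_cases, simp add: tens_mult)
    apply (elim T_cases, simp only: tens_act tens_carrier graded_act)
  by (simp_all add: tens_zero tens_one in_degree_def)

lemma T_abelian_monoid: "abelian_monoid T"
proof (rule abelian_monoidI)
  fix x y z assume "x \<in> carrier T" "y \<in> carrier T" "z \<in> carrier T"
  then obtain F G H where "graded F" "graded G" "graded H" "x = tens F" "y = tens G" "z = tens H"
    by (elim T_cases) blast
  then show "x \<oplus>\<^bsub>T\<^esub> y \<oplus>\<^bsub>T\<^esub> z = x \<oplus>\<^bsub>T\<^esub> (y \<oplus>\<^bsub>T\<^esub> z)" by (simp add: tens_add add_ac)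
next
  fix x y assume "x \<in> carrier T" "y \<in> carrier T"
  then obtain F G where "graded F" "graded G" "x = tens F" "y = tens G"
    by (elim T_cases) blast
  then show "x \<oplus>\<^bsub>T\<^esub> y = y \<oplus>\<^bsub>T\<^esub> x" by (simp add: tens_add add_ac)
next
  fix x assume "x \<in> carrier T"
  then obtain F where "graded F" "x = tens F" by (elim T_cases) blast
  then show "\<zero>\<^bsub>T\<^esub> \<oplus>\<^bsub>T\<^esub> x = x" by (simp add: tens_zero tens_add)
qed simp_all

lemma T_leq_refl: "f \<in> carrier T \<Longrightarrow> f \<preceq>\<^bsub>T\<^esub> f"
  by (elim T_cases) (simp add: tens_leq gradedD tle_refl)

lemma in_degree_carrier [simp]: "A \<in> carrier (FS l) \<Longrightarrow> in_degree l A \<in> carrier T"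
  by (simp add: in_degree_def)

lemma in_degree_zero: "in_degree l {#} = \<zero>\<^bsub>T\<^esub>"
  by (simp add: in_degree_def tens_zero)

lemma in_degree_add:
  "A \<in> carrier (FS l) \<Longrightarrow> C \<in> carrier (FS l) \<Longrightarrow> in_degree l A \<oplus>\<^bsub>T\<^esub> in_degree l C = in_degree l (A + C)"
  unfolding in_degree_def by (subst tens_add) (auto intro!: arg_cong[of _ _ tens])

lemma in_degree_act:
  assumes "b \<in> carrier B" "A \<in> carrier (FS l)"
  shows "act T b (in_degree l A) = in_degree l (act (FS l) b A)"
  unfolding in_degree_def using assms by (subst tens_act) (auto intro!: arg_cong[of _ _ tens])

lemma in_degree_eqI: "tle l A C \<Longrightarrow> tle l C A \<Longrightarrow> in_degree l A = in_degree l C"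
  unfolding in_degree_def tens_def tensor_class_def using tp.cls_eqI[of l A C] by (intro ext) simp

lemma in_degree_leqI: "tle l A C \<Longrightarrow> in_degree l A \<preceq>\<^bsub>T\<^esub> in_degree l C"
  using tle_carrier[of l A C] unfolding in_degree_def by (auto simp: tens_leq tle_refl)

lemma in_degree_mult:
  assumes "A \<in> carrier (FS i)" "C \<in> carrier (FS j)"
  shows "in_degree i A \<otimes>\<^bsub>T\<^esub> in_degree j C = in_degree (i + j) (concatenate B A C)"
proof -
  have "graded_mult (\<lambda>m. if m = i then A else {#}) (\<lambda>m. if m = j then C else {#}) l =
      (if l = i + j then concatenate B A C else {#})" for l
  proof -
    have "graded_mult (\<lambda>m. if m = i then A else {#}) (\<lambda>m. if m = j then C else {#}) l =
       (\<Sum>k\<le>l. if k = i then (if l - i = j then concatenate B A C else {#}) else {#})"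
      unfolding graded_mult_def by (intro sum.cong) auto
    then show ?thesis by (auto simp: sum.delta)
  qed
  then have "graded_mult (\<lambda>m. if m = i then A else {#}) (\<lambda>m. if m = j then C else {#}) =
      (\<lambda>l. if l = i + j then concatenate B A C else {#})" by blast
  then show ?thesis
    unfolding in_degree_def using assms by (simp add: tens_mult)
qed

text \<open>The preorder that defines an algebra quotient is closed under multiplication but not, by definition,
  under the action of scalars; this identity supplies the latter.\<close>

lemma act_eq_mult:
  assumes "b \<in> carrier B" "f \<in> carrier T"
  shows "act T b f = act T b \<one>\<^bsub>T\<^esub> \<otimes>\<^bsub>T\<^esub> f"
proof -
  obtain F where F: "graded F" "f = tens F" using assms(2) by (rule T_cases)
  have one: "act T b \<one>\<^bsub>T\<^esub> = in_degree 0 {#(b, [])#}" using assms(1) by (simp add: tens_one in_degree_act)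
  let ?u = "\<lambda>m::nat. if m = 0 then {#(b, [])#} else {#}"
  have "graded_mult ?u F l = act (FS l) b (F l)" for l
  proof -
    have "graded_mult ?u F l = (\<Sum>i\<le>l. if i = 0 then concatenate B {#(b, [])#} (F l) else {#})"
      unfolding graded_mult_def by (intro sum.cong) auto
    then show ?thesis by (simp add: concatenate_single_left wrap_def)
  qed
  then have "graded_mult ?u F = (\<lambda>l. act (FS l) b (F l))" by blast
  moreover have "tens ?u \<otimes>\<^bsub>T\<^esub> tens F = tens (graded_mult ?u F)"
    by (rule tens_mult) (use assms(1) F in auto)
  ultimately show ?thesis
    unfolding one F(2) in_degree_def tens_act[OF assms(1) F(1)] by metis
qed

lemma pure_tensor_eq: "pure_tensor B V xs = in_degree (length xs) {#(\<one>, xs)#}"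
  by (rule ext) (simp add: pure_tensor_def in_degree_def tens_def tensor_power_simps)

lemma homogeneous_eq: "homogeneous B V d = in_degree d ` carrier (FS d)"
proof (intro equalityI subsetI)
  fix f assume f: "f \<in> homogeneous B V d"
  then have "f \<in> carrier T" and 0: "\<And>l. l \<noteq> d \<Longrightarrow> f l = tcls l {#}"
    by (auto simp: homogeneous_def tensor_power_simps)
  then obtain F where F: "graded F" "f = tens F" by (elim T_cases)
  then have "f = in_degree d (F d)" using 0 by (intro ext) (simp add: in_degree_def tens_def)
  then show "f \<in> in_degree d ` carrier (FS d)" using F(1) gradedD by blast
next
  fix f assume "f \<in> in_degree d ` carrier (FS d)"
  then obtain A where "A \<in> carrier (FS d)" "f = in_degree d A" by blast
  then show "f \<in> homogeneous B V d"
    by (simp add: homogeneous_def) (simp add: in_degree_def tens_def tensor_power_simps)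
qed

section \<open>Functionals that detect coordinates\<close>

text \<open>Only neighbouring letters are compared, which is exactly what the relations of the exterior algebra
  provide, and what makes the class of these functions closed under prefixing words.\<close>

definition alt_weight :: "'b \<Rightarrow> (nat list \<Rightarrow> 'b) \<Rightarrow> bool" where
  "alt_weight \<epsilon> \<chi> \<longleftrightarrow> weight \<chi> \<and> (\<forall>u v i. \<chi> (u @ [i, i] @ v) = \<zero>) \<and>
     (\<forall>u v i j. i \<noteq> j \<longrightarrow> \<chi> (u @ [i, j] @ v) = \<epsilon> \<otimes> \<chi> (u @ [j, i] @ v))"

text \<open>Quantifying over all alternating functions, instead of the coordinate functions alone, is what makes
  this preorder stable under multiplication.\<close>

definition weight_le :: "'b \<Rightarrow> ('b, nat \<Rightarrow> 'b) tensor \<Rightarrow> ('b, nat \<Rightarrow> 'b) tensor \<Rightarrow> bool" where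
  "weight_le \<epsilon> f g \<longleftrightarrow> f \<in> carrier T \<and> g \<in> carrier T \<and>
     (\<forall>\<chi> l. alt_weight \<epsilon> \<chi> \<longrightarrow> (\<forall>A\<in>f l. \<forall>C\<in>g l. functional \<chi> A \<preceq> functional \<chi> C))"

lemma weight_le_tens:
  assumes "graded F" "graded G"
  shows "weight_le \<epsilon> (tens F) (tens G) \<longleftrightarrow>
    (\<forall>\<chi> l. alt_weight \<epsilon> \<chi> \<longrightarrow> functional \<chi> (F l) \<preceq> functional \<chi> (G l))" (is "?L \<longleftrightarrow> ?R")
proof
  assume L: ?L
  show ?R
  proof (intro allI impI)
    fix \<chi> l assume "alt_weight \<epsilon> \<chi>"
    moreover have "F l \<in> tens F l" "G l \<in> tens G l"
      using gradedD[OF assms(1)] gradedD[OF assms(2)] tle_refl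
      by (simp_all add: tens_def tensor_class_def tp.mem_cls_iff)
    ultimately show "functional \<chi> (F l) \<preceq> functional \<chi> (G l)" using L unfolding weight_le_def by blast
  qed
next
  assume R: ?R
  have "functional \<chi> A \<preceq> functional \<chi> C"
    if "alt_weight \<epsilon> \<chi>" "A \<in> tens F l" "C \<in> tens G l" for \<chi> l A C
  proof -
    have w: "weight \<chi>" using that by (simp add: alt_weight_def)
    have "tle l A (F l)" "tle l (G l) C" using that by (simp_all add: tens_def tensor_class_def tp.mem_cls_iff)
    then have "functional \<chi> A \<preceq> functional \<chi> (F l)" "functional \<chi> (G l) \<preceq> functional \<chi> C"
      using functional_tle[OF w] by blast+
    then show ?thesis using R that(1) by (meson functional_closed leq_trans)
  qed
  then show ?L unfolding weight_le_def using assms by simp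
qed

lemma weight_le_in_degree:
  assumes "A \<in> carrier (FS l)" "C \<in> carrier (FS l)"
  shows "weight_le \<epsilon> (in_degree l A) (in_degree l C) \<longleftrightarrow> (\<forall>\<chi>. alt_weight \<epsilon> \<chi> \<longrightarrow> functional \<chi> A \<preceq> functional \<chi> C)"
  unfolding in_degree_def using assms by (subst weight_le_tens) (auto simp: leq_refl)

lemma weight_le_order: "f \<in> carrier T \<Longrightarrow> g \<in> carrier T \<Longrightarrow> f \<preceq>\<^bsub>T\<^esub> g \<Longrightarrow> weight_le \<epsilon> f g"
  by (elim T_cases) (auto simp: tens_leq weight_le_tens alt_weight_def intro: functional_tle)

lemma weight_le_trans: "weight_le \<epsilon> f g \<Longrightarrow> weight_le \<epsilon> g h \<Longrightarrow> weight_le \<epsilon> f h"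
proof -
  assume *: "weight_le \<epsilon> f g" "weight_le \<epsilon> g h"
  then obtain F G H where "graded F" "graded G" "graded H" "f = tens F" "g = tens G" "h = tens H"
    unfolding weight_le_def by (elim conjE T_cases) blast
  then show ?thesis using * leq_trans[OF functional_closed functional_closed functional_closed]
    by (simp add: weight_le_tens) blast
qed

lemma weight_le_add: "weight_le \<epsilon> f g \<Longrightarrow> h \<in> carrier T \<Longrightarrow> weight_le \<epsilon> (f \<oplus>\<^bsub>T\<^esub> h) (g \<oplus>\<^bsub>T\<^esub> h)"
proof -
  assume *: "weight_le \<epsilon> f g" "h \<in> carrier T"
  then obtain F G H where F: "graded F" "graded G" "graded H" "f = tens F" "g = tens G" "h = tens H"
    unfolding weight_le_def by (elim conjE T_cases) blast
  have "functional \<chi> (F l + H l) \<preceq> functional \<chi> (G l + H l)" if "alt_weight \<epsilon> \<chi>" for \<chi> l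
  proof -
    have w: "weight \<chi>" using that by (simp add: alt_weight_def)
    show ?thesis
      unfolding functional_union[OF w gradedD[OF F(1)]] functional_union[OF w gradedD[OF F(2)]]
      using * F that by (intro leq_add) (auto simp: weight_le_tens)
  qed
  then show ?thesis using F by (simp add: tens_add weight_le_tens)
qed

lemma functional_sum_mono:
  assumes "weight \<chi>" "\<And>i. i \<in> S \<Longrightarrow> A i \<in> carrier (FS l)" "\<And>i. i \<in> S \<Longrightarrow> C i \<in> carrier (FS l)"
    "\<And>i. i \<in> S \<Longrightarrow> functional \<chi> (A i) \<preceq> functional \<chi> (C i)"
  shows "functional \<chi> (\<Sum>i\<in>S. A i) \<preceq> functional \<chi> (\<Sum>i\<in>S. C i)"
  using assms(2-)
proof (induction S rule: infinite_finite_induct)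
  case (insert i S)
  have "functional \<chi> (A i + (\<Sum>i\<in>S. A i)) \<preceq> functional \<chi> (C i + (\<Sum>i\<in>S. C i))"
    unfolding functional_union[OF assms(1) insert.prems(1)[of i], simplified]
      functional_union[OF assms(1) insert.prems(2)[of i], simplified]
    using insert by (intro add_mono) auto
  then show ?case using insert by simp
qed (simp_all add: leq_refl)

lemma alt_weight_shift: "alt_weight \<epsilon> \<chi> \<Longrightarrow> alt_weight \<epsilon> (\<lambda>u. \<chi> (w @ u))"
  unfolding alt_weight_def append_assoc[symmetric] by blast

text \<open>Evaluating the end of a word at a fixed tensor is linear in the function of words, so vanishing and
  the factor \<open>\<epsilon>\<close> are inherited.\<close>

lemma alt_weight_functional:
  assumes "alt_weight \<epsilon> \<chi>" "C \<in> carrier (FS j)" "\<epsilon> \<in> carrier B"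
  shows "alt_weight \<epsilon> (\<lambda>w. functional (\<lambda>u. \<chi> (w @ u)) C)"
proof -
  have w: "weight (\<lambda>u. \<chi> (w @ u))" for w using assms by (simp add: alt_weight_def)
  have repeat: "(\<lambda>x. \<chi> ((u @ [i, i] @ v) @ x)) = (\<lambda>_. \<zero>)" for u v i
    using assms(1) unfolding alt_weight_def append_assoc by blast
  have swap: "(\<lambda>x. \<chi> ((u @ [i, j] @ v) @ x)) = (\<lambda>x. \<epsilon> \<otimes> \<chi> ((u @ [j, i] @ v) @ x))" if "i \<noteq> j" for u v i j
    using assms(1) that unfolding alt_weight_def append_assoc by blast
  show ?thesis
    unfolding alt_weight_def
  proof (intro conjI allI impI)
    show "functional (\<lambda>x. \<chi> ((u @ [i, i] @ v) @ x)) C = \<zero>" for u v i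
      unfolding repeat by (rule functional_zero_weight[OF assms(2)])
    show "functional (\<lambda>x. \<chi> ((u @ [i, j] @ v) @ x)) C = \<epsilon> \<otimes> functional (\<lambda>x. \<chi> ((u @ [j, i] @ v) @ x)) C"
      if "i \<noteq> j" for u v i j
      unfolding swap[OF that] by (rule functional_scale_weight[OF w assms(3,2)])
  qed simp
qed

text \<open>With a fixed left factor, the functional of a product is monotone in the function of words that the
  right factor produces.\<close>

lemma weight_le_mult_left:
  assumes "weight_le \<epsilon> f g" "h \<in> carrier T"
  shows "weight_le \<epsilon> (h \<otimes>\<^bsub>T\<^esub> f) (h \<otimes>\<^bsub>T\<^esub> g)"
proof -
  from assms obtain F G H where F: "graded F" "graded G" "graded H" "f = tens F" "g = tens G" "h = tens H"
    unfolding weight_le_def by (elim conjE T_cases) blast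
  have "functional \<chi> (graded_mult H F l) \<preceq> functional \<chi> (graded_mult H G l)"
    if \<chi>: "alt_weight \<epsilon> \<chi>" for \<chi> l
    unfolding graded_mult_def
  proof (rule functional_sum_mono)
    show w: "weight \<chi>" using \<chi> by (simp add: alt_weight_def)
    fix i assume i: "i \<in> {..l}"
    show "concatenate B (H i) (F (l - i)) \<in> carrier (FS l)" "concatenate B (H i) (G (l - i)) \<in> carrier (FS l)"
      using concatenate_carrier'[of H] F i by auto
    show "functional \<chi> (concatenate B (H i) (F (l - i))) \<preceq> functional \<chi> (concatenate B (H i) (G (l - i)))"
      unfolding functional_concatenate[OF w gradedD[OF F(3)] gradedD[OF F(1)]]
        functional_concatenate[OF w gradedD[OF F(3)] gradedD[OF F(2)]]
      using assms F alt_weight_shift[OF \<chi>]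
      by (intro functional_mono_weight[where l = i] gradedD) (auto simp: weight_le_tens)
  qed
  then show ?thesis using F by (simp add: tens_mult weight_le_tens)
qed

text \<open>With a fixed right factor, the functional of a product is again an alternating functional of the left
  factor.\<close>

lemma weight_le_mult_right:
  assumes "weight_le \<epsilon> f g" "h \<in> carrier T" "\<epsilon> \<in> carrier B"
  shows "weight_le \<epsilon> (f \<otimes>\<^bsub>T\<^esub> h) (g \<otimes>\<^bsub>T\<^esub> h)"
proof -
  from assms obtain F G H where F: "graded F" "graded G" "graded H" "f = tens F" "g = tens G" "h = tens H"
    unfolding weight_le_def by (elim conjE T_cases) blast
  have "functional \<chi> (graded_mult F H l) \<preceq> functional \<chi> (graded_mult G H l)"
    if \<chi>: "alt_weight \<epsilon> \<chi>" for \<chi> l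
    unfolding graded_mult_def
  proof (rule functional_sum_mono)
    show w: "weight \<chi>" using \<chi> by (simp add: alt_weight_def)
    fix i assume i: "i \<in> {..l}"
    show "concatenate B (F i) (H (l - i)) \<in> carrier (FS l)" "concatenate B (G i) (H (l - i)) \<in> carrier (FS l)"
      using concatenate_carrier'[of _ H] F i by auto
    show "functional \<chi> (concatenate B (F i) (H (l - i))) \<preceq> functional \<chi> (concatenate B (G i) (H (l - i)))"
      unfolding functional_concatenate[OF w gradedD[OF F(1)] gradedD[OF F(3)]]
        functional_concatenate[OF w gradedD[OF F(2)] gradedD[OF F(3)]]
      using assms F alt_weight_functional[OF \<chi> gradedD[OF F(3)] assms(3)]
      by (auto simp: weight_le_tens)
  qed
  then show ?thesis using F by (simp add: tens_mult weight_le_tens)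
qed

end

section \<open>Quotients of the tensor algebra\<close>

lemma abelian_monoid_image:
  assumes "abelian_monoid G" "carrier N = h ` carrier G"
    and add: "\<And>x y. x \<in> carrier G \<Longrightarrow> y \<in> carrier G \<Longrightarrow> h x \<oplus>\<^bsub>N\<^esub> h y = h (x \<oplus>\<^bsub>G\<^esub> y)"
    and zero: "\<zero>\<^bsub>N\<^esub> = h \<zero>\<^bsub>G\<^esub>"
  shows "abelian_monoid N"
proof -
  interpret G: abelian_monoid G by fact
  show ?thesis
  proof (rule abelian_monoidI, unfold assms(2))
    fix x y z assume "x \<in> h ` carrier G" "y \<in> h ` carrier G" "z \<in> h ` carrier G"
    then obtain a b c where "a \<in> carrier G" "b \<in> carrier G" "c \<in> carrier G" "x = h a" "y = h b" "z = h c"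
      by blast
    then show "x \<oplus>\<^bsub>N\<^esub> y \<oplus>\<^bsub>N\<^esub> z = x \<oplus>\<^bsub>N\<^esub> (y \<oplus>\<^bsub>N\<^esub> z)" by (simp add: add G.a_assoc)
  next
    fix x y assume "x \<in> h ` carrier G" "y \<in> h ` carrier G"
    then obtain a b where "a \<in> carrier G" "b \<in> carrier G" "x = h a" "y = h b" by blast
    then show "x \<oplus>\<^bsub>N\<^esub> y = y \<oplus>\<^bsub>N\<^esub> x" "x \<oplus>\<^bsub>N\<^esub> y \<in> h ` carrier G"
      by (simp_all add: add G.a_comm)
  qed (auto simp: zero add)
qed

text \<open>An image \<open>M\<close> of the tensor algebra whose order is a congruence for sums and products. Forming a
  quotient by relations stays in this class (\<open>tensor_quotient_alg_quot\<close>), which covers the algebra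
  \<open>Sym(S\<^sup>n)/\<langle>e\<^sub>i\<^sup>2 \<equiv> 0\<rangle>\<close>, a quotient of a quotient.\<close>

locale tensor_quotient = free_tensor_algebra B n
  for B :: "('b, 'z) blueprint_scheme" (structure) and n +
  fixes M :: "('b, 'm) bmodule" and cls :: "('b, nat \<Rightarrow> 'b) tensor \<Rightarrow> 'm"
  assumes carrier_M: "carrier M = cls ` carrier T"
    and cls_eqI: "\<lbrakk>f \<in> carrier T; g \<in> carrier T; cls f \<preceq>\<^bsub>M\<^esub> cls g; cls g \<preceq>\<^bsub>M\<^esub> cls f\<rbrakk> \<Longrightarrow> cls f = cls g"
    and cls_zero: "\<zero>\<^bsub>M\<^esub> = cls \<zero>\<^bsub>T\<^esub>"
    and cls_one: "\<one>\<^bsub>M\<^esub> = cls \<one>\<^bsub>T\<^esub>"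
    and cls_add: "\<lbrakk>f \<in> carrier T; g \<in> carrier T\<rbrakk> \<Longrightarrow> cls f \<oplus>\<^bsub>M\<^esub> cls g = cls (f \<oplus>\<^bsub>T\<^esub> g)"
    and cls_mult: "\<lbrakk>f \<in> carrier T; g \<in> carrier T\<rbrakk> \<Longrightarrow> cls f \<otimes>\<^bsub>M\<^esub> cls g = cls (f \<otimes>\<^bsub>T\<^esub> g)"
    and cls_act: "\<lbrakk>b \<in> carrier B; f \<in> carrier T\<rbrakk> \<Longrightarrow> act M b (cls f) = cls (act T b f)"
    and le_order: "\<lbrakk>f \<in> carrier T; g \<in> carrier T; f \<preceq>\<^bsub>T\<^esub> g\<rbrakk> \<Longrightarrow> cls f \<preceq>\<^bsub>M\<^esub> cls g"
    and le_trans: "\<lbrakk>f \<in> carrier T; g \<in> carrier T; h \<in> carrier T;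
        cls f \<preceq>\<^bsub>M\<^esub> cls g; cls g \<preceq>\<^bsub>M\<^esub> cls h\<rbrakk> \<Longrightarrow> cls f \<preceq>\<^bsub>M\<^esub> cls h"
    and le_add: "\<lbrakk>f \<in> carrier T; g \<in> carrier T; h \<in> carrier T; cls f \<preceq>\<^bsub>M\<^esub> cls g\<rbrakk> \<Longrightarrow>
        cls (f \<oplus>\<^bsub>T\<^esub> h) \<preceq>\<^bsub>M\<^esub> cls (g \<oplus>\<^bsub>T\<^esub> h)"
    and le_mult_left: "\<lbrakk>f \<in> carrier T; g \<in> carrier T; h \<in> carrier T; cls f \<preceq>\<^bsub>M\<^esub> cls g\<rbrakk> \<Longrightarrow>
        cls (h \<otimes>\<^bsub>T\<^esub> f) \<preceq>\<^bsub>M\<^esub> cls (h \<otimes>\<^bsub>T\<^esub> g)"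
    and le_mult_right: "\<lbrakk>f \<in> carrier T; g \<in> carrier T; h \<in> carrier T; cls f \<preceq>\<^bsub>M\<^esub> cls g\<rbrakk> \<Longrightarrow>
        cls (f \<otimes>\<^bsub>T\<^esub> h) \<preceq>\<^bsub>M\<^esub> cls (g \<otimes>\<^bsub>T\<^esub> h)"
begin

lemma M_cases: assumes "x \<in> carrier M" obtains f where "f \<in> carrier T" "x = cls f"
  using assms by (auto simp: carrier_M)

lemma cls_carrier [simp]: "f \<in> carrier T \<Longrightarrow> cls f \<in> carrier M"
  by (simp add: carrier_M)

lemma M_abelian_monoid: "abelian_monoid M"
  by (rule abelian_monoid_image[OF T_abelian_monoid carrier_M]) (simp_all add: cls_add cls_zero)

lemma M_closed [simp]:
  "x \<in> carrier M \<Longrightarrow> y \<in> carrier M \<Longrightarrow> x \<oplus>\<^bsub>M\<^esub> y \<in> carrier M"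
  "x \<in> carrier M \<Longrightarrow> y \<in> carrier M \<Longrightarrow> x \<otimes>\<^bsub>M\<^esub> y \<in> carrier M"
  "b \<in> carrier B \<Longrightarrow> x \<in> carrier M \<Longrightarrow> act M b x \<in> carrier M"
  by (elim M_cases, simp add: cls_add) (elim M_cases, simp add: cls_mult, elim M_cases, simp add: cls_act)

lemma M_refl: "x \<in> carrier M \<Longrightarrow> x \<preceq>\<^bsub>M\<^esub> x"
  by (elim M_cases) (simp add: le_order T_leq_refl)

lemma alg_le_carrier: "alg_le M H x y \<Longrightarrow> x \<in> carrier M \<and> y \<in> carrier M"
  by (induction rule: alg_le.induct) auto

lemma add_preorder_alg_le: "add_preorder M (alg_le M H)"
proof (intro add_preorder.intro add_preorder_axioms.intro M_abelian_monoid)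
  show "alg_le M H x x" if "x \<in> carrier M" for x
    by (rule alg_le.order[OF that that M_refl[OF that]])
qed (fact alg_le_carrier alg_le.trans alg_le.add)+

lemma M_act_eq_mult:
  assumes "b \<in> carrier B" "x \<in> carrier M"
  shows "act M b x = cls (act T b \<one>\<^bsub>T\<^esub>) \<otimes>\<^bsub>M\<^esub> x"
proof -
  obtain f where f: "f \<in> carrier T" "x = cls f" using assms(2) by (rule M_cases)
  have "act M b x = cls (act T b f)" using f assms(1) by (simp add: cls_act)
  also have "\<dots> = cls (act T b \<one>\<^bsub>T\<^esub> \<otimes>\<^bsub>T\<^esub> f)" by (rule arg_cong[OF act_eq_mult[OF assms(1) f(1)]])
  also have "\<dots> = cls (act T b \<one>\<^bsub>T\<^esub>) \<otimes>\<^bsub>M\<^esub> x" using f assms(1) by (simp add: cls_mult)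
  finally show ?thesis .
qed

lemma alg_quot_leq:
  assumes "f \<in> carrier T" "g \<in> carrier T"
  shows "alg_class M H (cls f) \<preceq>\<^bsub>alg_quot M H\<^esub> alg_class M H (cls g) \<longleftrightarrow>
    alg_le M (H \<union> H\<inverse>) (cls f) (cls g)"
proof -
  interpret q: add_preorder M "alg_le M (H \<union> H\<inverse>)" by (rule add_preorder_alg_le)
  show ?thesis unfolding alg_quot_def alg_class_def bmod_quot_simps
    by (rule q.quot_leq) (simp_all add: assms)
qed

lemma tensor_quotient_alg_quot: "tensor_quotient B n (alg_quot M H) (\<lambda>f. alg_class M H (cls f))"
proof -
  let ?r = "alg_le M (H \<union> H\<inverse>)"
  interpret q: add_preorder M ?r by (rule add_preorder_alg_le)
  note leq = alg_quot_leq[of _ _ H]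
  show ?thesis
  proof
    show "carrier (alg_quot M H) = (\<lambda>f. alg_class M H (cls f)) ` carrier T"
      by (simp add: alg_quot_def alg_class_def carrier_M image_image)
    show "\<zero>\<^bsub>alg_quot M H\<^esub> = alg_class M H (cls \<zero>\<^bsub>T\<^esub>)"
      by (simp add: alg_quot_def alg_class_def cls_zero)
    show "\<one>\<^bsub>alg_quot M H\<^esub> = alg_class M H (cls \<one>\<^bsub>T\<^esub>)"
      by (simp add: alg_quot_def alg_class_def cls_one)
  next
    fix f g assume fg: "f \<in> carrier T" "g \<in> carrier T"
    then show "alg_class M H (cls f) \<oplus>\<^bsub>alg_quot M H\<^esub> alg_class M H (cls g) = alg_class M H (cls (f \<oplus>\<^bsub>T\<^esub> g))"
      unfolding alg_quot_def alg_class_def bmod_quot_simps by (simp only: q.quot_add cls_carrier cls_add)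
    have "q.cls (cls f) \<otimes>\<^bsub>bp_quot M ?r\<^esub> q.cls (cls g) = q.cls (cls f \<otimes>\<^bsub>M\<^esub> cls g)"
      by (rule q.quot_mult) (use fg in \<open>auto intro: alg_le.intros\<close>)
    then show "alg_class M H (cls f) \<otimes>\<^bsub>alg_quot M H\<^esub> alg_class M H (cls g) = alg_class M H (cls (f \<otimes>\<^bsub>T\<^esub> g))"
      unfolding alg_quot_def alg_class_def bmod_quot_simps using fg by (simp only: cls_mult)
    show "alg_class M H (cls f) = alg_class M H (cls g)"
      if "alg_class M H (cls f) \<preceq>\<^bsub>alg_quot M H\<^esub> alg_class M H (cls g)"
        "alg_class M H (cls g) \<preceq>\<^bsub>alg_quot M H\<^esub> alg_class M H (cls f)"
      using that unfolding leq[OF fg] leq[OF fg(2,1)] unfolding alg_class_def by (rule q.cls_eqI)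
    show "alg_class M H (cls f) \<preceq>\<^bsub>alg_quot M H\<^esub> alg_class M H (cls g)" if "f \<preceq>\<^bsub>T\<^esub> g"
      unfolding leq[OF fg] using fg that by (auto intro: alg_le.order le_order)
  next
    fix b f assume b: "b \<in> carrier B" "f \<in> carrier T"
    have "(\<Union>x\<in>q.cls (cls f). q.cls (act M b x)) = q.cls (act M b (cls f))"
    proof (rule q.quot_map)
      fix x y assume "?r x y"
      then show "?r (act M b x) (act M b y)"
        using alg_le_carrier[of "H \<union> H\<inverse>" x y] b(1)
        by (auto simp: M_act_eq_mult intro!: alg_le.mult_left)
    qed (use b in auto)
    then show "act (alg_quot M H) b (alg_class M H (cls f)) = alg_class M H (cls (act T b f))"
      unfolding alg_quot_def alg_class_def bmod_quot_simps using b by (simp only: cls_act)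
  next
    fix f g h assume fgh: "f \<in> carrier T" "g \<in> carrier T" "h \<in> carrier T"
      "alg_class M H (cls f) \<preceq>\<^bsub>alg_quot M H\<^esub> alg_class M H (cls g)"
    then have r: "?r (cls f) (cls g)" by (simp only: leq)
    show "alg_class M H (cls f) \<preceq>\<^bsub>alg_quot M H\<^esub> alg_class M H (cls h)"
      if "alg_class M H (cls g) \<preceq>\<^bsub>alg_quot M H\<^esub> alg_class M H (cls h)"
      using r that unfolding leq[OF fgh(1,3)] leq[OF fgh(2,3)] by (rule alg_le.trans)
    show "alg_class M H (cls (f \<oplus>\<^bsub>T\<^esub> h)) \<preceq>\<^bsub>alg_quot M H\<^esub> alg_class M H (cls (g \<oplus>\<^bsub>T\<^esub> h))"
      "alg_class M H (cls (h \<otimes>\<^bsub>T\<^esub> f)) \<preceq>\<^bsub>alg_quot M H\<^esub> alg_class M H (cls (h \<otimes>\<^bsub>T\<^esub> g))"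
      "alg_class M H (cls (f \<otimes>\<^bsub>T\<^esub> h)) \<preceq>\<^bsub>alg_quot M H\<^esub> alg_class M H (cls (g \<otimes>\<^bsub>T\<^esub> h))"
      using alg_le.intros(4-6)[OF r cls_carrier[OF fgh(3)]] fgh(1-3)
      by (simp_all add: leq cls_add cls_mult)
  qed
qed

text \<open>The property that is passed on to quotients and yields the independence of the \<open>e\<^sub>I\<close> in the end.\<close>

definition weight_sound :: "'b \<Rightarrow> bool" where
  "weight_sound \<epsilon> \<longleftrightarrow> (\<forall>f\<in>carrier T. \<forall>g\<in>carrier T. cls f \<preceq>\<^bsub>M\<^esub> cls g \<longrightarrow> weight_le \<epsilon> f g)"

text \<open>Induction over the generated preorder. In the transitivity step two representatives of the same
  middle class meet; soundness of \<open>M\<close> itself bridges them.\<close>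

lemma alg_le_weight_sound:
  assumes sound: "weight_sound \<epsilon>" and "\<epsilon> \<in> carrier B" and "alg_le M H x y"
    and gen: "\<And>x y. (x, y) \<in> H \<Longrightarrow> x \<in> carrier M \<Longrightarrow> y \<in> carrier M \<Longrightarrow>
       \<exists>f g. x = cls f \<and> y = cls g \<and> weight_le \<epsilon> f g"
  shows "\<exists>f g. x = cls f \<and> y = cls g \<and> weight_le \<epsilon> f g"
  using assms(3)
proof (induction rule: alg_le.induct)
  case (order x y)
  then show ?case using sound unfolding weight_sound_def by (elim M_cases) blast
next
  case (gen x y)
  then show ?case by (intro assms(4))
next
  case (trans x y z)
  then obtain f g g' h where *: "x = cls f" "y = cls g" "y = cls g'" "z = cls h" "weight_le \<epsilon> f g" "weight_le \<epsilon> g' h"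
    by blast
  then have "g \<in> carrier T" "g' \<in> carrier T" by (auto simp: weight_le_def)
  then have "weight_le \<epsilon> g g'" using sound * M_refl[of "cls g'"] unfolding weight_sound_def by simp
  then show ?case using * weight_le_trans by blast
next
  case (add x y z)
  then obtain f g h where *: "x = cls f" "y = cls g" "z = cls h" "weight_le \<epsilon> f g" "h \<in> carrier T"
    by (elim M_cases) blast
  then have "f \<in> carrier T" "g \<in> carrier T" by (auto simp: weight_le_def)
  then show ?case using * weight_le_add[OF *(4,5)] by (auto simp: cls_add)
next
  case (mult_left x y z)
  then obtain f g h where *: "x = cls f" "y = cls g" "z = cls h" "weight_le \<epsilon> f g" "h \<in> carrier T"
    by (elim M_cases) blast
  then have "f \<in> carrier T" "g \<in> carrier T" by (auto simp: weight_le_def)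
  then show ?case using * weight_le_mult_left[OF *(4,5)] by (auto simp: cls_mult)
next
  case (mult_right x y z)
  then obtain f g h where *: "x = cls f" "y = cls g" "z = cls h" "weight_le \<epsilon> f g" "h \<in> carrier T"
    by (elim M_cases) blast
  then have "f \<in> carrier T" "g \<in> carrier T" by (auto simp: weight_le_def)
  then show ?case using * weight_le_mult_right[OF *(4,5) assms(2)] by (auto simp: cls_mult)
qed

lemma weight_sound_alg_quot:
  assumes sound: "weight_sound \<epsilon>" and "\<epsilon> \<in> carrier B"
    and gen: "\<And>x y. (x, y) \<in> H \<Longrightarrow> x \<in> carrier M \<Longrightarrow> y \<in> carrier M \<Longrightarrow>
       \<exists>f g. x = cls f \<and> y = cls g \<and> weight_le \<epsilon> f g \<and> weight_le \<epsilon> g f"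
  shows "tensor_quotient.weight_sound B n (alg_quot M H) (\<lambda>f. alg_class M H (cls f)) \<epsilon>"
  unfolding tensor_quotient.weight_sound_def[OF tensor_quotient_alg_quot]
proof (intro ballI impI)
  fix f g assume fg: "f \<in> carrier T" "g \<in> carrier T"
    and "alg_class M H (cls f) \<preceq>\<^bsub>alg_quot M H\<^esub> alg_class M H (cls g)"
  then have "alg_le M (H \<union> H\<inverse>) (cls f) (cls g)" by (simp add: alg_quot_leq)
  from alg_le_weight_sound[OF sound assms(2) this]
  obtain f' g' where *: "cls f = cls f'" "cls g = cls g'" "weight_le \<epsilon> f' g'"
    using gen by blast
  then have "f' \<in> carrier T" "g' \<in> carrier T" by (auto simp: weight_le_def)
  then have "weight_le \<epsilon> f f'" "weight_le \<epsilon> g' g"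
    using sound fg * M_refl[of "cls f'"] M_refl[of "cls g'"] unfolding weight_sound_def by simp_all
  then show "weight_le \<epsilon> f g" using *(3) weight_le_trans by blast
qed

end

context free_tensor_algebra
begin

lemma T_tensor_quotient: "tensor_quotient B n T (\<lambda>f. f)"
proof
  fix f g assume fg: "f \<in> carrier T" "g \<in> carrier T" "f \<preceq>\<^bsub>T\<^esub> g" "g \<preceq>\<^bsub>T\<^esub> f"
  then obtain F G where F: "graded F" "graded G" "f = tens F" "g = tens G"
    by (elim T_cases) blast
  then have "tle l (F l) (G l)" "tle l (G l) (F l)" for l using fg(3,4) by (simp_all add: tens_leq)
  then show "f = g"
    unfolding F(3,4) tens_def using F(1,2) by (intro ext) (simp add: tcls_eq_iff gradedD)
next
  fix f g h assume "f \<in> carrier T" "g \<in> carrier T" "h \<in> carrier T" and fg: "f \<preceq>\<^bsub>T\<^esub> g"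
  then obtain F G H where F: "graded F" "graded G" "graded H" "f = tens F" "g = tens G" "h = tens H"
    by (elim T_cases) blast
  have r: "tle l (F l) (G l)" for l using fg F by (simp add: tens_leq)
  show "f \<preceq>\<^bsub>T\<^esub> h" if "g \<preceq>\<^bsub>T\<^esub> h" using fg that F by (simp add: tens_leq) (blast intro: tle_trans)
  show "f \<oplus>\<^bsub>T\<^esub> h \<preceq>\<^bsub>T\<^esub> g \<oplus>\<^bsub>T\<^esub> h"
    using F r by (simp add: tens_add tens_leq tle_add tle_refl gradedD)
  have sum: "tle l (\<Sum>i\<le>l. A i) (\<Sum>i\<le>l. C i)" if "\<And>i. i \<le> l \<Longrightarrow> tle l (A i) (C i)" for l A C
  proof -
    have "tle l (\<Sum>i\<in>S. A i) (\<Sum>i\<in>S. C i)" if "S \<subseteq> {..l}" for S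
      using finite_subset[OF that finite_atMost] that
      by (induction S) (auto simp: tle_refl intro: tle_add \<open>\<And>i. i \<le> l \<Longrightarrow> tle l (A i) (C i)\<close>)
    then show ?thesis by blast
  qed
  have "tle l (graded_mult H F l) (graded_mult H G l)" for l
    unfolding graded_mult_def
    by (rule sum) (use tle_concatenate_left[OF gradedD[OF F(3)] r] in \<open>metis le_add_diff_inverse\<close>)
  then show "h \<otimes>\<^bsub>T\<^esub> f \<preceq>\<^bsub>T\<^esub> h \<otimes>\<^bsub>T\<^esub> g" using F by (simp add: tens_mult tens_leq)
  have "tle l (graded_mult F H l) (graded_mult G H l)" for l
    unfolding graded_mult_def
    by (rule sum) (use tle_concatenate_right[OF gradedD[OF F(3)] r] in \<open>metis le_add_diff_inverse\<close>)
  then show "f \<otimes>\<^bsub>T\<^esub> h \<preceq>\<^bsub>T\<^esub> g \<otimes>\<^bsub>T\<^esub> h" using F by (simp add: tens_mult tens_leq)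
qed simp_all

sublocale tensor: tensor_quotient B n T "\<lambda>f. f" by (rule T_tensor_quotient)

lemma tensor_weight_sound: "tensor.weight_sound \<epsilon>"
  unfolding tensor.weight_sound_def by (blast intro: weight_le_order)

end

section \<open>Bases of exterior powers\<close>

text \<open>Counts the pairs of positions whose letters are in strictly decreasing order, also for words with
  repeated letters.\<close>

primrec inversions :: "nat list \<Rightarrow> nat" where
  "inversions [] = 0"
| "inversions (x # xs) = length (filter (\<lambda>y. y < x) xs) + inversions xs"

lemma inversions_swap: "i < j \<Longrightarrow> inversions (u @ [j, i] @ v) = Suc (inversions (u @ [i, j] @ v))"
  by (induction u) auto

lemma inversions_sorted: "sorted xs \<Longrightarrow> inversions xs = 0"
  by (induction xs) (auto simp: filter_empty_conv not_less)

lemma descent_exists: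
  "\<not> sorted_wrt (<) w \<Longrightarrow> \<exists>u i j v. w = u @ [i, j] @ v \<and> j \<le> i" for w :: "nat list"
proof (induction w)
  case (Cons x w)
  show ?case
  proof (cases "sorted_wrt (<) w")
    case True
    then obtain y zs where w: "w = y # zs" using Cons.prems by (cases w) auto
    with True Cons.prems have "y \<le> x" by auto
    then show ?thesis using w by (intro exI[of _ "[]"]) auto
  next
    case False
    with Cons.IH obtain u i j v where "w = u @ [i, j] @ v" "j \<le> i" by blast
    then show ?thesis by (intro exI[of _ "x # u"]) auto
  qed
qed simp

lemma d_subsets_finite: "finite (d_subsets n d)" "I \<in> d_subsets n d \<Longrightarrow> finite I"
  by (auto simp: d_subsets_def intro: finite_subset[of _ "Pow {1..n}"] finite_subset)

context free_tensor_algebra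
begin

abbreviation units where "units w \<equiv> map (unit_vec B n) w"

lemma units_closed: "set (units w) \<subseteq> carrier V"
  by (auto simp: unit_vec_closed)

lemma single_carrier: "b \<in> carrier B \<Longrightarrow> {#(b, units w)#} \<in> carrier (FS (length w))"
  unfolding FS_single using units_closed by simp

lemma basis_tensor_eq: "basis_tensor B n w = in_degree (length w) {#(\<one>, units w)#}"
  unfolding basis_tensor_def pure_tensor_eq by simp

lemma basis_tensor_carrier [simp]: "basis_tensor B n w \<in> carrier T"
  unfolding basis_tensor_eq by (rule in_degree_carrier[OF single_carrier[OF one_closed]])

lemma act_basis_tensor:
  "b \<in> carrier B \<Longrightarrow> act T b (basis_tensor B n w) = in_degree (length w) {#(b, units w)#}"
  unfolding basis_tensor_eq by (subst in_degree_act[OF _ single_carrier]) simp_all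

lemma functional_single:
  assumes "weight \<chi>" "b \<in> carrier B" "set xs \<subseteq> carrier V"
  shows "functional \<chi> {#(b, xs)#} = b \<otimes> expand B n xs \<chi>"
  using functional_add_mset[OF assms, of "{#}"] expand_closed[OF assms(1,3)] assms(2) by simp

end

text \<open>Any quotient in which the exterior relations hold for basis vectors, and in which no relations hold
  but those seen by alternating functionals, has the \<open>e\<^sub>I\<close> as a basis.\<close>

locale exterior_quotient = tensor_quotient B n M cls
  for B :: "('b, 'z) blueprint_scheme" (structure) and n and M :: "('b, 'm) bmodule" and cls +
  fixes \<epsilon> :: 'b
  assumes eps_carrier [simp]: "\<epsilon> \<in> carrier B" and eps_sq: "\<epsilon> \<otimes> \<epsilon> = \<one>"
    and cls_repeat: "i \<in> {1..n} \<Longrightarrow> cls (basis_tensor B n [i, i]) = cls \<zero>\<^bsub>T\<^esub>"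
    and cls_swap: "\<lbrakk>i \<in> {1..n}; j \<in> {1..n}; i \<noteq> j\<rbrakk> \<Longrightarrow>
      cls (basis_tensor B n [i, j]) = cls (act T \<epsilon> (basis_tensor B n [j, i]))"
    and weight_sound: "weight_sound \<epsilon>"
begin

text \<open>The function of words whose functional is the coordinate at \<open>e\<^sub>I\<close>.\<close>

definition coord_weight :: "nat set \<Rightarrow> nat list \<Rightarrow> 'b" where
  "coord_weight I w = (if distinct w \<and> set w = I then \<epsilon> [^] inversions w else \<zero>)"

text \<open>An exchange of different neighbours changes the number of inversions by one, up or down; since
  \<open>\<epsilon>\<^sup>2 = 1\<close>, both directions amount to a factor \<open>\<epsilon>\<close>.\<close>

lemma alt_coord_weight: "alt_weight \<epsilon> (coord_weight I)"
proof -
  have swap: "coord_weight I (u @ [i, j] @ v) = \<epsilon> \<otimes> coord_weight I (u @ [j, i] @ v)" if "i \<noteq> j" for u v i j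
  proof -
    have eq: "distinct (u @ [i, j] @ v) = distinct (u @ [j, i] @ v)" "set (u @ [i, j] @ v) = set (u @ [j, i] @ v)"
      by auto
    have "\<epsilon> [^] inversions (u @ [i, j] @ v) = \<epsilon> \<otimes> \<epsilon> [^] inversions (u @ [j, i] @ v)"
    proof (cases "i < j")
      case True
      have "\<epsilon> \<otimes> (x \<otimes> \<epsilon>) = x" if "x \<in> carrier B" for x
        using that m_comm[of x \<epsilon>] m_assoc[of \<epsilon> \<epsilon> x] by (simp add: eps_sq)
      then show ?thesis
        unfolding inversions_swap[OF True] nat_pow_Suc by simp
    next
      case False
      then have "j < i" using that by simp
      show ?thesis
        unfolding inversions_swap[OF \<open>j < i\<close>] nat_pow_Suc by (simp add: m_comm)
    qed
    then show ?thesis unfolding coord_weight_def eq by simp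
  qed
  have "weight (coord_weight I)" "coord_weight I (u @ [i, i] @ v) = \<zero>" for u v i
    by (simp_all add: coord_weight_def)
  then show ?thesis unfolding alt_weight_def using swap by blast
qed

lemma weight_coord_weight: "weight (coord_weight I)"
  using alt_coord_weight by (simp add: alt_weight_def)

definition basis_sum :: "nat \<Rightarrow> (nat set \<Rightarrow> 'b) \<Rightarrow> ('b, nat \<Rightarrow> 'b) formal_sum" where
  "basis_sum d v = (\<Sum>I\<in>d_subsets n d. {#(v I, units (sorted_list_of_set I))#})"

definition vec :: "nat \<Rightarrow> (nat set \<Rightarrow> 'b) \<Rightarrow> 'm" where
  "vec d v = cls (in_degree d (basis_sum d v))"

lemma basis_term_carrier:
  "I \<in> d_subsets n d \<Longrightarrow> {#(b, units (sorted_list_of_set I))#} \<in> carrier (FS d) \<longleftrightarrow> b \<in> carrier B"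
  unfolding FS_single using units_closed by (auto simp: d_subsets_def)

lemma basis_sum_carrier: "v \<in> d_subsets n d \<rightarrow> carrier B \<Longrightarrow> basis_sum d v \<in> carrier (FS d)"
  unfolding basis_sum_def by (rule FS_sum) (auto simp: basis_term_carrier simp del: FS_single)

lemma functional_basis_sum:
  assumes v: "v \<in> d_subsets n d \<rightarrow> carrier B" and I: "I \<in> d_subsets n d"
  shows "functional (coord_weight I) (basis_sum d v) = v I"
proof -
  have *: "functional (coord_weight I) (\<Sum>K\<in>S. {#(v K, units (sorted_list_of_set K))#}) =
      (\<Oplus>K\<in>S. if I = K then v K else \<zero>)" if "S \<subseteq> d_subsets n d" for S
    using finite_subset[OF that d_subsets_finite(1)] that
  proof (induction S)
    case (insert K S)
    then have K: "K \<in> d_subsets n d" and vK: "v K \<in> carrier B" using v by auto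
    have "set (sorted_list_of_set K) \<subseteq> {1..n}" using K d_subsets_finite(2)[OF K] by (auto simp: d_subsets_def)
    then have "expand B n (units (sorted_list_of_set K)) (coord_weight I) = coord_weight I (sorted_list_of_set K)"
      by (rule expand_unit_vec[OF weight_coord_weight])
    also have "\<dots> = (if I = K then \<one> else \<zero>)"
      using d_subsets_finite(2)[OF K] by (auto simp: coord_weight_def inversions_sorted)
    finally have e: "expand B n (units (sorted_list_of_set K)) (coord_weight I) = (if I = K then \<one> else \<zero>)" .
    have "(\<lambda>K. if I = K then v K else \<zero>) \<in> S \<rightarrow> carrier B" using insert v by auto
    then show ?case
      using insert vK functional_add_mset[OF weight_coord_weight vK units_closed] e by simp
  qed simp
  show ?thesis
    unfolding basis_sum_def *[OF subset_refl] using v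
    by (intro finsum_singleton[OF I d_subsets_finite(1)]) auto
qed

text \<open>Independence of the \<open>e\<^sub>I\<close>, in the ordered sense: apply the coordinate functionals.\<close>

lemma vec_leqD:
  assumes "v \<in> d_subsets n d \<rightarrow> carrier B" "w \<in> d_subsets n d \<rightarrow> carrier B"
    and "vec d v \<preceq>\<^bsub>M\<^esub> vec d w" "I \<in> d_subsets n d"
  shows "v I \<preceq> w I"
proof -
  have "weight_le \<epsilon> (in_degree d (basis_sum d v)) (in_degree d (basis_sum d w))"
    using weight_sound assms(1-3) basis_sum_carrier unfolding weight_sound_def vec_def by simp
  then have "functional (coord_weight I) (basis_sum d v) \<preceq> functional (coord_weight I) (basis_sum d w)"
    using weight_le_in_degree[OF basis_sum_carrier[OF assms(1)] basis_sum_carrier[OF assms(2)]]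
      alt_coord_weight by blast
  then show ?thesis by (simp add: functional_basis_sum assms)
qed

lemma tle_sum:
  assumes "finite S" "\<And>i. i \<in> S \<Longrightarrow> tle l (A i) (C i)"
  shows "tle l (\<Sum>i\<in>S. A i) (\<Sum>i\<in>S. C i)"
  using assms by (induction S) (auto intro: tle_add simp: tle_refl)

lemma cls_in_degree_leq: "tle l A C \<Longrightarrow> cls (in_degree l A) \<preceq>\<^bsub>M\<^esub> cls (in_degree l C)"
  using tle_carrier[of l A C] by (intro le_order in_degree_leqI in_degree_carrier) auto

lemma vec_leqI:
  assumes "v \<in> d_subsets n d \<rightarrow> carrier B" "w \<in> d_subsets n d \<rightarrow> carrier B"
    and "\<And>I. I \<in> d_subsets n d \<Longrightarrow> v I \<preceq> w I"
  shows "vec d v \<preceq>\<^bsub>M\<^esub> vec d w"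
  unfolding vec_def basis_sum_def
proof (intro cls_in_degree_leq tle_sum d_subsets_finite)
  fix I assume I: "I \<in> d_subsets n d"
  let ?U = "units (sorted_list_of_set I)"
  have "tle d (act (FS d) (v I) {#(\<one>, ?U)#}) (act (FS d) (w I) {#(\<one>, ?U)#})"
    by (rule tle_act[OF tle_refl]) (use assms I in \<open>auto simp: basis_term_carrier simp del: FS_single\<close>)
  moreover have "v I \<in> carrier B" "w I \<in> carrier B" using assms I by auto
  ultimately show "tle d {#(v I, ?U)#} {#(w I, ?U)#}" by simp
qed

lemma vec_carrier: "v \<in> d_subsets n d \<rightarrow> carrier B \<Longrightarrow> vec d v \<in> carrier M"
  unfolding vec_def by (simp add: basis_sum_carrier)

lemma vec_eqI: "(\<And>I. I \<in> d_subsets n d \<Longrightarrow> v I = w I) \<Longrightarrow> vec d v = vec d w"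
  unfolding vec_def basis_sum_def by (simp cong: sum.cong)

lemma cls_in_degree_eqI: "tle l A C \<Longrightarrow> tle l C A \<Longrightarrow> cls (in_degree l A) = cls (in_degree l C)"
  by (rule arg_cong[OF in_degree_eqI])

lemma vec_add:
  assumes "v \<in> d_subsets n d \<rightarrow> carrier B" "w \<in> d_subsets n d \<rightarrow> carrier B"
  shows "vec d v \<oplus>\<^bsub>M\<^esub> vec d w = vec d (\<lambda>I. v I \<oplus> w I)"
proof -
  let ?U = "\<lambda>I. units (sorted_list_of_set I)"
  have "vec d v \<oplus>\<^bsub>M\<^esub> vec d w = cls (in_degree d (basis_sum d v + basis_sum d w))"
    unfolding vec_def using basis_sum_carrier assms by (simp add: cls_add in_degree_add)
  also have "basis_sum d v + basis_sum d w = (\<Sum>I\<in>d_subsets n d. {#(v I, ?U I), (w I, ?U I)#})"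
    unfolding basis_sum_def sum.distrib[symmetric] by (simp add: add_mset_commute)
  also have "cls (in_degree d \<dots>) = vec d (\<lambda>I. v I \<oplus> w I)"
    unfolding vec_def basis_sum_def
  proof (intro cls_in_degree_eqI tle_sum d_subsets_finite)
    fix I assume I: "I \<in> d_subsets n d"
    then have vw: "v I \<in> carrier B" "w I \<in> carrier B" using assms by auto
    have *: "({#(v I \<oplus> w I, ?U I)#}, {#(v I, ?U I), (w I, ?U I)#}) \<in> multilinear_rels B V"
      unfolding multilinear_rels_def using vw by blast
    have "{#(v I \<oplus> w I, ?U I)#} \<in> carrier (FS d)" "{#(v I, ?U I), (w I, ?U I)#} \<in> carrier (FS d)"
      using vw basis_term_carrier[OF I] unfolding FS_add_mset by auto
    from tle_multilinear[OF * this]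
    show "tle d {#(v I, ?U I), (w I, ?U I)#} {#(v I \<oplus> w I, ?U I)#}"
      "tle d {#(v I \<oplus> w I, ?U I)#} {#(v I, ?U I), (w I, ?U I)#}" by blast+
  qed
  finally show ?thesis .
qed

lemma vec_act:
  assumes "b \<in> carrier B" "v \<in> d_subsets n d \<rightarrow> carrier B"
  shows "act M b (vec d v) = vec d (\<lambda>I. b \<otimes> v I)"
proof -
  have "act (FS d) b (\<Sum>I\<in>S. {#(v I, units (sorted_list_of_set I))#}) =
      (\<Sum>I\<in>S. {#(b \<otimes> v I, units (sorted_list_of_set I))#})" if "finite S" for S
    using that by (induction S) auto
  from this[OF d_subsets_finite(1)]
  have "act (FS d) b (basis_sum d v) = basis_sum d (\<lambda>I. b \<otimes> v I)"
    unfolding basis_sum_def .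
  then show ?thesis
    unfolding vec_def using assms by (simp add: cls_act in_degree_act basis_sum_carrier del: formal_sums_simps)
qed

lemma tle_zero:
  assumes "length xs = l" "set xs \<subseteq> carrier V"
  shows "tle l {#(\<zero>, xs)#} {#}" "tle l {#} {#(\<zero>, xs)#}"
proof -
  have *: "({#(\<zero>, xs)#}, {#}) \<in> multilinear_rels B V" unfolding multilinear_rels_def by blast
  have "{#(\<zero>, xs)#} \<in> carrier (FS l)" "{#} \<in> carrier (FS l)" using assms by auto
  from tle_multilinear[OF * this] show "tle l {#(\<zero>, xs)#} {#}" "tle l {#} {#(\<zero>, xs)#}" .
qed

lemma vec_single:
  assumes "I \<in> d_subsets n d" "b \<in> carrier B"
  shows "vec d (\<lambda>K. if K = I then b else \<zero>) = cls (in_degree d {#(b, units (sorted_list_of_set I))#})"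
proof -
  let ?U = "\<lambda>I. units (sorted_list_of_set I)"
  have "vec d (\<lambda>K. if K = I then b else \<zero>) =
      cls (in_degree d (\<Sum>K\<in>d_subsets n d. if K = I then {#(b, ?U I)#} else {#}))"
    unfolding vec_def basis_sum_def
  proof (intro cls_in_degree_eqI tle_sum d_subsets_finite)
    fix K assume K: "K \<in> d_subsets n d"
    have U: "length (?U K) = d" "set (?U K) \<subseteq> carrier V"
      using K units_closed by (simp_all add: d_subsets_def)
    show "tle d {#(if K = I then b else \<zero>, ?U K)#} (if K = I then {#(b, ?U I)#} else {#})"
      "tle d (if K = I then {#(b, ?U I)#} else {#}) {#(if K = I then b else \<zero>, ?U K)#}"
      using U tle_zero[OF U] assms(2) by (auto intro!: tle_refl)
  qed
  then show ?thesis using assms(1) d_subsets_finite(1) by (simp add: sum.delta)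
qed

lemma vec_zero: "vec d (\<lambda>_. \<zero>) = \<zero>\<^bsub>M\<^esub>"
proof -
  have "vec d (\<lambda>_. \<zero>) = cls (in_degree d (\<Sum>K\<in>d_subsets n d. {#}))"
    unfolding vec_def basis_sum_def
    by (intro cls_in_degree_eqI tle_sum d_subsets_finite; rule tle_zero) (use units_closed in \<open>auto simp: d_subsets_def\<close>)
  then show ?thesis by (simp add: in_degree_zero cls_zero)
qed

definition span :: "nat \<Rightarrow> 'm set" where
  "span d = vec d ` (d_subsets n d \<rightarrow> carrier B)"

lemma span_add: "x \<in> span d \<Longrightarrow> y \<in> span d \<Longrightarrow> x \<oplus>\<^bsub>M\<^esub> y \<in> span d"
proof -
  assume "x \<in> span d" "y \<in> span d"
  then obtain v w where v: "v \<in> d_subsets n d \<rightarrow> carrier B" "w \<in> d_subsets n d \<rightarrow> carrier B" "x = vec d v" "y = vec d w"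
    unfolding span_def by blast
  moreover have "(\<lambda>I. v I \<oplus> w I) \<in> d_subsets n d \<rightarrow> carrier B" using v by auto
  ultimately show ?thesis unfolding span_def by (simp only: vec_add) blast
qed

lemma span_act: "b \<in> carrier B \<Longrightarrow> x \<in> span d \<Longrightarrow> act M b x \<in> span d"
proof -
  assume b: "b \<in> carrier B" "x \<in> span d"
  then obtain v where v: "v \<in> d_subsets n d \<rightarrow> carrier B" "x = vec d v"
    unfolding span_def by blast
  moreover have "(\<lambda>I. b \<otimes> v I) \<in> d_subsets n d \<rightarrow> carrier B" using v b by auto
  ultimately show ?thesis unfolding span_def using b(1) by (simp only: vec_act) blast
qed

lemma span_zero: "\<zero>\<^bsub>M\<^esub> \<in> span d"
  unfolding span_def using vec_zero[of d] by (metis (no_types, lifting) Pi_I image_eqI zero_closed)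

text \<open>Isolates two neighbouring letters of a word, so that a relation of degree two can be applied to them
  inside the algebra.\<close>

lemma in_degree_split:
  assumes "b \<in> carrier B" "c \<in> carrier B"
  shows "in_degree (length u) {#(b, units u)#} \<otimes>\<^bsub>T\<^esub> (in_degree 2 {#(c, units [i, j])#} \<otimes>\<^bsub>T\<^esub> in_degree (length v) {#(\<one>, units v)#})
    = in_degree (length (u @ [i, j] @ v)) {#(b \<otimes> c, units (u @ [i, j] @ v))#}"
proof -
  have 2: "{#(c, units [i, j])#} \<in> carrier (FS 2)"
    using single_carrier[OF assms(2), of "[i, j]"] by (simp add: numeral_2_eq_2)
  have c: "concatenate B {#(c, units [i, j])#} {#(\<one>, units v)#} = {#(c, units ([i, j] @ v))#}"
    using assms by (simp add: concatenate_single_left wrap_def)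
  have "in_degree 2 {#(c, units [i, j])#} \<otimes>\<^bsub>T\<^esub> in_degree (length v) {#(\<one>, units v)#} =
     in_degree (length ([i, j] @ v)) {#(c, units ([i, j] @ v))#}"
    using in_degree_mult[OF 2 single_carrier[OF one_closed, of v]] unfolding c by simp
  moreover have "concatenate B {#(b, units u)#} {#(c, units ([i, j] @ v))#} = {#(b \<otimes> c, units (u @ [i, j] @ v))#}"
    using assms by (simp add: concatenate_single_left wrap_def)
  ultimately show ?thesis
    using in_degree_mult[OF single_carrier[OF assms(1), of u] single_carrier[OF assms(2), of "[i, j] @ v"]] by simp
qed

lemma cls_word_repeat:
  assumes "b \<in> carrier B" "i \<in> {1..n}"
  shows "cls (in_degree (length (u @ [i, i] @ v)) {#(b, units (u @ [i, i] @ v))#}) = \<zero>\<^bsub>M\<^esub>"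
proof -
  let ?u = "in_degree (length u) {#(b, units u)#}" and ?v = "in_degree (length v) {#(\<one>, units v)#}"
  have c: "?u \<in> carrier T" "?v \<in> carrier T" "in_degree 2 {#(\<one>, units [i, i])#} \<in> carrier T"
    using single_carrier[OF assms(1), of u] single_carrier[OF one_closed, of v]
      single_carrier[OF one_closed, of "[i, i]"] by (simp_all add: numeral_2_eq_2)
  have "cls (in_degree (length (u @ [i, i] @ v)) {#(b, units (u @ [i, i] @ v))#}) =
      cls ?u \<otimes>\<^bsub>M\<^esub> (cls (basis_tensor B n [i, i]) \<otimes>\<^bsub>M\<^esub> cls ?v)"
    using in_degree_split[OF assms(1) one_closed, of u i i v] assms c
    by (simp add: cls_mult basis_tensor_eq numeral_2_eq_2[symmetric])
  also have "\<dots> = cls (?u \<otimes>\<^bsub>T\<^esub> (in_degree 2 {#} \<otimes>\<^bsub>T\<^esub> ?v))"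
    using c by (simp add: cls_repeat[OF assms(2)] cls_mult in_degree_zero)
  also have "\<dots> = \<zero>\<^bsub>M\<^esub>"
    using in_degree_mult[OF FS_empty single_carrier[OF one_closed, of v], of 2]
      in_degree_mult[OF single_carrier[OF assms(1), of u] FS_empty]
    by (simp add: cls_zero in_degree_zero[symmetric, of "2 + length v"]) (simp add: in_degree_zero)
  finally show ?thesis .
qed

lemma cls_word_swap:
  assumes "b \<in> carrier B" "i \<in> {1..n}" "j \<in> {1..n}" "i \<noteq> j"
  shows "cls (in_degree (length (u @ [i, j] @ v)) {#(b, units (u @ [i, j] @ v))#}) =
    act M \<epsilon> (cls (in_degree (length (u @ [j, i] @ v)) {#(b, units (u @ [j, i] @ v))#}))"
proof -
  let ?u = "in_degree (length u) {#(b, units u)#}" and ?v = "in_degree (length v) {#(\<one>, units v)#}"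
  have 2: "{#(c, units [k, l])#} \<in> carrier (FS 2)" if "c \<in> carrier B" for c k l
    using single_carrier[OF that, of "[k, l]"] by (simp add: numeral_2_eq_2)
  have c: "?u \<in> carrier T" "?v \<in> carrier T"
    using single_carrier[OF assms(1), of u] single_carrier[OF one_closed, of v] by simp_all
  have deg2: "in_degree 2 {#(c, units [k, l])#} \<in> carrier T" if "c \<in> carrier B" for c k l
    using 2[OF that] by (rule in_degree_carrier)
  have act: "act T \<epsilon> (basis_tensor B n [j, i]) = in_degree 2 {#(\<epsilon>, units [j, i])#}"
    using in_degree_act[OF eps_carrier 2[OF one_closed, of j i]]
    by (simp add: basis_tensor_eq numeral_2_eq_2)
  have "cls (in_degree (length (u @ [i, j] @ v)) {#(b, units (u @ [i, j] @ v))#}) =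
      cls ?u \<otimes>\<^bsub>M\<^esub> (cls (basis_tensor B n [i, j]) \<otimes>\<^bsub>M\<^esub> cls ?v)"
    using in_degree_split[OF assms(1) one_closed, of u i j v] assms c deg2
    by (simp add: cls_mult basis_tensor_eq numeral_2_eq_2[symmetric])
  also have "cls ?u \<otimes>\<^bsub>M\<^esub> (cls (basis_tensor B n [i, j]) \<otimes>\<^bsub>M\<^esub> cls ?v) =
      cls (?u \<otimes>\<^bsub>T\<^esub> (in_degree 2 {#(\<epsilon>, units [j, i])#} \<otimes>\<^bsub>T\<^esub> ?v))"
    unfolding cls_swap[OF assms(2-4)] act using c deg2 by (simp add: cls_mult)
  also have "\<dots> = cls (in_degree (length (u @ [j, i] @ v)) {#(b \<otimes> \<epsilon>, units (u @ [j, i] @ v))#})"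
    unfolding in_degree_split[OF assms(1) eps_carrier] ..
  also have "\<dots> = act M \<epsilon> (cls (in_degree (length (u @ [j, i] @ v)) {#(b, units (u @ [j, i] @ v))#}))"
    using single_carrier[OF assms(1), of "u @ [j, i] @ v"] assms(1) eps_carrier
    by (simp only: cls_act in_degree_carrier in_degree_act) (simp add: m_comm)
  finally show ?thesis .
qed

text \<open>Bubble sort: a word that is not strictly increasing has two neighbours with \<open>j \<le> i\<close>; they make the word
  vanish or are exchanged, which lowers the number of inversions.\<close>

lemma word_in_span:
  assumes "b \<in> carrier B" "set w \<subseteq> {1..n}"
  shows "cls (in_degree (length w) {#(b, units w)#}) \<in> span (length w)"
  using assms(2)
proof (induction "inversions w" arbitrary: w rule: less_induct)
  case less
  show ?case
  proof (cases "sorted_wrt (<) w")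
    case True
    then have "sorted_list_of_set (set w) = w"
      by (simp add: strict_sorted_iff sorted_list_of_set.idem_if_sorted_distinct)
    moreover have "set w \<in> d_subsets n (length w)"
      using less.prems True by (simp add: d_subsets_def strict_sorted_iff distinct_card)
    ultimately have "cls (in_degree (length w) {#(b, units w)#}) = vec (length w) (\<lambda>K. if K = set w then b else \<zero>)"
      using vec_single[of "set w" "length w" b] assms(1) by simp
    then show ?thesis unfolding span_def using assms(1) by auto
  next
    case False
    then obtain u i j v where w: "w = u @ [i, j] @ v" "j \<le> i" using descent_exists by blast
    with less.prems have ij: "i \<in> {1..n}" "j \<in> {1..n}" by auto
    show ?thesis
    proof (cases "i = j")
      case True
      show ?thesis unfolding w(1) True cls_word_repeat[OF assms(1) ij(2)] by (rule span_zero)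
    next
      case False
      have "inversions (u @ [j, i] @ v) < inversions w" using inversions_swap[of j i u v] w False by simp
      then have "cls (in_degree (length (u @ [j, i] @ v)) {#(b, units (u @ [j, i] @ v))#}) \<in> span (length (u @ [j, i] @ v))"
        by (rule less.hyps) (use less.prems w in auto)
      moreover have "length (u @ [j, i] @ v) = length (u @ [i, j] @ v)" by simp
      ultimately show ?thesis
        unfolding w(1) cls_word_swap[OF assms(1) ij False] by (metis span_act eps_carrier)
    qed
  qed
qed

lemma cls_in_degree_plus:
  assumes "A \<in> carrier (FS d)" "C \<in> carrier (FS d)"
  shows "cls (in_degree d (A + C)) = cls (in_degree d A) \<oplus>\<^bsub>M\<^esub> cls (in_degree d C)"
  using assms by (simp add: cls_add in_degree_add)

text \<open>The vectors are replaced by basis vectors from left to right; \<open>w\<close> collects the indices already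
  chosen.\<close>

lemma tensor_in_span:
  assumes "b \<in> carrier B" "set w \<subseteq> {1..n}" "set xs \<subseteq> carrier V"
  shows "cls (in_degree (length w + length xs) {#(b, units w @ xs)#}) \<in> span (length w + length xs)"
  using assms
proof (induction xs arbitrary: b w)
  case Nil
  then show ?case using word_in_span by simp
next
  case (Cons x xs)
  let ?d = "length w + length (x # xs)"
  have x: "x \<in> carrier V" and xs: "set xs \<subseteq> carrier V" using Cons.prems by auto
  \<comment> \<open>\<open>t k\<close> is \<open>x\<close> truncated after coordinate \<open>k\<close>; each step splits off one multiple of a basis vector.\<close>
  define t where "t k = (\<lambda>i\<in>{1..n}. if i \<le> k then x i else \<zero>)" for k
  have t: "t k \<in> carrier V" for k
    using x by (auto simp: t_def free_bmod_simps PiE_iff)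
  have carr: "{#(c, units w @ y # xs)#} \<in> carrier (FS ?d)" if "y \<in> carrier V" "c \<in> carrier B" for y c
    using that xs units_closed by simp
  have "cls (in_degree ?d {#(b, units w @ t k # xs)#}) \<in> span ?d" if "k \<le> n" for k
    using that
  proof (induction k)
    case 0
    have "t 0 = \<zero>\<^bsub>V\<^esub>" by (auto simp: t_def free_bmod_simps)
    then have "({#(b, units w @ t 0 # xs)#}, {#}) \<in> multilinear_rels B V"
      unfolding multilinear_rels_def by auto
    note * = tle_multilinear[OF this carr[OF t Cons.prems(1)] FS_empty]
    show ?case
      unfolding cls_in_degree_eqI[OF *] in_degree_zero cls_zero[symmetric] by (rule span_zero)
  next
    case (Suc k)
    let ?e = "unit_vec B n (Suc k)" and ?c = "x (Suc k)"
    have c: "?c \<in> carrier B" using Suc.prems x by simp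
    have tS: "t (Suc k) = t k \<oplus>\<^bsub>V\<^esub> act V ?c ?e"
      using x c by (auto simp: t_def free_bmod_simps unit_vec_def fun_eq_iff le_Suc_eq)
    have ce: "act V ?c ?e \<in> carrier V" by (rule V_act_closed[OF unit_vec_closed c])
    have "({#(b, units w @ [t k \<oplus>\<^bsub>V\<^esub> act V ?c ?e] @ xs)#},
        {#(b, units w @ [t k] @ xs), (b, units w @ [act V ?c ?e] @ xs)#}) \<in> multilinear_rels B V"
      unfolding multilinear_rels_def using t ce by blast
    then have 1: "({#(b, units w @ t (Suc k) # xs)#},
        {#(b, units w @ t k # xs)#} + {#(b, units w @ act V ?c ?e # xs)#}) \<in> multilinear_rels B V"
      unfolding tS by (simp add: add_mset_commute)
    note * = tle_multilinear[OF 1 carr[OF t Cons.prems(1)] FS_plus[OF carr[OF t Cons.prems(1)] carr[OF ce Cons.prems(1)]]]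
    have "({#(b, units w @ [act V ?c ?e] @ xs)#}, {#(b \<otimes> ?c, units w @ [?e] @ xs)#}) \<in> multilinear_rels B V"
      unfolding multilinear_rels_def
      by (rule UnI2, rule CollectI)
        (intro exI[of _ "units w"] exI[of _ xs] exI[of _ b] exI[of _ "?c"] exI[of _ "?e"] conjI refl
          Cons.prems(1) c unit_vec_closed)
    then have 2: "({#(b, units w @ act V ?c ?e # xs)#}, {#(b \<otimes> ?c, units w @ ?e # xs)#}) \<in> multilinear_rels B V"
      by simp
    have bc: "b \<otimes> ?c \<in> carrier B" using c Cons.prems(1) by simp
    note ** = tle_multilinear[OF 2 carr[OF ce Cons.prems(1)] carr[OF unit_vec_closed bc]]
    have "cls (in_degree (length (w @ [Suc k]) + length xs) {#(b \<otimes> ?c, units (w @ [Suc k]) @ xs)#})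
        \<in> span (length (w @ [Suc k]) + length xs)"
      by (rule Cons.IH[OF bc _ xs]) (use Cons.prems Suc.prems in auto)
    then have "cls (in_degree ?d {#(b \<otimes> ?c, units w @ ?e # xs)#}) \<in> span ?d" by simp
    moreover have "cls (in_degree ?d {#(b, units w @ t k # xs)#}) \<in> span ?d" using Suc by simp
    ultimately show ?case
      unfolding cls_in_degree_eqI[OF *]
        cls_in_degree_plus[OF carr[OF t Cons.prems(1)] carr[OF ce Cons.prems(1)]] cls_in_degree_eqI[OF **]
      by (intro span_add)
  qed
  from this[of n] have "cls (in_degree ?d {#(b, units w @ t n # xs)#}) \<in> span ?d" by simp
  moreover have "t n = x" using x by (auto simp: t_def free_bmod_simps PiE_iff extensional_def fun_eq_iff)
  ultimately show ?case by simp
qed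

lemma span_eq: "span d = cls ` homogeneous B V d"
proof (intro equalityI subsetI)
  fix x assume "x \<in> span d"
  then show "x \<in> cls ` homogeneous B V d"
    unfolding span_def homogeneous_eq vec_def using basis_sum_carrier by blast
next
  fix x assume "x \<in> cls ` homogeneous B V d"
  then obtain A where A: "A \<in> carrier (FS d)" "x = cls (in_degree d A)" unfolding homogeneous_eq by blast
  from A(1) have "cls (in_degree d A) \<in> span d"
  proof (induction A)
    case empty
    show ?case unfolding in_degree_zero cls_zero[symmetric] by (rule span_zero)
  next
    case (add x A)
    obtain b xs where x: "x = (b, xs)" by fastforce
    with add.prems have *: "{#(b, xs)#} \<in> carrier (FS d)" "A \<in> carrier (FS d)"
      unfolding x FS_add_mset by auto
    then have "cls (in_degree d {#(b, xs)#}) \<in> span d" using tensor_in_span[of b "[]" xs] by simp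
    then show ?case
      using add.IH[OF *(2)] cls_in_degree_plus[OF *(2,1)] unfolding x by (simp add: span_add)
  qed
  then show "x \<in> span d" using A by simp
qed

text \<open>Allows the sum to be formed in any structure with the operations of \<open>M\<close> that contains the span, such
  as the homogeneous part of \<open>M\<close>.\<close>

lemma finsum_eq_vec:
  fixes N :: "('b, 'm) bmodule"
  assumes "abelian_monoid N" "span d \<subseteq> carrier N" "add N = add M" "act N = act M" "zero N = zero M"
    and v: "v \<in> d_subsets n d \<rightarrow> carrier B"
    and e: "\<And>I. I \<in> d_subsets n d \<Longrightarrow> e I = vec d (\<lambda>K. if K = I then \<one> else \<zero>)"
  shows "(\<Oplus>\<^bsub>N\<^esub>I\<in>d_subsets n d. act N (v I) (e I)) = vec d v"
proof -
  interpret N: abelian_monoid N by fact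
  have summand: "act N (v I) (e I) = vec d (\<lambda>K. if K = I then v I else \<zero>)" if "I \<in> d_subsets n d" for I
  proof -
    have "v I \<in> carrier B" using v that by auto
    then show ?thesis
      unfolding e[OF that] assms(4) by (subst vec_act) (auto intro!: vec_eqI)
  qed
  have "(\<Oplus>\<^bsub>N\<^esub>I\<in>S. act N (v I) (e I)) = vec d (\<lambda>K. if K \<in> S then v K else \<zero>)" if "S \<subseteq> d_subsets n d" for S
    using finite_subset[OF that d_subsets_finite(1)] that
  proof (induction S)
    case empty
    then show ?case by (simp add: vec_zero assms(5))
  next
    case (insert I S)
    have cl: "act N (v K) (e K) \<in> carrier N" if "K \<in> d_subsets n d" for K
    proof -
      have "(\<lambda>L. if L = K then v K else \<zero>) \<in> d_subsets n d \<rightarrow> carrier B" using v that by auto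
      then show ?thesis unfolding summand[OF that] using assms(2) unfolding span_def by blast
    qed
    have "(\<Oplus>\<^bsub>N\<^esub>I\<in>insert I S. act N (v I) (e I)) =
        vec d (\<lambda>K. if K = I then v I else \<zero>) \<oplus>\<^bsub>M\<^esub> vec d (\<lambda>K. if K \<in> S then v K else \<zero>)"
      using insert cl summand by (subst N.finsum_insert) (auto simp: assms(3))
    also have "\<dots> = vec d (\<lambda>K. if K \<in> insert I S then v K else \<zero>)"
      using insert v by (subst vec_add) (auto intro!: vec_eqI simp: Pi_iff)
    finally show ?case .
  qed
  from this[OF subset_refl] show ?thesis by (simp cong: if_cong) (auto intro!: vec_eqI)
qed

end

section \<open>Modules with coordinates\<close>

text \<open>\<open>N\<close> is the free ordered module on \<open>J\<close>; \<open>vec\<close> sends coordinates to elements and is left unspecified on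
  families with values outside the carrier. Uniqueness of coordinates follows from the order.\<close>

locale coordinatized = ordered_semiring B for B :: "('b, 'z) blueprint_scheme" (structure) +
  fixes N :: "('b, 'm) bmodule" and J :: "'i set" and vec :: "('i \<Rightarrow> 'b) \<Rightarrow> 'm"
  assumes finite_J: "finite J"
    and carrier_N: "carrier N = vec ` (J \<rightarrow> carrier B)"
    and vec_cong: "\<lbrakk>v \<in> J \<rightarrow> carrier B; w \<in> J \<rightarrow> carrier B; \<And>I. I \<in> J \<Longrightarrow> v I = w I\<rbrakk> \<Longrightarrow> vec v = vec w"
    and vec_leq: "\<lbrakk>v \<in> J \<rightarrow> carrier B; w \<in> J \<rightarrow> carrier B\<rbrakk> \<Longrightarrow>
        vec v \<preceq>\<^bsub>N\<^esub> vec w \<longleftrightarrow> (\<forall>I\<in>J. v I \<preceq> w I)"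
    and vec_zero: "\<zero>\<^bsub>N\<^esub> = vec (\<lambda>_. \<zero>)"
    and vec_add: "\<lbrakk>v \<in> J \<rightarrow> carrier B; w \<in> J \<rightarrow> carrier B\<rbrakk> \<Longrightarrow>
        vec v \<oplus>\<^bsub>N\<^esub> vec w = vec (\<lambda>I. v I \<oplus> w I)"
    and vec_act: "\<lbrakk>b \<in> carrier B; v \<in> J \<rightarrow> carrier B\<rbrakk> \<Longrightarrow> act N b (vec v) = vec (\<lambda>I. b \<otimes> v I)"
begin

lemma vec_eq_iff:
  assumes "v \<in> J \<rightarrow> carrier B" "w \<in> J \<rightarrow> carrier B"
  shows "vec v = vec w \<longleftrightarrow> (\<forall>I\<in>J. v I = w I)"
proof
  assume eq: "vec v = vec w"
  have "v I \<preceq> w I" "w I \<preceq> v I" if "I \<in> J" for I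
    using vec_leq[OF assms] vec_leq[OF assms(2,1)] vec_leq[OF assms(1,1)] that assms(1) leq_refl
    unfolding eq by auto
  then show "\<forall>I\<in>J. v I = w I" using assms by (auto intro: leq_antisym)
qed (use vec_cong assms in blast)

end

context exterior_quotient
begin

lemma span_abelian_monoid:
  fixes N :: "('b, 'm) bmodule"
  assumes "carrier N = span d" "add N = add M" "zero N = zero M"
  shows "abelian_monoid N"
proof -
  interpret M: abelian_monoid M by (rule M_abelian_monoid)
  have "span d \<subseteq> carrier M" unfolding span_def using vec_carrier by blast
  then show ?thesis
    by (intro abelian_monoidI; unfold assms)
      (auto simp: span_add span_zero subset_iff M.a_ac)
qed

lemma coordinatized_span:
  fixes N :: "('b, 'm) bmodule"
  assumes "carrier N = span d" "add N = add M" "zero N = zero M" "act N = act M" "leq N = leq M"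
    and vec': "\<And>v. v \<in> d_subsets n d \<rightarrow> carrier B \<Longrightarrow> vec' v = vec d v"
  shows "coordinatized B N (d_subsets n d) vec'"
proof
  show "carrier N = vec' ` (d_subsets n d \<rightarrow> carrier B)"
    unfolding assms(1) span_def using vec' by (intro image_cong refl) simp
  show "\<zero>\<^bsub>N\<^esub> = vec' (\<lambda>_. \<zero>)" by (simp add: assms(3) vec' vec_zero)
next
  fix v w assume vw: "v \<in> d_subsets n d \<rightarrow> carrier B" "w \<in> d_subsets n d \<rightarrow> carrier B"
  then show "vec' v \<preceq>\<^bsub>N\<^esub> vec' w \<longleftrightarrow> (\<forall>I\<in>d_subsets n d. v I \<preceq> w I)"
    unfolding assms(5) vec'[OF vw(1)] vec'[OF vw(2)] using vec_leqI vec_leqD by blast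
  show "vec' v = vec' w" if "\<And>I. I \<in> d_subsets n d \<Longrightarrow> v I = w I"
    unfolding vec'[OF vw(1)] vec'[OF vw(2)] using that by (rule vec_eqI)
  have "(\<lambda>I. v I \<oplus> w I) \<in> d_subsets n d \<rightarrow> carrier B" using vw by auto
  then show "vec' v \<oplus>\<^bsub>N\<^esub> vec' w = vec' (\<lambda>I. v I \<oplus> w I)"
    using vw by (simp add: assms(2) vec' vec_add)
next
  fix b v assume b: "b \<in> carrier B" "v \<in> d_subsets n d \<rightarrow> carrier B"
  then have "(\<lambda>I. b \<otimes> v I) \<in> d_subsets n d \<rightarrow> carrier B" by auto
  then show "act N b (vec' v) = vec' (\<lambda>I. b \<otimes> v I)"
    using b by (simp add: assms(4) vec' vec_act)
qed (rule d_subsets_finite)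

lemma cls_basis_tensor:
  assumes "I \<in> d_subsets n d"
  shows "cls (basis_tensor B n (sorted_list_of_set I)) = vec d (\<lambda>K. if K = I then \<one> else \<zero>)"
  using vec_single[OF assms one_closed] assms by (simp add: basis_tensor_eq d_subsets_def)

end

context tensor_quotient
begin

lemma alg_class_eqI:
  assumes "(x, y) \<in> H" "x \<in> carrier M" "y \<in> carrier M"
  shows "alg_class M H x = alg_class M H y"
proof -
  interpret q: add_preorder M "alg_le M (H \<union> H\<inverse>)" by (rule add_preorder_alg_le)
  show ?thesis
    unfolding alg_class_def using assms by (intro q.cls_eqI alg_le.gen) auto
qed

end

subsection \<open>Exterior powers over ordered blueprints\<close>

context free_tensor_algebra
begin

lemma functional_basis:
  assumes "alt_weight \<epsilon> \<chi>" "b \<in> carrier B" "set w \<subseteq> {1..n}"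
  shows "functional \<chi> {#(b, units w)#} = b \<otimes> \<chi> w"
  using functional_single[OF _ assms(2) units_closed] expand_unit_vec[OF _ assms(3)] assms(1)
  by (simp add: alt_weight_def)

text \<open>The two defining conditions on alternating functions are the relations of the exterior algebra, read
  with the empty word on both sides.\<close>

lemma weight_le_ext_rels:
  assumes "\<epsilon> \<in> carrier B" "(x, y) \<in> ext_rels B \<epsilon> n"
  shows "weight_le \<epsilon> x y \<and> weight_le \<epsilon> y x"
proof -
  have c: "{#(b, units [i, j])#} \<in> carrier (FS 2)" if "b \<in> carrier B" for b i j
    using single_carrier[OF that, of "[i, j]"] by (simp add: numeral_2_eq_2)
  from assms(2) consider i where "i \<in> {1..n}" "x = basis_tensor B n [i, i]" "y = \<zero>\<^bsub>T\<^esub>"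
    | i j where "i \<in> {1..n}" "j \<in> {1..n}" "i \<noteq> j" "x = basis_tensor B n [i, j]"
      "y = act T \<epsilon> (basis_tensor B n [j, i])"
    unfolding ext_rels_def by blast
  then show ?thesis
  proof cases
    case (1 i)
    have x: "x = in_degree 2 {#(\<one>, units [i, i])#}" "y = in_degree 2 {#}"
      using 1 by (simp_all add: basis_tensor_eq numeral_2_eq_2 in_degree_zero)
    have "functional \<chi> {#(\<one>, units [i, i])#} = \<zero>" if "alt_weight \<epsilon> \<chi>" for \<chi>
    proof -
      have "\<chi> ([] @ [i, i] @ []) = \<zero>" using that unfolding alt_weight_def by blast
      then show ?thesis using functional_basis[OF that one_closed, of "[i, i]"] 1 by simp
    qed
    then show ?thesis
      unfolding x weight_le_in_degree[OF c[OF one_closed] FS_empty] weight_le_in_degree[OF FS_empty c[OF one_closed]]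
      by (simp add: leq_refl)
  next
    case (2 i j)
    have x: "x = in_degree 2 {#(\<one>, units [i, j])#}" "y = in_degree 2 {#(\<epsilon>, units [j, i])#}"
      using 2 act_basis_tensor[OF assms(1), of "[j, i]"] by (simp_all add: basis_tensor_eq numeral_2_eq_2)
    have "functional \<chi> {#(\<one>, units [i, j])#} = functional \<chi> {#(\<epsilon>, units [j, i])#}"
      if "alt_weight \<epsilon> \<chi>" for \<chi>
    proof -
      have "\<chi> ([] @ [i, j] @ []) = \<epsilon> \<otimes> \<chi> ([] @ [j, i] @ [])" and "weight \<chi>"
        using that 2 unfolding alt_weight_def by blast+
      then show ?thesis
        using functional_basis[OF that one_closed, of "[i, j]"] functional_basis[OF that assms(1), of "[j, i]"] 2
          assms(1) by simp
    qed
    then show ?thesis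
      unfolding x weight_le_in_degree[OF c[OF one_closed] c[OF assms(1)]]
        weight_le_in_degree[OF c[OF assms(1)] c[OF one_closed]]
      by (simp add: leq_refl)
  qed
qed

lemma exterior_quotient_ext_algebra:
  assumes "\<epsilon> \<in> carrier B" "\<epsilon> \<otimes> \<epsilon> = \<one>"
  shows "exterior_quotient B n (ext_algebra B \<epsilon> n) (alg_class T (ext_rels B \<epsilon> n)) \<epsilon>"
  unfolding ext_algebra_def
proof (intro exterior_quotient.intro exterior_quotient_axioms.intro assms
    tensor.tensor_quotient_alg_quot[of "ext_rels B \<epsilon> n"]
    tensor.weight_sound_alg_quot tensor_weight_sound)
  show "alg_class T (ext_rels B \<epsilon> n) (basis_tensor B n [i, i]) = alg_class T (ext_rels B \<epsilon> n) \<zero>\<^bsub>T\<^esub>"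
    if "i \<in> {1..n}" for i
    by (rule tensor.alg_class_eqI) (use that in \<open>auto simp: ext_rels_def\<close>)
  show "alg_class T (ext_rels B \<epsilon> n) (basis_tensor B n [i, j]) =
      alg_class T (ext_rels B \<epsilon> n) (act T \<epsilon> (basis_tensor B n [j, i]))"
    if "i \<in> {1..n}" "j \<in> {1..n}" "i \<noteq> j" for i j
    by (rule tensor.alg_class_eqI) (use that assms in \<open>auto simp: ext_rels_def\<close>)
  show "\<exists>f g. x = f \<and> y = g \<and> weight_le \<epsilon> f g \<and> weight_le \<epsilon> g f"
    if "(x, y) \<in> ext_rels B \<epsilon> n" for x y
    using weight_le_ext_rels[OF assms(1) that] by blast
qed

end

text \<open>The underlying set of the exterior power consists of the combinations with coefficients in the
  underlying monoid; as this contains \<open>0\<close> and \<open>1\<close>, it contains the \<open>e\<^sub>I\<close> and generates their whole span.\<close>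

lemma
  assumes "ordered_blueprint B" "\<epsilon> \<in> und B" "\<epsilon> \<otimes>\<^bsub>B\<^esub> \<epsilon> = \<one>\<^bsub>B\<^esub>"
  shows coordinatized_ext_power:
      "coordinatized B (ext_power B \<epsilon> n d) (d_subsets n d) (ext_vec B \<epsilon> n d)"
    and ext_basis_eq_vec: "I \<in> d_subsets n d \<Longrightarrow> ext_basis B \<epsilon> n I =
      ext_vec B \<epsilon> n d (\<lambda>K. if K = I then \<one>\<^bsub>B\<^esub> else \<zero>\<^bsub>B\<^esub>)"
proof -
  interpret ordered_blueprint B by fact
  interpret free_tensor_algebra B n ..
  have "\<epsilon> \<in> carrier B" using assms und_subset by blast
  from exterior_quotient_ext_algebra[OF this assms(3)]
  interpret E: exterior_quotient B n "ext_algebra B \<epsilon> n" "alg_class T (ext_rels B \<epsilon> n)" \<epsilon> .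
  have basis: "ext_basis B \<epsilon> n I = E.vec d (\<lambda>K. if K = I then \<one>\<^bsub>B\<^esub> else \<zero>\<^bsub>B\<^esub>)"
    if "I \<in> d_subsets n d" for I
    unfolding ext_basis_def by (rule E.cls_basis_tensor[OF that])
  have "E.span d \<subseteq> carrier (ext_algebra B \<epsilon> n)"
    unfolding E.span_def using E.vec_carrier by blast
  then have vec: "ext_vec B \<epsilon> n d v = E.vec d v" if "v \<in> d_subsets n d \<rightarrow> carrier B" for v
    unfolding ext_vec_def using that basis
    by (intro E.finsum_eq_vec E.M_abelian_monoid refl)
  define H where "H = {ext_vec B \<epsilon> n d v | v. v \<in> d_subsets n d \<rightarrow> und B}"
  have carrier: "submodule_gen B (ext_algebra B \<epsilon> n) H = E.span d"
  proof (intro equalityI subsetI)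
    fix x assume "x \<in> submodule_gen B (ext_algebra B \<epsilon> n) H"
    then show "x \<in> E.span d"
    proof induction
      case (gen x)
      then obtain v where v: "v \<in> d_subsets n d \<rightarrow> und B" "x = ext_vec B \<epsilon> n d v"
        unfolding H_def by blast
      then have "v \<in> d_subsets n d \<rightarrow> carrier B" using und_subset by blast
      then show ?case unfolding v(2) E.span_def by (simp add: vec)
    qed (auto intro: E.span_zero E.span_add E.span_act)
  next
    fix x assume "x \<in> E.span d"
    then obtain v where v: "v \<in> d_subsets n d \<rightarrow> carrier B" "x = E.vec d v" unfolding E.span_def by blast
    have "E.vec d (\<lambda>K. if K \<in> S then v K else \<zero>\<^bsub>B\<^esub>) \<in> submodule_gen B (ext_algebra B \<epsilon> n) H"
      if "S \<subseteq> d_subsets n d" for S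
      using finite_subset[OF that d_subsets_finite(1)] that
    proof (induction S)
      case empty
      show ?case using E.vec_zero submodule_gen.zero by simp
    next
      case (insert I S)
      have vI: "v I \<in> carrier B" using insert v by auto
      have "E.vec d (\<lambda>K. if K = I then \<one>\<^bsub>B\<^esub> else \<zero>\<^bsub>B\<^esub>) \<in> H"
        unfolding H_def using zero_und one_und
        by (auto intro!: exI[of _ "\<lambda>K. if K = I then \<one>\<^bsub>B\<^esub> else \<zero>\<^bsub>B\<^esub>"] vec[symmetric])
      then have "act (ext_algebra B \<epsilon> n) (v I) (E.vec d (\<lambda>K. if K = I then \<one>\<^bsub>B\<^esub> else \<zero>\<^bsub>B\<^esub>))
          \<in> submodule_gen B (ext_algebra B \<epsilon> n) H"
        by (intro submodule_gen.act[OF vI] submodule_gen.gen)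
      from submodule_gen.add[OF this insert.IH]
      have "act (ext_algebra B \<epsilon> n) (v I) (E.vec d (\<lambda>K. if K = I then \<one>\<^bsub>B\<^esub> else \<zero>\<^bsub>B\<^esub>))
         \<oplus>\<^bsub>ext_algebra B \<epsilon> n\<^esub> E.vec d (\<lambda>K. if K \<in> S then v K else \<zero>\<^bsub>B\<^esub>) \<in> submodule_gen B (ext_algebra B \<epsilon> n) H"
        using insert.prems by blast
      also have "act (ext_algebra B \<epsilon> n) (v I) (E.vec d (\<lambda>K. if K = I then \<one>\<^bsub>B\<^esub> else \<zero>\<^bsub>B\<^esub>))
         \<oplus>\<^bsub>ext_algebra B \<epsilon> n\<^esub> E.vec d (\<lambda>K. if K \<in> S then v K else \<zero>\<^bsub>B\<^esub>) =
         E.vec d (\<lambda>I'. v I \<otimes>\<^bsub>B\<^esub> (if I' = I then \<one>\<^bsub>B\<^esub> else \<zero>\<^bsub>B\<^esub>) \<oplus>\<^bsub>B\<^esub> (if I' \<in> S then v I' else \<zero>\<^bsub>B\<^esub>))"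
        using v vI by (subst E.vec_act, simp, simp, subst E.vec_add) auto
      also have "\<dots> = E.vec d (\<lambda>K. if K \<in> insert I S then v K else \<zero>\<^bsub>B\<^esub>)"
        using insert v vI by (intro E.vec_eqI) (auto simp: Pi_iff)
      finally show ?case .
    qed
    from this[OF subset_refl] have "E.vec d (\<lambda>K. if K \<in> d_subsets n d then v K else \<zero>\<^bsub>B\<^esub>) \<in> submodule_gen B (ext_algebra B \<epsilon> n) H" .
    moreover have "E.vec d (\<lambda>K. if K \<in> d_subsets n d then v K else \<zero>\<^bsub>B\<^esub>) = x"
      unfolding v(2) by (rule E.vec_eqI) simp
    ultimately show "x \<in> submodule_gen B (ext_algebra B \<epsilon> n) H" by simp
  qed
  show "coordinatized B (ext_power B \<epsilon> n d) (d_subsets n d) (ext_vec B \<epsilon> n d)"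
    by (rule E.coordinatized_span) (simp_all add: ext_power_def Let_def vec carrier[unfolded H_def])
  show "ext_basis B \<epsilon> n I = ext_vec B \<epsilon> n d (\<lambda>K. if K = I then \<one>\<^bsub>B\<^esub> else \<zero>\<^bsub>B\<^esub>)"
    if "I \<in> d_subsets n d"
    unfolding basis[OF that] by (rule vec[symmetric]) auto
qed

subsection \<open>Exterior powers over fields and idempotent semifields\<close>

lemma discrete_bp_simps [simp]:
  "carrier discrete_bp = UNIV" "mult discrete_bp = (*)" "one discrete_bp = 1"
  "zero discrete_bp = 0" "add discrete_bp = (+)" "leq discrete_bp = (=)" "und discrete_bp = UNIV"
  by (simp_all add: discrete_bp_def)

lemma ordered_semiring_discrete_bp: "ordered_semiring (discrete_bp :: 'r::comm_semiring_1 blueprint)"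
proof (intro ordered_semiring.intro semiring.intro semiring_axioms.intro ordered_semiring_axioms.intro)
  show "abelian_monoid (discrete_bp :: 'r blueprint)"
    by (rule abelian_monoidI) (simp_all add: add_ac)
  show "Group.monoid (discrete_bp :: 'r blueprint)"
    by (rule Group.monoidI) (simp_all add: mult_ac)
  show "Group.comm_monoid (discrete_bp :: 'r blueprint)"
    by (rule Group.comm_monoidI) (simp_all add: mult_ac)
qed (simp_all add: algebra_simps)

lemma free_tensor_algebra_discrete: "free_tensor_algebra (discrete_bp :: 'r::comm_semiring_1 blueprint)"
  by (intro free_tensor_algebra.intro ordered_semiring_discrete_bp)

lemma finsum_discrete: "finsum (discrete_bp :: 'r::comm_semiring_1 blueprint) f A = sum f A"
proof -
  interpret ordered_semiring "discrete_bp :: 'r blueprint" by (rule ordered_semiring_discrete_bp)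
  show ?thesis
  proof (induction A rule: infinite_finite_induct)
    case (insert x A)
    have "finsum discrete_bp f (insert x A) = f x \<oplus>\<^bsub>discrete_bp\<^esub> finsum discrete_bp f A"
      using insert by (intro finsum_insert) auto
    then show ?case using insert by simp
  qed (simp_all add: finsum_infinite)
qed

lemma expand_pair_discrete:
  "expand (discrete_bp :: 'r::comm_semiring_1 blueprint) n [x, y] \<chi> =
    (\<Sum>i\<in>{1..n}. \<Sum>j\<in>{1..n}. x i * y j * \<chi> [i, j])"
  by (simp add: finsum_discrete sum_distrib_left mult.assoc)

text \<open>In characteristic two antisymmetry alone would not suffice, so the diagonal is assumed to vanish and
  the off-diagonal terms are cancelled in pairs as \<open>n\<close> grows.\<close>

lemma sum_antisymmetric:
  fixes c :: "nat \<Rightarrow> nat \<Rightarrow> 'k::ring_1"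
  assumes "\<And>i. c i i = 0" "\<And>i j. i \<noteq> j \<Longrightarrow> c i j = - c j i"
  shows "(\<Sum>i\<in>{1..n}. \<Sum>j\<in>{1..n}. c i j) = 0"
proof (induction n)
  case (Suc n)
  have "(\<Sum>i\<in>{1..Suc n}. \<Sum>j\<in>{1..Suc n}. c i j) =
      (\<Sum>i\<in>{1..n}. \<Sum>j\<in>{1..n}. c i j) + ((\<Sum>i\<in>{1..n}. c i (Suc n)) + (\<Sum>j\<in>{1..n}. c (Suc n) j))"
    using assms(1) by (simp add: sum.distrib)
  also have "(\<Sum>j\<in>{1..n}. c (Suc n) j) = (\<Sum>j\<in>{1..n}. - c j (Suc n))"
    by (intro sum.cong assms(2)) auto
  finally show ?case using Suc by (simp add: sum_negf)
qed simp

context free_tensor_algebra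
begin

lemma pair_carrier: "x \<in> carrier V \<Longrightarrow> y \<in> carrier V \<Longrightarrow> {#(\<one>, [x, y])#} \<in> carrier (FS 2)"
  by (simp add: numeral_2_eq_2)

lemma pure_pair: "pure_tensor B V [x, y] = in_degree 2 {#(\<one>, [x, y])#}"
  by (simp add: pure_tensor_eq numeral_2_eq_2)

end

text \<open>Expanding \<open>(e\<^sub>i + e\<^sub>j) \<otimes> (e\<^sub>i + e\<^sub>j) \<equiv> 0\<close> gives \<open>e\<^sub>i \<otimes> e\<^sub>j \<equiv> - e\<^sub>j \<otimes> e\<^sub>i\<close>. Conversely an alternating functional
  kills every square \<open>x \<otimes> x\<close>, because \<open>x\<^sub>i x\<^sub>j \<chi>(ij)\<close> is antisymmetric with zero diagonal.\<close>

lemma exterior_quotient_field_ext_algebra: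
  "exterior_quotient discrete_bp n (field_ext_algebra n :: ('k::field, ('k, nat \<Rightarrow> 'k) tensor set) bmodule)
    (alg_class (discrete_tensors n) (field_ext_rels n)) (- 1)"
proof -
  interpret free_tensor_algebra "discrete_bp :: 'k blueprint" n by (rule free_tensor_algebra_discrete)
  let ?H = "field_ext_rels n :: (('k, nat \<Rightarrow> 'k) tensor \<times> ('k, nat \<Rightarrow> 'k) tensor) set"
  have Hx: "(in_degree 2 {#(1, [x, x])#}, \<zero>\<^bsub>T\<^esub>) \<in> ?H" if "x \<in> carrier V" for x
    unfolding field_ext_rels_def using that pure_pair by fastforce
  interpret Q: tensor_quotient "discrete_bp :: 'k blueprint" n "alg_quot T ?H" "alg_class T ?H"
    by (rule tensor.tensor_quotient_alg_quot)
  let ?c = "\<lambda>x y. alg_class T ?H (in_degree 2 {#(1, [x, y])#})"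
  have square: "?c x x = alg_class T ?H \<zero>\<^bsub>T\<^esub>" if "x \<in> carrier V" for x
    by (rule tensor.alg_class_eqI[OF Hx[OF that]]) (use pair_carrier[OF that that] in simp_all)
  show ?thesis
    unfolding field_ext_algebra_def
  proof (intro exterior_quotient.intro exterior_quotient_axioms.intro
      tensor.tensor_quotient_alg_quot[of ?H] tensor.weight_sound_alg_quot tensor_weight_sound)
    fix i j assume "i \<in> {1..n}"
    show "alg_class T ?H (basis_tensor discrete_bp n [i, i]) = alg_class T ?H \<zero>\<^bsub>T\<^esub>"
      using square[OF unit_vec_closed] by (simp add: basis_tensor_eq numeral_2_eq_2)
  next
    fix i j
    let ?x = "unit_vec (discrete_bp :: 'k blueprint) n i" and ?y = "unit_vec (discrete_bp :: 'k blueprint) n j"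
    let ?xy = "?x \<oplus>\<^bsub>V\<^esub> ?y"
    note cl = unit_vec_closed V_add_closed[OF unit_vec_closed unit_vec_closed]
    have pc: "{#(1, [u, v])#} \<in> carrier (FS 2)" if "u \<in> carrier V" "v \<in> carrier V" for u v
      using pair_carrier[OF that] by simp
    have T1: "tle 2 {#(1, [?xy, ?xy])#} ({#(1, [?x, ?xy])#} + {#(1, [?y, ?xy])#})"
      "tle 2 ({#(1, [?x, ?xy])#} + {#(1, [?y, ?xy])#}) {#(1, [?xy, ?xy])#}"
    proof -
      have "({#(1, [] @ [?xy] @ [?xy])#}, {#(1, [] @ [?x] @ [?xy]), (1, [] @ [?y] @ [?xy])#}) \<in> multilinear_rels discrete_bp V"
        unfolding multilinear_rels_def using cl(1) by blast
      then have "({#(1, [?xy, ?xy])#}, {#(1, [?x, ?xy])#} + {#(1, [?y, ?xy])#}) \<in> multilinear_rels discrete_bp V"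
        by (simp add: add_mset_commute)
      note * = tle_multilinear[OF this pc[OF cl(2) cl(2)] FS_plus[OF pc[OF cl(1) cl(2)] pc[OF cl(1) cl(2)]]]
      show "tle 2 {#(1, [?xy, ?xy])#} ({#(1, [?x, ?xy])#} + {#(1, [?y, ?xy])#})"
        "tle 2 ({#(1, [?x, ?xy])#} + {#(1, [?y, ?xy])#}) {#(1, [?xy, ?xy])#}" by (fact *)+
    qed
    have T2: "tle 2 {#(1, [u, ?xy])#} ({#(1, [u, ?x])#} + {#(1, [u, ?y])#})"
      "tle 2 ({#(1, [u, ?x])#} + {#(1, [u, ?y])#}) {#(1, [u, ?xy])#}" if u: "u \<in> carrier V" for u
    proof -
      have "({#(1, [u] @ [?xy] @ [])#}, {#(1, [u] @ [?x] @ []), (1, [u] @ [?y] @ [])#}) \<in> multilinear_rels discrete_bp V"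
        unfolding multilinear_rels_def using cl(1) by blast
      then have "({#(1, [u, ?xy])#}, {#(1, [u, ?x])#} + {#(1, [u, ?y])#}) \<in> multilinear_rels discrete_bp V"
        by (simp add: add_mset_commute)
      note * = tle_multilinear[OF this pc[OF u cl(2)] FS_plus[OF pc[OF u cl(1)] pc[OF u cl(1)]]]
      show "tle 2 {#(1, [u, ?xy])#} ({#(1, [u, ?x])#} + {#(1, [u, ?y])#})"
        "tle 2 ({#(1, [u, ?x])#} + {#(1, [u, ?y])#}) {#(1, [u, ?xy])#}" by (fact *)+
    qed
    let ?D = "in_degree 2 ({#(1, [?x, ?x])#} + {#(1, [?x, ?y])#} + ({#(1, [?y, ?x])#} + {#(1, [?y, ?y])#}))"
    let ?q = "alg_quot T ?H"
    interpret q: abelian_monoid ?q by (rule Q.M_abelian_monoid)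
    note c = Q.cls_carrier[OF in_degree_carrier]
    have eq: "in_degree 2 {#(1, [?xy, ?xy])#} = ?D"
      by (rule in_degree_eqI)
        (blast intro: tle_trans[OF T1(1)] tle_trans[OF _ T1(2)] tle_add[OF T2(1)[OF cl(1)] T2(1)[OF cl(1)]]
           tle_add[OF T2(2)[OF cl(1)] T2(2)[OF cl(1)]])+
    have plus: "alg_class T ?H (in_degree 2 (A + C)) = alg_class T ?H (in_degree 2 A) \<oplus>\<^bsub>?q\<^esub> alg_class T ?H (in_degree 2 C)"
      if "A \<in> carrier (FS 2)" "C \<in> carrier (FS 2)" for A C
      using that by (simp add: Q.cls_add in_degree_add)
    have "\<zero>\<^bsub>?q\<^esub> = ?c ?xy ?xy" using square[OF cl(2)] by (simp only: Q.cls_zero)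
    also have "\<dots> = (?c ?x ?x \<oplus>\<^bsub>?q\<^esub> ?c ?x ?y) \<oplus>\<^bsub>?q\<^esub> (?c ?y ?x \<oplus>\<^bsub>?q\<^esub> ?c ?y ?y)"
      unfolding eq by (simp only: plus FS_plus pc cl)
    also have "\<dots> = ?c ?x ?y \<oplus>\<^bsub>?q\<^esub> ?c ?y ?x"
      unfolding square[OF cl(1)] Q.cls_zero[symmetric] using c[OF pc[OF cl(1) cl(1)]] by simp
    finally have 0: "?c ?x ?y \<oplus>\<^bsub>?q\<^esub> ?c ?y ?x = \<zero>\<^bsub>?q\<^esub>" ..
    let ?n = "alg_class T ?H (in_degree 2 {#(-1, [?y, ?x])#})"
    have nc: "{#(-1, [?y, ?x])#} \<in> carrier (FS 2)" using cl(1) by (simp add: numeral_2_eq_2)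
    have "({#(1 \<oplus>\<^bsub>discrete_bp\<^esub> (-1), [?y, ?x])#}, {#(1, [?y, ?x]), (-1, [?y, ?x])#}) \<in> multilinear_rels (discrete_bp :: 'k blueprint) V"
      unfolding multilinear_rels_def
      by ((rule UnI1)+, rule CollectI, rule exI[of _ 1], rule exI[of _ "-1"]) auto
    then have "({#(0, [?y, ?x])#}, {#(1, [?y, ?x])#} + {#(-1, [?y, ?x])#}) \<in> multilinear_rels (discrete_bp :: 'k blueprint) V"
      by (simp add: add_mset_commute)
    note * = tle_multilinear[OF this _ FS_plus[OF pc[OF cl(1) cl(1)] nc]]
    have z: "{#(0, [?y, ?x])#} \<in> carrier (FS 2)" using cl(1) by (simp add: numeral_2_eq_2)
    have "({#(0, [?y, ?x])#}, {#}) \<in> multilinear_rels (discrete_bp :: 'k blueprint) V"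
      unfolding multilinear_rels_def by auto
    note ** = tle_multilinear[OF this z FS_empty]
    have "?c ?y ?x \<oplus>\<^bsub>?q\<^esub> ?n = alg_class T ?H (in_degree 2 {#(0, [?y, ?x])#})"
      unfolding plus[OF pc[OF cl(1) cl(1)] nc, symmetric] by (rule arg_cong[OF in_degree_eqI[OF *(2)[OF z] *(1)[OF z]]])
    also have "\<dots> = \<zero>\<^bsub>?q\<^esub>"
      unfolding in_degree_eqI[OF **] in_degree_zero Q.cls_zero ..
    finally have 1: "?c ?y ?x \<oplus>\<^bsub>?q\<^esub> ?n = \<zero>\<^bsub>?q\<^esub>" .
    have cc: "?c ?x ?y \<in> carrier ?q" "?c ?y ?x \<in> carrier ?q" "?n \<in> carrier ?q"
      using c[OF pc[OF cl(1) cl(1)]] c[OF nc] by blast+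
    have "?c ?x ?y = (?c ?x ?y \<oplus>\<^bsub>?q\<^esub> ?c ?y ?x) \<oplus>\<^bsub>?q\<^esub> ?n"
      using cc 1 by (simp only: q.a_assoc q.r_zero)
    also have "\<dots> = ?n" unfolding 0 using cc by (simp only: q.l_zero)
    finally show "alg_class T ?H (basis_tensor discrete_bp n [i, j]) =
        alg_class T ?H (act T (- 1) (basis_tensor discrete_bp n [j, i]))"
      using act_basis_tensor[of "-1" "[j, i]"] by (simp add: basis_tensor_eq numeral_2_eq_2)
  next
    fix x y assume "(x, y) \<in> ?H"
    then obtain u where u: "u \<in> carrier V" "x = in_degree 2 {#(1, [u, u])#}" "y = in_degree 2 {#}"
      unfolding field_ext_rels_def by (auto simp: pure_pair in_degree_zero)
    have "functional \<chi> {#(1, [u, u])#} = 0" if \<chi>: "alt_weight (-1) \<chi>" for \<chi>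
    proof -
      have repeat: "\<chi> ([] @ [i, i] @ []) = 0" for i
        using \<chi> unfolding alt_weight_def discrete_bp_simps by blast
      have swap: "\<chi> ([] @ [i, j] @ []) = -1 * \<chi> ([] @ [j, i] @ [])" if "i \<noteq> j" for i j
        using \<chi> that unfolding alt_weight_def discrete_bp_simps by blast
      have "(\<Sum>i\<in>{1..n}. \<Sum>j\<in>{1..n}. u i * u j * \<chi> [i, j]) = 0"
      proof (rule sum_antisymmetric)
        show "u i * u i * \<chi> [i, i] = 0" for i using repeat[of i] by simp
        show "u i * u j * \<chi> [i, j] = - (u j * u i * \<chi> [j, i])" if "i \<noteq> j" for i j
          using swap[OF that] by (simp add: mult.commute)
      qed
      then have "expand discrete_bp n [u, u] \<chi> = 0" by (simp only: expand_pair_discrete)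
      then show ?thesis using functional_single[of \<chi> 1 "[u, u]"] u(1) by simp
    qed
    then show "\<exists>f g. x = f \<and> y = g \<and> weight_le (-1) f g \<and> weight_le (-1) g f"
      using u(2,3) weight_le_in_degree[OF pair_carrier[OF u(1,1)] FS_empty] weight_le_in_degree[OF FS_empty pair_carrier[OF u(1,1)]]
      by simp
  qed simp_all
qed

text \<open>Here \<open>\<epsilon> = 1\<close>: commutativity is imposed first, the squares of the generators in a second quotient.\<close>

lemma exterior_quotient_trop_ext_algebra:
  "exterior_quotient discrete_bp n
    (trop_ext_algebra n :: ('s::idempotent_semifield, ('s, nat \<Rightarrow> 's) tensor set set) bmodule)
    (\<lambda>f. alg_class (sym_algebra n) (square_rels n) (alg_class (discrete_tensors n) (sym_rels n) f)) 1"
proof -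
  interpret free_tensor_algebra "discrete_bp :: 's blueprint" n by (rule free_tensor_algebra_discrete)
  let ?H = "sym_rels n :: (('s, nat \<Rightarrow> 's) tensor \<times> ('s, nat \<Rightarrow> 's) tensor) set"
  let ?K = "square_rels n :: (('s, nat \<Rightarrow> 's) tensor set \<times> ('s, nat \<Rightarrow> 's) tensor set) set"
  have Hxy: "(in_degree 2 {#(1, [x, y])#}, in_degree 2 {#(1, [y, x])#}) \<in> ?H"
    if "x \<in> carrier V" "y \<in> carrier V" for x y
    unfolding sym_rels_def using that pure_pair by fastforce
  interpret Q: tensor_quotient "discrete_bp :: 's blueprint" n "sym_algebra n" "alg_class T ?H"
    unfolding sym_algebra_def by (rule tensor.tensor_quotient_alg_quot)
  have sound: "Q.weight_sound 1"
    unfolding sym_algebra_def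
  proof (rule tensor.weight_sound_alg_quot[OF tensor_weight_sound])
    fix x y assume "(x, y) \<in> ?H"
    then obtain u v where u: "u \<in> carrier V" "v \<in> carrier V" "x = in_degree 2 {#(1, [u, v])#}" "y = in_degree 2 {#(1, [v, u])#}"
      unfolding sym_rels_def by (auto simp: pure_pair)
    have "functional \<chi> {#(1, [u, v])#} = functional \<chi> {#(1, [v, u])#}" if \<chi>: "alt_weight 1 \<chi>" for \<chi>
    proof -
      have "i \<noteq> j \<Longrightarrow> \<chi> ([] @ [i, j] @ []) = 1 * \<chi> ([] @ [j, i] @ [])" for i j
        using \<chi> unfolding alt_weight_def discrete_bp_simps by blast
      then have c: "\<chi> [i, j] = \<chi> [j, i]" for i j by (cases "i = j") simp_all
      have "(\<Sum>i\<in>{1..n}. \<Sum>j\<in>{1..n}. u i * v j * \<chi> [i, j]) = (\<Sum>j\<in>{1..n}. \<Sum>i\<in>{1..n}. v j * u i * \<chi> [j, i])"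
        by (subst sum.swap) (simp add: c mult.commute)
      then have "expand discrete_bp n [u, v] \<chi> = expand discrete_bp n [v, u] \<chi>" by (simp only: expand_pair_discrete)
      then show ?thesis using functional_single[of \<chi> 1 "[u, v]"] functional_single[of \<chi> 1 "[v, u]"] u(1,2) by simp
    qed
    then show "\<exists>f g. x = f \<and> y = g \<and> weight_le 1 f g \<and> weight_le 1 g f"
      using u(3,4) weight_le_in_degree[OF pair_carrier[OF u(1,2)] pair_carrier[OF u(2,1)]]
        weight_le_in_degree[OF pair_carrier[OF u(2,1)] pair_carrier[OF u(1,2)]] by simp
  qed simp
  have mult: "basis_tensor discrete_bp n [i] \<otimes>\<^bsub>T\<^esub> basis_tensor discrete_bp n [i] = basis_tensor discrete_bp n [i, i]" for i
  proof -
    have "{#(1, [unit_vec discrete_bp n i])#} \<in> carrier (FS 1)" using unit_vec_closed by simp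
    from in_degree_mult[OF this this] show ?thesis
      by (simp add: basis_tensor_eq concatenate_single_left wrap_def)
  qed
  have gen: "sym_gen n i \<otimes>\<^bsub>sym_algebra n\<^esub> sym_gen n i = alg_class T ?H (basis_tensor discrete_bp n [i, i])" for i
    unfolding sym_gen_def by (simp only: Q.cls_mult basis_tensor_carrier mult)
  have K: "(alg_class T ?H (basis_tensor discrete_bp n [i, i]), alg_class T ?H \<zero>\<^bsub>T\<^esub>) \<in> ?K" if "i \<in> {1..n}" for i
    unfolding square_rels_def gen Q.cls_zero using that by blast
  show ?thesis
    unfolding trop_ext_algebra_def
  proof (intro exterior_quotient.intro exterior_quotient_axioms.intro
      Q.tensor_quotient_alg_quot[of ?K] Q.weight_sound_alg_quot sound)
    show "alg_class (sym_algebra n) ?K (alg_class T ?H (basis_tensor discrete_bp n [i, i])) =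
       alg_class (sym_algebra n) ?K (alg_class T ?H \<zero>\<^bsub>T\<^esub>)" if "i \<in> {1..n}" for i
      by (rule Q.alg_class_eqI[OF K[OF that]]) simp_all
    show "alg_class (sym_algebra n) ?K (alg_class T ?H (basis_tensor discrete_bp n [i, j])) =
       alg_class (sym_algebra n) ?K (alg_class T ?H (act T 1 (basis_tensor discrete_bp n [j, i])))" for i j
    proof -
      have "act T 1 (basis_tensor discrete_bp n [j, i]) = basis_tensor discrete_bp n [j, i]"
        using act_basis_tensor[of 1 "[j, i]"] by (simp add: basis_tensor_eq)
      moreover have "alg_class T ?H (basis_tensor discrete_bp n [i, j]) = alg_class T ?H (basis_tensor discrete_bp n [j, i])"
        using tensor.alg_class_eqI[OF Hxy[OF unit_vec_closed unit_vec_closed], of i j]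
        by (simp add: basis_tensor_eq numeral_2_eq_2 pair_carrier[unfolded numeral_2_eq_2] unit_vec_closed)
      ultimately show ?thesis by simp
    qed
    fix x y assume "(x, y) \<in> ?K"
    then obtain i where i: "i \<in> {1..n}" "x = alg_class T ?H (basis_tensor discrete_bp n [i, i])" "y = alg_class T ?H \<zero>\<^bsub>T\<^esub>"
      unfolding square_rels_def gen Q.cls_zero by blast
    then have "(basis_tensor discrete_bp n [i, i], \<zero>\<^bsub>T\<^esub>) \<in> ext_rels (discrete_bp :: 's blueprint) 1 n"
      unfolding ext_rels_def by blast
    from weight_le_ext_rels[OF _ this] i(2,3)
    show "\<exists>f g. x = alg_class T ?H f \<and> y = alg_class T ?H g \<and> weight_le 1 f g \<and> weight_le 1 g f"
      by auto
  qed simp_all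
qed

lemma
  shows coordinatized_field_ext_power: "coordinatized discrete_bp
      (field_ext_power n d :: ('k::field, ('k, nat \<Rightarrow> 'k) tensor set) bmodule) (d_subsets n d) (field_ext_vec n d)"
    and field_ext_basis_eq_vec: "I \<in> d_subsets n d \<Longrightarrow> (field_ext_basis n I :: ('k, nat \<Rightarrow> 'k) tensor set) =
      field_ext_vec n d (\<lambda>K. if K = I then 1 else 0)"
proof -
  interpret E: exterior_quotient discrete_bp n "field_ext_algebra n :: ('k, ('k, nat \<Rightarrow> 'k) tensor set) bmodule"
    "alg_class (discrete_tensors n) (field_ext_rels n)" "- 1"
    by (rule exterior_quotient_field_ext_algebra)
  let ?N = "field_ext_power n d :: ('k, ('k, nat \<Rightarrow> 'k) tensor set) bmodule"
  have N: "carrier ?N = E.span d" "add ?N = add (field_ext_algebra n)" "zero ?N = zero (field_ext_algebra n)"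
    "act ?N = act (field_ext_algebra n)" "leq ?N = leq (field_ext_algebra n)"
    by (simp_all add: field_ext_power_def E.span_eq)
  have basis: "field_ext_basis n I = E.vec d (\<lambda>K. if K = I then 1 else 0)" if "I \<in> d_subsets n d" for I
    unfolding field_ext_basis_def using E.cls_basis_tensor[OF that] by (simp cong: if_cong)
  have vec: "field_ext_vec n d v = E.vec d v" for v
    unfolding field_ext_vec_def
    by (rule E.finsum_eq_vec[OF E.span_abelian_monoid[OF N(1-3)] _ N(2,4,3)]) (simp_all add: N basis cong: if_cong)
  show "coordinatized discrete_bp ?N (d_subsets n d) (field_ext_vec n d)"
    by (rule E.coordinatized_span[OF N]) (rule vec)
  show "(field_ext_basis n I :: ('k, nat \<Rightarrow> 'k) tensor set) = field_ext_vec n d (\<lambda>K. if K = I then 1 else 0)"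
    if "I \<in> d_subsets n d"
    unfolding vec by (rule basis[OF that])
qed

lemma
  shows coordinatized_trop_ext_power: "coordinatized discrete_bp
      (trop_ext_power n d :: ('s::idempotent_semifield, ('s, nat \<Rightarrow> 's) tensor set set) bmodule) (d_subsets n d) (trop_ext_vec n d)"
    and trop_ext_basis_eq_vec: "I \<in> d_subsets n d \<Longrightarrow> (trop_ext_basis n I :: ('s, nat \<Rightarrow> 's) tensor set set) =
      trop_ext_vec n d (\<lambda>K. if K = I then 1 else 0)"
proof -
  let ?cls = "\<lambda>f. alg_class (sym_algebra n) (square_rels n) (alg_class (discrete_tensors n) (sym_rels n) f)"
  interpret E: exterior_quotient discrete_bp n "trop_ext_algebra n :: ('s, ('s, nat \<Rightarrow> 's) tensor set set) bmodule"
    ?cls 1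
    by (rule exterior_quotient_trop_ext_algebra)
  let ?N = "trop_ext_power n d :: ('s, ('s, nat \<Rightarrow> 's) tensor set set) bmodule"
  have N: "carrier ?N = E.span d" "add ?N = add (trop_ext_algebra n)" "zero ?N = zero (trop_ext_algebra n)"
    "act ?N = act (trop_ext_algebra n)" "leq ?N = leq (trop_ext_algebra n)"
    by (simp_all add: trop_ext_power_def E.span_eq)
  have word: "foldr (\<otimes>\<^bsub>trop_ext_algebra n\<^esub>) (map (\<lambda>i. alg_class (sym_algebra n) (square_rels n) (sym_gen n i)) w)
      \<one>\<^bsub>trop_ext_algebra n\<^esub> = ?cls (basis_tensor discrete_bp n w :: ('s, nat \<Rightarrow> 's) tensor)" for w
  proof (induction w)
    case Nil
    then show ?case by (simp add: E.cls_one E.basis_tensor_eq E.tens_one)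
  next
    case (Cons i w)
    have 1: "{#(1, [unit_vec discrete_bp n i])#} \<in> carrier (E.FS 1)" using E.unit_vec_closed by simp
    have 2: "{#(1, E.units w)#} \<in> carrier (E.FS (length w))" using E.single_carrier[of 1 w] by simp
    have "basis_tensor discrete_bp n [i] \<otimes>\<^bsub>E.T\<^esub> basis_tensor discrete_bp n w = (basis_tensor discrete_bp n (i # w) :: ('s, nat \<Rightarrow> 's) tensor)"
      using E.in_degree_mult[OF 1 2] by (simp add: E.basis_tensor_eq E.concatenate_single_left E.wrap_def)
    then show ?case
      using Cons by (simp add: sym_gen_def E.cls_mult)
  qed
  have basis: "trop_ext_basis n I = E.vec d (\<lambda>K. if K = I then 1 else 0)" if "I \<in> d_subsets n d" for I
    unfolding trop_ext_basis_def word using E.cls_basis_tensor[OF that] by (simp cong: if_cong)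
  have vec: "trop_ext_vec n d v = E.vec d v" for v
    unfolding trop_ext_vec_def
    by (rule E.finsum_eq_vec[OF E.span_abelian_monoid[OF N(1-3)] _ N(2,4,3)]) (simp_all add: N basis cong: if_cong)
  show "coordinatized discrete_bp ?N (d_subsets n d) (trop_ext_vec n d)"
    by (rule E.coordinatized_span[OF N]) (rule vec)
  show "(trop_ext_basis n I :: ('s, nat \<Rightarrow> 's) tensor set set) = trop_ext_vec n d (\<lambda>K. if K = I then 1 else 0)"
    if "I \<in> d_subsets n d"
    unfolding vec by (rule basis[OF that])
qed

section \<open>Base change along a retraction of scalars\<close>

lemma (in coordinatized) N_abelian_monoid: "abelian_monoid N"
proof (rule abelian_monoidI, unfold carrier_N)
  fix x y z
  assume "x \<in> vec ` (J \<rightarrow> carrier B)" "y \<in> vec ` (J \<rightarrow> carrier B)" "z \<in> vec ` (J \<rightarrow> carrier B)"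
  then obtain u v w where u: "u \<in> J \<rightarrow> carrier B" "v \<in> J \<rightarrow> carrier B" "w \<in> J \<rightarrow> carrier B"
    "x = vec u" "y = vec v" "z = vec w" by blast
  then have "(\<lambda>I. u I \<oplus> v I) \<in> J \<rightarrow> carrier B" "(\<lambda>I. v I \<oplus> w I) \<in> J \<rightarrow> carrier B" by auto
  then show "x \<oplus>\<^bsub>N\<^esub> y \<oplus>\<^bsub>N\<^esub> z = x \<oplus>\<^bsub>N\<^esub> (y \<oplus>\<^bsub>N\<^esub> z)"
    using u by (simp add: vec_add) (rule vec_cong; auto simp: Pi_iff a_assoc)
next
  fix x y assume "x \<in> vec ` (J \<rightarrow> carrier B)" "y \<in> vec ` (J \<rightarrow> carrier B)"
  then obtain u v where u: "u \<in> J \<rightarrow> carrier B" "v \<in> J \<rightarrow> carrier B" "x = vec u" "y = vec v" by blast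
  then have "(\<lambda>I. u I \<oplus> v I) \<in> J \<rightarrow> carrier B" "(\<lambda>I. v I \<oplus> u I) \<in> J \<rightarrow> carrier B" by auto
  with u show "x \<oplus>\<^bsub>N\<^esub> y \<in> vec ` (J \<rightarrow> carrier B)" "x \<oplus>\<^bsub>N\<^esub> y = y \<oplus>\<^bsub>N\<^esub> x"
    by (simp_all add: vec_add) (rule vec_cong; auto simp: Pi_iff a_comm)
next
  show "\<zero>\<^bsub>N\<^esub> \<in> vec ` (J \<rightarrow> carrier B)" unfolding vec_zero by auto
next
  fix x assume "x \<in> vec ` (J \<rightarrow> carrier B)"
  then obtain u where u: "u \<in> J \<rightarrow> carrier B" "x = vec u" by blast
  show "\<zero>\<^bsub>N\<^esub> \<oplus>\<^bsub>N\<^esub> x = x"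
    unfolding vec_zero u(2) by (subst vec_add; (rule vec_cong)?; use u(1) in \<open>auto simp: Pi_iff\<close>)
qed

text \<open>The situation of \<open>K\<^sup>m\<^sup>o\<^sup>n\<close> and \<open>S\<^sup>m\<^sup>o\<^sup>n\<close>: \<open>\<theta>\<close> sums a multiset and \<open>\<sigma>\<close> is the inclusion of monomials, which is
  not additive. The order \<open>sle\<close> on the target makes \<open>\<theta>\<close> monotone; it is equality for rings and the
  natural order for idempotent semirings.\<close>

locale scalar_retraction = ordered_semiring B for B :: "('b, 'z) blueprint_scheme" (structure) +
  fixes \<theta> :: "'b \<Rightarrow> 'r::comm_semiring_1" and \<sigma> :: "'r \<Rightarrow> 'b" and sle :: "'r \<Rightarrow> 'r \<Rightarrow> bool"
  assumes \<theta>_zero: "\<theta> \<zero> = 0" and \<theta>_one: "\<theta> \<one> = 1"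
    and \<theta>_add: "\<lbrakk>x \<in> carrier B; y \<in> carrier B\<rbrakk> \<Longrightarrow> \<theta> (x \<oplus> y) = \<theta> x + \<theta> y"
    and \<theta>_mult: "\<lbrakk>x \<in> carrier B; y \<in> carrier B\<rbrakk> \<Longrightarrow> \<theta> (x \<otimes> y) = \<theta> x * \<theta> y"
    and \<sigma>_carrier [simp]: "\<sigma> a \<in> carrier B" and \<theta>_\<sigma> [simp]: "\<theta> (\<sigma> a) = a"
    and sle_refl: "sle a a"
    and sle_trans: "\<lbrakk>sle a b; sle b c\<rbrakk> \<Longrightarrow> sle a c"
    and sle_antisym: "\<lbrakk>sle a b; sle b a\<rbrakk> \<Longrightarrow> a = b"
    and sle_add: "sle a b \<Longrightarrow> sle (a + c) (b + c)"
    and sle_mult: "\<lbrakk>sle a b; sle a' b'\<rbrakk> \<Longrightarrow> sle (a * a') (b * b')"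
    and \<theta>_mono: "\<lbrakk>x \<in> carrier B; y \<in> carrier B; x \<preceq> y\<rbrakk> \<Longrightarrow> sle (\<theta> x) (\<theta> y)"

text \<open>\<open>H_sound\<close> keeps apart elements whose coordinates have different sums; \<open>H_complete\<close> identifies each
  element with a normal form that depends on these sums only.\<close>

locale scalar_quotient = scalar_retraction B \<theta> \<sigma> sle + E: coordinatized B E J vecE
  for B :: "('b, 'z) blueprint_scheme" (structure) and \<theta> :: "'b \<Rightarrow> 'r::comm_semiring_1" and \<sigma> sle
    and E :: "('b, 'm) bmodule" and J :: "'i set" and vecE +
  fixes H :: "('m \<times> 'm) set"
  assumes H_sound: "\<lbrakk>v \<in> J \<rightarrow> carrier B; w \<in> J \<rightarrow> carrier B; (vecE v, vecE w) \<in> H; I \<in> J\<rbrakk> \<Longrightarrow>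
      sle (\<theta> (v I)) (\<theta> (w I))"
    and H_complete: "v \<in> J \<rightarrow> carrier B \<Longrightarrow>
      mod_le B E H (vecE v) (vecE (\<lambda>I. \<sigma> (\<theta> (v I)))) \<and> mod_le B E H (vecE (\<lambda>I. \<sigma> (\<theta> (v I)))) (vecE v)"
begin

abbreviation "r \<equiv> mod_le B E H"
abbreviation "c \<equiv> pre_class (carrier E) r"

lemma E_cases: assumes "x \<in> carrier E" obtains v where "v \<in> J \<rightarrow> carrier B" "x = vecE v"
  using assms unfolding E.carrier_N by blast

lemma vecE_carrier: "v \<in> J \<rightarrow> carrier B \<Longrightarrow> vecE v \<in> carrier E"
  unfolding E.carrier_N by blast

lemma E_act_closed: "b \<in> carrier B \<Longrightarrow> x \<in> carrier E \<Longrightarrow> act E b x \<in> carrier E"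
  by (elim E_cases) (auto simp: E.vec_act intro!: vecE_carrier)

lemma E_refl: "x \<in> carrier E \<Longrightarrow> x \<preceq>\<^bsub>E\<^esub> x"
  by (elim E_cases) (auto simp: E.vec_leq intro!: leq_refl)

lemma r_carrier: "r x y \<Longrightarrow> x \<in> carrier E \<and> y \<in> carrier E"
  by (induction rule: mod_le.induct)
    (auto intro: E_act_closed abelian_monoid.a_closed[OF E.N_abelian_monoid])

lemma add_preorder_r: "add_preorder E r"
proof (intro add_preorder.intro add_preorder_axioms.intro E.N_abelian_monoid)
  show "r x x" if "x \<in> carrier E" for x by (rule mod_le.order[OF that that E_refl[OF that]])
qed (fact r_carrier mod_le.trans mod_le.add)+

sublocale q: add_preorder E r by (rule add_preorder_r)

text \<open>All closure rules of an additive preorder are inherited by the comparison of sums in each coordinate.\<close>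

lemma r_sound:
  assumes "r x y"
  shows "\<exists>v w. v \<in> J \<rightarrow> carrier B \<and> w \<in> J \<rightarrow> carrier B \<and> x = vecE v \<and> y = vecE w \<and>
    (\<forall>I\<in>J. sle (\<theta> (v I)) (\<theta> (w I)))"
  using assms
proof (induction rule: mod_le.induct)
  case (order x y)
  then obtain v w where vw: "v \<in> J \<rightarrow> carrier B" "w \<in> J \<rightarrow> carrier B" "x = vecE v" "y = vecE w"
    by (elim E_cases) simp
  then have "\<forall>I\<in>J. v I \<preceq> w I" using order.hyps(3) by (simp add: E.vec_leq)
  then have "\<forall>I\<in>J. sle (\<theta> (v I)) (\<theta> (w I))" using vw by (auto simp: Pi_iff intro: \<theta>_mono)
  then show ?case using vw by blast
next
  case (gen x y)
  then obtain v w where vw: "v \<in> J \<rightarrow> carrier B" "w \<in> J \<rightarrow> carrier B" "x = vecE v" "y = vecE w"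
    by (elim E_cases) simp
  then have "\<forall>I\<in>J. sle (\<theta> (v I)) (\<theta> (w I))" using gen.hyps(3) H_sound by simp
  then show ?case using vw by blast
next
  case (trans x y z)
  then obtain u v v' w where *: "u \<in> J \<rightarrow> carrier B" "v \<in> J \<rightarrow> carrier B" "v' \<in> J \<rightarrow> carrier B" "w \<in> J \<rightarrow> carrier B"
    "x = vecE u" "y = vecE v" "y = vecE v'" "z = vecE w"
    "\<forall>I\<in>J. sle (\<theta> (u I)) (\<theta> (v I))" "\<forall>I\<in>J. sle (\<theta> (v' I)) (\<theta> (w I))" by blast
  then have "\<forall>I\<in>J. v I = v' I" using E.vec_eq_iff by blast
  with *(9,10) have "\<forall>I\<in>J. sle (\<theta> (u I)) (\<theta> (w I))" by (metis sle_trans)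
  then show ?case using * by blast
next
  case (add x y z)
  from add.IH obtain v w where vw: "v \<in> J \<rightarrow> carrier B" "w \<in> J \<rightarrow> carrier B"
    "x = vecE v" "y = vecE w" "\<forall>I\<in>J. sle (\<theta> (v I)) (\<theta> (w I))" by blast
  from add.hyps obtain u where u: "u \<in> J \<rightarrow> carrier B" "z = vecE u" by (elim E_cases)
  have "x \<oplus>\<^bsub>E\<^esub> z = vecE (\<lambda>I. v I \<oplus> u I)" "y \<oplus>\<^bsub>E\<^esub> z = vecE (\<lambda>I. w I \<oplus> u I)"
    using vw u by (simp_all add: E.vec_add)
  moreover have "\<forall>I\<in>J. sle (\<theta> (v I \<oplus> u I)) (\<theta> (w I \<oplus> u I))"
    using vw u by (auto simp: \<theta>_add Pi_iff intro: sle_add)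
  moreover have "(\<lambda>I. v I \<oplus> u I) \<in> J \<rightarrow> carrier B" "(\<lambda>I. w I \<oplus> u I) \<in> J \<rightarrow> carrier B" using vw u by auto
  ultimately show ?case by blast
next
  case (act a b x y)
  from act.IH obtain v w where vw: "v \<in> J \<rightarrow> carrier B" "w \<in> J \<rightarrow> carrier B"
    "x = vecE v" "y = vecE w" "\<forall>I\<in>J. sle (\<theta> (v I)) (\<theta> (w I))" by blast
  have "act E a x = vecE (\<lambda>I. a \<otimes> v I)" "act E b y = vecE (\<lambda>I. b \<otimes> w I)"
    using vw act by (simp_all add: E.vec_act)
  moreover have "\<forall>I\<in>J. sle (\<theta> (a \<otimes> v I)) (\<theta> (b \<otimes> w I))"
    using vw act by (auto simp: \<theta>_mult Pi_iff intro: sle_mult \<theta>_mono)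
  moreover have "(\<lambda>I. a \<otimes> v I) \<in> J \<rightarrow> carrier B" "(\<lambda>I. b \<otimes> w I) \<in> J \<rightarrow> carrier B" using vw act by auto
  ultimately show ?case by blast
qed

lemma r_vecE:
  assumes "v \<in> J \<rightarrow> carrier B" "w \<in> J \<rightarrow> carrier B" "r (vecE v) (vecE w)" "I \<in> J"
  shows "sle (\<theta> (v I)) (\<theta> (w I))"
proof -
  from r_sound[OF assms(3)] obtain v' w' where *: "v' \<in> J \<rightarrow> carrier B" "w' \<in> J \<rightarrow> carrier B"
    "vecE v = vecE v'" "vecE w = vecE w'" "\<forall>I\<in>J. sle (\<theta> (v' I)) (\<theta> (w' I))" by blast
  then have "v I = v' I" "w I = w' I" using assms E.vec_eq_iff by blast+
  then show ?thesis using * assms(4) by simp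
qed

lemma c_vecE_eq_iff:
  assumes "v \<in> J \<rightarrow> carrier B" "w \<in> J \<rightarrow> carrier B"
  shows "c (vecE v) = c (vecE w) \<longleftrightarrow> (\<forall>I\<in>J. \<theta> (v I) = \<theta> (w I))"
proof
  assume "c (vecE v) = c (vecE w)"
  then have "r (vecE v) (vecE w)" "r (vecE w) (vecE v)"
    using q.cls_eq_iff assms vecE_carrier by blast+
  then show "\<forall>I\<in>J. \<theta> (v I) = \<theta> (w I)" using r_vecE assms sle_antisym by blast
next
  assume eq: "\<forall>I\<in>J. \<theta> (v I) = \<theta> (w I)"
  have "vecE (\<lambda>I. \<sigma> (\<theta> (v I))) = vecE (\<lambda>I. \<sigma> (\<theta> (w I)))"
    by (rule E.vec_cong) (use eq in auto)
  then show "c (vecE v) = c (vecE w)"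
    using H_complete[OF assms(1)] H_complete[OF assms(2)] by (metis q.cls_eqI)
qed

abbreviation "Q \<equiv> bmod_quot E r"

lemma Q_add:
  assumes "v \<in> J \<rightarrow> carrier B" "w \<in> J \<rightarrow> carrier B"
  shows "c (vecE v) \<oplus>\<^bsub>Q\<^esub> c (vecE w) = c (vecE (\<lambda>I. v I \<oplus> w I))"
  using q.quot_add[OF vecE_carrier[OF assms(1)] vecE_carrier[OF assms(2)]]
  unfolding bmod_quot_simps E.vec_add[OF assms] .

lemma Q_act:
  assumes "b \<in> carrier B" "v \<in> J \<rightarrow> carrier B"
  shows "act Q b (c (vecE v)) = c (vecE (\<lambda>I. b \<otimes> v I))"
proof -
  have "(\<Union>x\<in>c (vecE v). c (act E b x)) = c (act E b (vecE v))"
    by (rule q.quot_map[OF mod_le.act[OF assms(1) assms(1) leq_refl[OF assms(1)]] vecE_carrier[OF assms(2)]])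
  then show ?thesis unfolding bmod_quot_simps E.vec_act[OF assms] .
qed

text \<open>Semilinearity and the values on the basis determine the map on all elements; one basis vector is
  added at a time.\<close>

lemma canonical_iso_vec:
  assumes "coordinatized discrete_bp M J vecM"
    and iso: "semilinear_iso \<sigma> M Q \<Phi>"
    and basis: "\<And>I. I \<in> J \<Longrightarrow> \<Phi> (vecM (\<lambda>K. if K = I then 1 else 0)) = c (vecE (\<lambda>K. if K = I then \<one> else \<zero>))"
  shows "\<Phi> (vecM v) = c (vecE (\<lambda>I. \<sigma> (v I)))"
proof -
  interpret M: coordinatized discrete_bp M J vecM by fact
  have iso_add: "\<Phi> (x \<oplus>\<^bsub>M\<^esub> y) = \<Phi> x \<oplus>\<^bsub>Q\<^esub> \<Phi> y" if "x \<in> carrier M" "y \<in> carrier M" for x y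
    using iso that unfolding semilinear_iso_def by blast
  have iso_act: "\<Phi> (act M a x) = act Q (\<sigma> a) (\<Phi> x)" if "x \<in> carrier M" for a x
    using iso that unfolding semilinear_iso_def by blast
  have "\<Phi> (vecM (\<lambda>K. if K \<in> S then v K else 0)) = c (vecE (\<lambda>K. if K \<in> S then \<sigma> (v K) else \<zero>))"
    if "S \<subseteq> J" for S
    using finite_subset[OF that E.finite_J] that
  proof (induction S)
    case empty
    show ?case using iso unfolding semilinear_iso_def by (simp add: M.vec_zero E.vec_zero)
  next
    case (insert I S)
    let ?s = "vecM (\<lambda>K. if K \<in> S then v K else 0)" and ?e = "vecM (\<lambda>K. if K = I then 1 else 0)"
    have carr: "?s \<in> carrier M" "?e \<in> carrier M" "act M (v I) ?e \<in> carrier M"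
      by (auto simp: M.carrier_N M.vec_act)
    have "vecM (\<lambda>K. if K \<in> insert I S then v K else 0) = ?s \<oplus>\<^bsub>M\<^esub> act M (v I) ?e"
      using insert.hyps by (auto simp: M.vec_act M.vec_add intro!: M.vec_cong)
    then have "\<Phi> (vecM (\<lambda>K. if K \<in> insert I S then v K else 0)) =
        \<Phi> ?s \<oplus>\<^bsub>Q\<^esub> act Q (\<sigma> (v I)) (\<Phi> ?e)"
      by (simp only: iso_add[OF carr(1,3)] iso_act[OF carr(2)])
    also have "\<dots> = c (vecE (\<lambda>K. if K \<in> S then \<sigma> (v K) else \<zero>)) \<oplus>\<^bsub>Q\<^esub>
        act Q (\<sigma> (v I)) (c (vecE (\<lambda>K. if K = I then \<one> else \<zero>)))"
      using insert basis by (simp del: bmod_quot_simps)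
    also have "\<dots> = c (vecE (\<lambda>K. (if K \<in> S then \<sigma> (v K) else \<zero>) \<oplus> \<sigma> (v I) \<otimes> (if K = I then \<one> else \<zero>)))"
      by (subst Q_act; (subst Q_add)?; auto simp del: bmod_quot_simps)
    also have "\<dots> = c (vecE (\<lambda>K. if K \<in> insert I S then \<sigma> (v K) else \<zero>))"
      using insert.hyps by (intro arg_cong[of _ _ c] E.vec_cong) auto
    finally show ?case .
  qed
  from this[OF subset_refl]
  have "\<Phi> (vecM (\<lambda>K. if K \<in> J then v K else 0)) = c (vecE (\<lambda>K. if K \<in> J then \<sigma> (v K) else \<zero>))" .
  moreover have "vecM (\<lambda>K. if K \<in> J then v K else 0) = vecM v" by (rule M.vec_cong) auto
  moreover have "vecE (\<lambda>K. if K \<in> J then \<sigma> (v K) else \<zero>) = vecE (\<lambda>I. \<sigma> (v I))" by (rule E.vec_cong) auto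
  ultimately show ?thesis by simp
qed

text \<open>Additivity holds although \<open>\<sigma>\<close> is not additive: both sides have the same sums in each coordinate.\<close>

lemma canonical_iso_exists:
  assumes "coordinatized discrete_bp M J vecM"
  shows "\<exists>\<Phi>. semilinear_iso \<sigma> M Q \<Phi> \<and>
    (\<forall>I\<in>J. \<Phi> (vecM (\<lambda>K. if K = I then 1 else 0)) = c (vecE (\<lambda>K. if K = I then \<one> else \<zero>)))"
proof -
  interpret M: coordinatized discrete_bp M J vecM by fact
  define \<Phi> where "\<Phi> x = c (vecE (\<lambda>I. \<sigma> ((SOME v. x = vecM v) I)))" for x
  have \<Phi>: "\<Phi> (vecM v) = c (vecE (\<lambda>I. \<sigma> (v I)))" for v
  proof -
    have "vecM v = vecM (SOME u. vecM v = vecM u)" by (rule someI[of _ v]) simp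
    then have "\<forall>I\<in>J. v I = (SOME u. vecM v = vecM u) I" by (subst (asm) M.vec_eq_iff) auto
    then have "vecE (\<lambda>I. \<sigma> ((SOME u. vecM v = vecM u) I)) = vecE (\<lambda>I. \<sigma> (v I))"
      by (intro E.vec_cong) auto
    then show ?thesis unfolding \<Phi>_def by simp
  qed
  have carrier_M: "carrier M = range vecM" unfolding M.carrier_N by (simp add: Pi_UNIV)
  have "bij_betw \<Phi> (carrier M) (carrier Q)"
    unfolding bij_betw_def
  proof
    show "inj_on \<Phi> (carrier M)"
      unfolding carrier_M
    proof (rule inj_onI, clarify)
      fix v w assume "\<Phi> (vecM v) = \<Phi> (vecM w)"
      then have "\<forall>I\<in>J. \<theta> (\<sigma> (v I)) = \<theta> (\<sigma> (w I))"
        unfolding \<Phi> by (subst (asm) c_vecE_eq_iff) auto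
      then show "vecM v = vecM w" by (intro M.vec_cong) auto
    qed
    have "c (vecE v) \<in> \<Phi> ` carrier M" if "v \<in> J \<rightarrow> carrier B" for v
    proof -
      have "c (vecE v) = c (vecE (\<lambda>I. \<sigma> (\<theta> (v I))))" using that by (subst c_vecE_eq_iff) auto
      then show ?thesis using \<Phi>[of "\<lambda>I. \<theta> (v I)"] unfolding carrier_M by blast
    qed
    moreover have "c (vecE (\<lambda>I. \<sigma> (v I))) \<in> carrier Q" for v
      by (auto simp: E.carrier_N)
    ultimately show "\<Phi> ` carrier M = carrier Q"
      by (auto simp: carrier_M \<Phi> E.carrier_N)
  qed
  moreover have "\<Phi> \<zero>\<^bsub>M\<^esub> = \<zero>\<^bsub>Q\<^esub>"
    by (simp add: M.vec_zero E.vec_zero \<Phi>) (subst c_vecE_eq_iff, auto simp: \<theta>_zero)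
  moreover have "\<Phi> (vecM v \<oplus>\<^bsub>M\<^esub> vecM w) = \<Phi> (vecM v) \<oplus>\<^bsub>Q\<^esub> \<Phi> (vecM w)" for v w
  proof -
    have "\<Phi> (vecM v \<oplus>\<^bsub>M\<^esub> vecM w) = c (vecE (\<lambda>I. \<sigma> (v I + w I)))" by (simp add: M.vec_add \<Phi>)
    also have "\<dots> = c (vecE (\<lambda>I. \<sigma> (v I) \<oplus> \<sigma> (w I)))" by (subst c_vecE_eq_iff) (auto simp: \<theta>_add)
    also have "\<dots> = \<Phi> (vecM v) \<oplus>\<^bsub>Q\<^esub> \<Phi> (vecM w)" unfolding \<Phi> by (subst Q_add) auto
    finally show ?thesis .
  qed
  moreover have "\<Phi> (act M a (vecM v)) = act Q (\<sigma> a) (\<Phi> (vecM v))" for a v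
  proof -
    have "\<Phi> (act M a (vecM v)) = c (vecE (\<lambda>I. \<sigma> (a * v I)))" by (simp add: M.vec_act \<Phi>)
    also have "\<dots> = c (vecE (\<lambda>I. \<sigma> a \<otimes> \<sigma> (v I)))" by (subst c_vecE_eq_iff) (auto simp: \<theta>_mult)
    also have "\<dots> = act Q (\<sigma> a) (\<Phi> (vecM v))" unfolding \<Phi> by (subst Q_act) auto
    finally show ?thesis .
  qed
  ultimately have "semilinear_iso \<sigma> M Q \<Phi>"
    unfolding semilinear_iso_def carrier_M by blast
  moreover have "\<Phi> (vecM (\<lambda>K. if K = I then 1 else 0)) = c (vecE (\<lambda>K. if K = I then \<one> else \<zero>))" for I
    unfolding \<Phi> by (subst c_vecE_eq_iff) (auto simp: \<theta>_zero \<theta>_one)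
  ultimately show ?thesis by blast
qed

end

section \<open>Monomial blueprints\<close>

lemma monoid_semiring_simps [simp]:
  "carrier monoid_semiring = UNIV" "one monoid_semiring = {#1#}" "zero monoid_semiring = {#}"
  "add monoid_semiring = (+)" "leq monoid_semiring = (=)"
  "und monoid_semiring = insert {#} (range (\<lambda>a. {#a#}))"
  by (simp_all add: monoid_semiring_def)

abbreviation mset_mult where "mset_mult \<equiv> mult monoid_semiring"

lemma mset_mult_simps [simp]:
  "mset_mult {#} Y = {#}" "mset_mult (add_mset a X) Y = image_mset ((*) a) Y + mset_mult X Y"
  by (simp_all add: monoid_semiring_def)

lemma mset_mult_empty_right [simp]: "mset_mult X {#} = {#}"
  by (induction X) auto

lemma mset_mult_union_left: "mset_mult (X + X') Y = mset_mult X Y + mset_mult X' Y"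
  by (induction X) (auto simp: add_ac)

lemma mset_mult_union_right: "mset_mult X (Y + Y') = mset_mult X Y + mset_mult X Y'"
  by (induction X) (auto simp: add_ac)

lemma mset_mult_single [simp]: "mset_mult {#a#} Y = image_mset ((*) a) Y"
  using mset_mult_simps(2)[of a "{#}" Y] by simp

lemma mset_mult_add_right: "mset_mult X (add_mset b Y) = image_mset (\<lambda>a. a * b) X + mset_mult X Y"
  by (induction X) (auto simp: add_ac)

lemma mset_mult_comm: "mset_mult X Y = mset_mult Y X"
  by (induction X) (auto simp: mset_mult_add_right mult.commute)

lemma mset_mult_image: "mset_mult (image_mset ((*) a) Y) Z = image_mset ((*) a) (mset_mult Y Z)"
proof (induction Y)
  case (add x Y)
  have "(*) (a * x) = (\<lambda>y. a * (x * y))" by (simp add: fun_eq_iff mult.assoc)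
  then show ?case using add by (simp add: image_mset.compositionality o_def)
qed simp

lemma mset_mult_assoc: "mset_mult (mset_mult X Y) Z = mset_mult X (mset_mult Y Z)"
  by (induction X) (auto simp: mset_mult_union_left mset_mult_image)

lemma image_mset_mult_one [simp]: "image_mset ((*) 1) X = (X :: 'a::monoid_mult multiset)"
  by (induction X) simp_all

lemma mset_mult_one: "mset_mult {#1#} X = X" "mset_mult X {#1#} = X"
  using mset_mult_comm[of X "{#1#}"] by simp_all

lemma sum_mset_mset_mult: "\<Sum>\<^sub># (mset_mult X Y) = \<Sum>\<^sub># X * (\<Sum>\<^sub># Y :: 'r::comm_semiring_1)"
proof (induction X)
  case (add x X)
  have "\<Sum>\<^sub># (image_mset ((*) x) Y) = x * \<Sum>\<^sub># Y" by (induction Y) (simp_all add: distrib_left)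
  then show ?case using add by (simp add: distrib_right)
qed simp

definition mclass ::
    "('d::{comm_monoid_mult,mult_zero} multiset \<times> 'd multiset) set \<Rightarrow> 'd multiset \<Rightarrow> 'd multiset set" where
  "mclass H A = pre_class UNIV (monomial_le H) A"

lemma monomial_eq_mclass: "monomial H a = mclass H {#a#}"
  by (simp add: monomial_def mclass_def)

lemma mle_refl: "monomial_le H A A"
  unfolding monomial_le_def by (rule alg_le.order) simp_all

lemma mle_gen: "(A, C) \<in> H \<Longrightarrow> monomial_le H A C"
  unfolding monomial_le_def by (rule alg_le.gen) simp_all

lemma mle_zero: "monomial_le H {#} {#0#}" "monomial_le H {#0#} {#}"
  unfolding monomial_le_def by (rule alg_le.gen; simp)+

lemma mle_trans: "monomial_le H A C \<Longrightarrow> monomial_le H C D \<Longrightarrow> monomial_le H A D"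
  unfolding monomial_le_def by (rule alg_le.trans)

lemma monomial_add_preorder: "add_preorder monoid_semiring (monomial_le H)"
proof (intro add_preorder.intro add_preorder_axioms.intro)
  show "abelian_monoid (monoid_semiring :: 'a multiset blueprint)"
    by (rule abelian_monoidI) (simp_all add: add_ac)
  show "monomial_le H (x \<oplus>\<^bsub>monoid_semiring\<^esub> z) (y \<oplus>\<^bsub>monoid_semiring\<^esub> z)" if "monomial_le H x y" for x y z
    using that unfolding monomial_le_def by (rule alg_le.add) simp
  show "monomial_le H x z" if "monomial_le H x y" "monomial_le H y z" for x y z
    using that by (rule mle_trans)
qed (simp_all add: mle_refl)

lemma mle_add: "monomial_le H A A' \<Longrightarrow> monomial_le H C C' \<Longrightarrow> monomial_le H (A + C) (A' + C')"
  using add_preorder.r_add2[OF monomial_add_preorder] by fastforce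

lemma mclass_eq_iff: "mclass H A = mclass H C \<longleftrightarrow> monomial_le H A C \<and> monomial_le H C A"
  unfolding mclass_def using add_preorder.cls_eq_iff[OF monomial_add_preorder, of A C] by simp

lemma monomial_bp_simps:
  "carrier (monomial_bp H) = range (mclass H)"
  "mclass H A \<oplus>\<^bsub>monomial_bp H\<^esub> mclass H C = mclass H (A + C)"
  "mclass H A \<otimes>\<^bsub>monomial_bp H\<^esub> mclass H C = mclass H (mset_mult A C)"
  "\<one>\<^bsub>monomial_bp H\<^esub> = mclass H {#1#}"
  "\<zero>\<^bsub>monomial_bp H\<^esub> = mclass H {#}"
  "mclass H A \<preceq>\<^bsub>monomial_bp H\<^esub> mclass H C \<longleftrightarrow> monomial_le H A C"
  "und (monomial_bp H) = range (monomial H)"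
proof -
  interpret q: add_preorder monoid_semiring "monomial_le H" by (rule monomial_add_preorder)
  show "mclass H A \<oplus>\<^bsub>monomial_bp H\<^esub> mclass H C = mclass H (A + C)"
    using q.quot_add[of A C] by (simp add: monomial_bp_def mclass_def)
  show "mclass H A \<preceq>\<^bsub>monomial_bp H\<^esub> mclass H C \<longleftrightarrow> monomial_le H A C"
    using q.quot_leq[of A C] by (simp add: monomial_bp_def mclass_def)
  have "q.cls A \<otimes>\<^bsub>bp_quot monoid_semiring (monomial_le H)\<^esub> q.cls C = q.cls (mset_mult A C)"
    by (rule q.quot_mult) (simp_all add: monomial_le_def alg_le.mult_left alg_le.mult_right)
  then show "mclass H A \<otimes>\<^bsub>monomial_bp H\<^esub> mclass H C = mclass H (mset_mult A C)"
    by (simp add: monomial_bp_def mclass_def)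
  have "mclass H {#} = mclass H {#0#}" unfolding mclass_eq_iff using mle_zero by blast
  then show "und (monomial_bp H) = range (monomial H)"
    by (auto simp: monomial_bp_def monomial_eq_mclass mclass_def[symmetric])
qed (simp_all add: monomial_bp_def mclass_def)

lemma monomial_zero: "monomial H 0 = \<zero>\<^bsub>monomial_bp H\<^esub>"
  using mle_zero by (auto simp: monomial_eq_mclass monomial_bp_simps mclass_eq_iff)

lemma monomial_one: "monomial H 1 = \<one>\<^bsub>monomial_bp H\<^esub>"
  by (simp add: monomial_eq_mclass monomial_bp_simps)

lemma monomial_mult: "monomial H a \<otimes>\<^bsub>monomial_bp H\<^esub> monomial H b = monomial H (a * b)"
  by (simp add: monomial_eq_mclass monomial_bp_simps)

lemma ordered_blueprint_monomial_bp: "ordered_blueprint (monomial_bp H)"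
proof (intro ordered_blueprint.intro ordered_semiring.intro semiring.intro semiring_axioms.intro
    ordered_semiring_axioms.intro ordered_blueprint_axioms.intro)
  show "abelian_monoid (monomial_bp H)"
    by (rule abelian_monoidI) (auto simp: monomial_bp_simps add_ac)
  show "Group.monoid (monomial_bp H)"
    by (rule Group.monoidI) (auto simp: monomial_bp_simps mset_mult_assoc mset_mult_one)
  show "Group.comm_monoid (monomial_bp H)"
  proof (rule Group.comm_monoidI)
    fix x y assume "x \<in> carrier (monomial_bp H)" "y \<in> carrier (monomial_bp H)"
    then show "x \<otimes>\<^bsub>monomial_bp H\<^esub> y = y \<otimes>\<^bsub>monomial_bp H\<^esub> x"
      by (clarsimp simp: monomial_bp_simps) (rule arg_cong[OF mset_mult_comm])
  qed (auto simp: monomial_bp_simps mset_mult_assoc mset_mult_one)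
next
  fix x y z assume "x \<in> carrier (monomial_bp H)" "y \<in> carrier (monomial_bp H)" "z \<in> carrier (monomial_bp H)"
  then obtain A C D where ACD: "x = mclass H A" "y = mclass H C" "z = mclass H D"
    by (auto simp: monomial_bp_simps)
  then show "(x \<oplus>\<^bsub>monomial_bp H\<^esub> y) \<otimes>\<^bsub>monomial_bp H\<^esub> z =
      x \<otimes>\<^bsub>monomial_bp H\<^esub> z \<oplus>\<^bsub>monomial_bp H\<^esub> y \<otimes>\<^bsub>monomial_bp H\<^esub> z"
    "z \<otimes>\<^bsub>monomial_bp H\<^esub> (x \<oplus>\<^bsub>monomial_bp H\<^esub> y) =
      z \<otimes>\<^bsub>monomial_bp H\<^esub> x \<oplus>\<^bsub>monomial_bp H\<^esub> z \<otimes>\<^bsub>monomial_bp H\<^esub> y"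
    by (simp_all add: monomial_bp_simps mset_mult_union_left mset_mult_union_right)
  from ACD show "x \<preceq>\<^bsub>monomial_bp H\<^esub> y \<Longrightarrow> y \<preceq>\<^bsub>monomial_bp H\<^esub> z \<Longrightarrow> x \<preceq>\<^bsub>monomial_bp H\<^esub> z"
    by (simp add: monomial_bp_simps) (rule mle_trans)
  from ACD show "x \<preceq>\<^bsub>monomial_bp H\<^esub> y \<Longrightarrow> x \<oplus>\<^bsub>monomial_bp H\<^esub> z \<preceq>\<^bsub>monomial_bp H\<^esub> y \<oplus>\<^bsub>monomial_bp H\<^esub> z"
    by (simp add: monomial_bp_simps mle_add mle_refl)
  from ACD show "x \<preceq>\<^bsub>monomial_bp H\<^esub> y \<Longrightarrow> x \<otimes>\<^bsub>monomial_bp H\<^esub> z \<preceq>\<^bsub>monomial_bp H\<^esub> y \<otimes>\<^bsub>monomial_bp H\<^esub> z"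
    by (simp add: monomial_bp_simps) (simp add: monomial_le_def alg_le.mult_right)
next
  fix x assume "x \<in> carrier (monomial_bp H)"
  then obtain A where A: "x = mclass H A" by (auto simp: monomial_bp_simps)
  obtain ys where "mset ys = A" using ex_mset by blast
  moreover have "foldr (\<oplus>\<^bsub>monomial_bp H\<^esub>) (map (monomial H) ys) \<zero>\<^bsub>monomial_bp H\<^esub> = mclass H (mset ys)"
    by (induction ys) (simp_all add: monomial_bp_simps monomial_eq_mclass)
  ultimately show "\<exists>xs. set xs \<subseteq> und (monomial_bp H) \<and> x = foldr (\<oplus>\<^bsub>monomial_bp H\<^esub>) xs \<zero>\<^bsub>monomial_bp H\<^esub>"
    using A by (intro exI[of _ "map (monomial H) ys"]) (auto simp: monomial_bp_simps)
next
  fix x y assume "x \<in> und (monomial_bp H)" "y \<in> und (monomial_bp H)"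
  then show "x \<otimes>\<^bsub>monomial_bp H\<^esub> y \<in> und (monomial_bp H)"
    by (auto simp: monomial_bp_simps(7) monomial_mult)
next
  show "\<zero>\<^bsub>monomial_bp H\<^esub> \<in> und (monomial_bp H)" "\<one>\<^bsub>monomial_bp H\<^esub> \<in> und (monomial_bp H)"
    unfolding monomial_bp_simps(7) monomial_zero[symmetric] monomial_one[symmetric] by blast+
next
  fix x y assume "x \<in> carrier (monomial_bp H)" "y \<in> carrier (monomial_bp H)"
    "x \<preceq>\<^bsub>monomial_bp H\<^esub> y" "y \<preceq>\<^bsub>monomial_bp H\<^esub> x"
  then show "x = y" by (clarsimp simp: monomial_bp_simps) (simp add: mclass_eq_iff)
qed (auto simp: monomial_bp_simps monomial_eq_mclass mle_refl)

lemma finsum_monomial: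
  assumes "finite S"
  shows "(\<Oplus>\<^bsub>monomial_bp H\<^esub>k\<in>S. monomial H (f k)) = mclass H (image_mset f (mset_set S))"
proof -
  interpret ordered_blueprint "monomial_bp H" by (rule ordered_blueprint_monomial_bp)
  show ?thesis
    using assms
  proof (induction S)
    case (insert k S)
    have "(\<Oplus>\<^bsub>monomial_bp H\<^esub>k\<in>insert k S. monomial H (f k)) =
        monomial H (f k) \<oplus>\<^bsub>monomial_bp H\<^esub> (\<Oplus>\<^bsub>monomial_bp H\<^esub>k\<in>S. monomial H (f k))"
      using insert by (intro finsum_insert) (auto simp: monomial_bp_simps monomial_eq_mclass)
    then show ?case using insert by (simp add: monomial_bp_simps monomial_eq_mclass)
  qed (simp add: monomial_bp_simps)
qed

lemma monomial_pow: "monomial H a [^]\<^bsub>monomial_bp H\<^esub> (k::nat) = monomial H (a ^ k)"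
proof -
  interpret ordered_blueprint "monomial_bp H" by (rule ordered_blueprint_monomial_bp)
  show ?thesis by (induction k) (simp_all add: monomial_one monomial_mult mult.commute)
qed

text \<open>Reindexes the Pluecker sum from positions \<open>k\<close> in \<open>Y\<close> to elements \<open>i\<close> of \<open>Y\<close>; the position of \<open>i\<close> becomes the
  number of elements of \<open>Y\<close> up to \<open>i\<close>.\<close>

lemma pluecker_rel_monomial:
  assumes v: "\<And>I. I \<in> d_subsets n d \<Longrightarrow> \<Delta> I = monomial H (v I)"
    and X: "X \<subseteq> {1..n}" "card X + 1 = d" and Y: "Y \<in> d_subsets n (d + 1)"
  shows "pluecker_rel (monomial_bp H) (monomial H e) \<Delta> X Y \<longleftrightarrow>
    monomial_le H {#} {# e ^ (card {y \<in> Y. y \<le> i} + card {x \<in> X. x < i}) * v (X \<union> {i}) * v (Y - {i}).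
      i \<in># mset_set (Y - X) #}"
proof -
  let ?i = "\<lambda>k. sorted_list_of_set Y ! (k - 1)" and ?K = "{k \<in> {1..card Y}. sorted_list_of_set Y ! (k - 1) \<notin> X}"
  have fin: "finite Y" "finite X" using X Y by (auto simp: d_subsets_def intro: finite_subset)
  let ?g = "\<lambda>i. e ^ (card {y \<in> Y. y \<le> i} + card {x \<in> X. x < i}) * v (X \<union> {i}) * v (Y - {i})"
  have i_in: "?i k \<in> Y" if "k \<in> {1..card Y}" for k
  proof -
    have "sorted_list_of_set Y ! (k - 1) \<in> set (sorted_list_of_set Y)"
      using that fin by (intro nth_mem) auto
    then show ?thesis using fin by simp
  qed
  have rank: "card {y \<in> Y. y \<le> ?i k} = k" if "k \<in> {1..card Y}" for k
  proof -
    let ?L = "sorted_list_of_set Y"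
    have L: "sorted_wrt (<) ?L" "length ?L = card Y" "set ?L = Y" using fin by auto
    have "{y \<in> Y. y \<le> ?i k} = (!) ?L ` {..<k}"
    proof (intro equalityI subsetI)
      fix y assume "y \<in> {y \<in> Y. y \<le> ?i k}"
      then obtain j where j: "j < card Y" "y = ?L ! j" "y \<le> ?i k" using L by (metis (mono_tags) in_set_conv_nth mem_Collect_eq)
      have "j \<le> k - 1"
      proof (rule ccontr)
        assume "\<not> j \<le> k - 1"
        then have "?L ! (k - 1) < ?L ! j" using L j by (intro sorted_wrt_nth_less[OF L(1)]) auto
        then show False using j by simp
      qed
      then show "y \<in> (!) ?L ` {..<k}" using j that by auto
    next
      fix y assume "y \<in> (!) ?L ` {..<k}"
      then obtain j where j: "j < k" "y = ?L ! j" by auto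
      then have "y \<le> ?i k"
        using that L by (cases "j = k - 1") (auto intro!: less_imp_le sorted_wrt_nth_less[OF L(1)])
      moreover have "y \<in> Y" using j that L(2,3) nth_mem[of j ?L] by auto
      ultimately show "y \<in> {y \<in> Y. y \<le> ?i k}" by simp
    qed
    moreover have "inj_on ((!) ?L) {..<k}"
      using that L(2) by (intro inj_on_nth) auto
    ultimately show ?thesis by (simp add: card_image)
  qed
  have inj: "inj_on ?i {1..card Y}"
    by (rule inj_onI) (metis rank)
  then have "?i ` {1..card Y} = Y"
    using i_in by (intro card_subset_eq[OF fin(1)]) (auto simp: card_image)
  moreover have "?i ` ?K = ?i ` {1..card Y} - X" by blast
  ultimately have bij: "?i ` ?K = Y - X" by simp
  have injK: "inj_on ?i ?K" using inj by (rule inj_on_subset) auto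
  have summand: "monomial H e [^]\<^bsub>monomial_bp H\<^esub> (k + card {x \<in> X. x < ?i k}) \<otimes>\<^bsub>monomial_bp H\<^esub> \<Delta> (X \<union> {?i k})
      \<otimes>\<^bsub>monomial_bp H\<^esub> \<Delta> (Y - {?i k}) = monomial H (?g (?i k))" if "k \<in> ?K" for k
  proof -
    have "?i k \<in> Y" "?i k \<notin> X" using that i_in by auto
    then have "X \<union> {?i k} \<in> d_subsets n d" "Y - {?i k} \<in> d_subsets n d"
      using X Y fin by (auto simp: d_subsets_def)
    then show ?thesis using rank[of k] that by (simp add: v monomial_pow monomial_mult)
  qed
  interpret ordered_blueprint "monomial_bp H" by (rule ordered_blueprint_monomial_bp)
  have "pluecker_rel (monomial_bp H) (monomial H e) \<Delta> X Y \<longleftrightarrow>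
      mclass H {#} \<preceq>\<^bsub>monomial_bp H\<^esub> (\<Oplus>\<^bsub>monomial_bp H\<^esub>k\<in>?K. monomial H (?g (?i k)))"
    unfolding pluecker_rel_def Let_def monomial_bp_simps(5)[symmetric]
    using summand by (intro arg_cong2[of _ _ _ _ "leq (monomial_bp H)"] refl finsum_cong')
      (auto simp: monomial_bp_simps(1) monomial_eq_mclass)
  also have "(\<Oplus>\<^bsub>monomial_bp H\<^esub>k\<in>?K. monomial H (?g (?i k))) = mclass H (image_mset (\<lambda>k. ?g (?i k)) (mset_set ?K))"
    by (rule finsum_monomial) simp
  also have "image_mset (\<lambda>k. ?g (?i k)) (mset_set ?K) = image_mset ?g (image_mset ?i (mset_set ?K))"
    by (simp add: image_mset.compositionality o_def)
  also have "image_mset ?i (mset_set ?K) = mset_set (Y - X)"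
    unfolding image_mset_mset_set[OF injK] bij ..
  finally show ?thesis unfolding monomial_bp_simps(6) .
qed

text \<open>Depends on the chosen representative unless the order of the blueprint respects sums
  (\<open>class_sum_mclass\<close>).\<close>

definition class_sum :: "'r::comm_monoid_add multiset set \<Rightarrow> 'r" where
  "class_sum X = \<Sum>\<^sub># (SOME A. A \<in> X)"

locale monomial_order =
  fixes H :: "('r::comm_semiring_1 multiset \<times> 'r multiset) set" and sle :: "'r \<Rightarrow> 'r \<Rightarrow> bool"
  assumes sle_refl: "sle a a"
    and sle_trans: "\<lbrakk>sle a b; sle b c\<rbrakk> \<Longrightarrow> sle a c"
    and sle_antisym: "\<lbrakk>sle a b; sle b a\<rbrakk> \<Longrightarrow> a = b"
    and sle_add: "sle a b \<Longrightarrow> sle (a + c) (b + c)"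
    and sle_mult: "\<lbrakk>sle a b; sle a' b'\<rbrakk> \<Longrightarrow> sle (a * a') (b * b')"
    and H_sum: "(A, C) \<in> H \<Longrightarrow> sle (\<Sum>\<^sub># A) (\<Sum>\<^sub># C)"
begin

lemma mle_sum: "monomial_le H A C \<Longrightarrow> sle (\<Sum>\<^sub># A) (\<Sum>\<^sub># C)"
  unfolding monomial_le_def
proof (induction rule: alg_le.induct)
  case (gen x y) then show ?case using H_sum sle_refl by fastforce
next
  case (trans x y z) show ?case by (rule sle_trans[OF trans.IH])
qed (simp_all add: sle_refl sle_add sle_mult sum_mset_mset_mult)

lemma class_sum_mclass: "class_sum (mclass H A) = \<Sum>\<^sub># A"
proof -
  have "A \<in> mclass H A" by (simp add: mclass_def pre_class_def mle_refl)
  then have "(SOME C. C \<in> mclass H A) \<in> mclass H A" by (rule someI)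
  then show ?thesis
    unfolding class_sum_def mclass_def pre_class_def using mle_sum sle_antisym by blast
qed

lemma monomial_eq_iff: "monomial H a = monomial H b \<longleftrightarrow> a = b"
proof
  assume "monomial H a = monomial H b"
  then have "class_sum (monomial H a) = class_sum (monomial H b)" by (rule arg_cong)
  then show "a = b" by (simp add: monomial_eq_mclass class_sum_mclass)
qed simp

lemma scalar_retraction_monomial_bp: "scalar_retraction (monomial_bp H) class_sum (monomial H) sle"
proof (intro scalar_retraction.intro scalar_retraction_axioms.intro)
  show "ordered_semiring (monomial_bp H)"
    using ordered_blueprint_monomial_bp by (rule ordered_blueprint.axioms)
  show "sle a c" if "sle a b" "sle b c" for a b c using that by (rule sle_trans)
  show "a = b" if "sle a b" "sle b a" for a b using that by (rule sle_antisym)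
qed (auto simp: monomial_bp_simps monomial_eq_mclass class_sum_mclass sum_mset_mset_mult
    sle_refl sle_add sle_mult mle_sum)

lemma bp_units_monomial: "monomial H a \<in> bp_units (monomial_bp H) \<longleftrightarrow> (\<exists>b. a * b = 1)"
  unfolding bp_units_def Units_def
  by (auto simp: monomial_bp_simps(7) monomial_mult monomial_one[symmetric] monomial_eq_iff mult.commute)

end

section \<open>The monomial blueprints of rings and idempotent semifields\<close>

lemma monomial_order_ring: "monomial_order (ring_rels :: ('r::comm_ring_1 multiset \<times> 'r multiset) set) (=)"
  by standard (auto simp: ring_rels_def)

lemma ring_null_iff: "monomial_le (ring_rels :: ('r::comm_ring_1 multiset \<times> 'r multiset) set) {#} A \<longleftrightarrow> \<Sum>\<^sub># A = 0"
proof
  assume "monomial_le ring_rels {#} A"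
  then show "\<Sum>\<^sub># A = 0" using monomial_order.mle_sum[OF monomial_order_ring, of "{#}" A] by simp
next
  assume "\<Sum>\<^sub># A = 0"
  then have "monomial_le ring_rels {#0#} A" by (intro mle_gen) (auto simp: ring_rels_def)
  then show "monomial_le ring_rels {#} A" by (rule mle_trans[OF mle_zero(1)])
qed

lemma add_idem: "a + a = (a :: 's::idempotent_semifield)"
proof -
  have "a + a = a * (1 + 1)" by (simp only: distrib_left mult_1_right)
  then show ?thesis by (simp only: one_add_one_idem mult_1_right)
qed

lemma monomial_order_semifield:
  "monomial_order (semifield_rels :: ('s::idempotent_semifield multiset \<times> 's multiset) set) (\<lambda>a b. a + b = b)"
proof
  fix a b c a' b' :: 's
  show "a + a = a" by (rule add_idem)
  show "a + c = c" if "a + b = b" "b + c = c" using that by (metis add.assoc)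
  show "a = b" if "a + b = b" "b + a = a" using that by (simp add: add.commute)
  show "(a + c) + (b + c) = b + c" if "a + b = b"
  proof -
    have "(a + c) + (b + c) = (a + b) + (c + c)" by (simp add: add_ac)
    then show ?thesis by (simp add: that add_idem)
  qed
  show "a * a' + b * b' = b * b'" if "a + b = b" "a' + b' = b'"
  proof -
    have "b * a' + b * b' = b * b'" by (metis distrib_left that(2))
    moreover have "a * a' + b * a' = b * a'" by (metis distrib_right that(1))
    ultimately show ?thesis by (metis add.assoc)
  qed
next
  fix A C :: "'s multiset" assume "(A, C) \<in> semifield_rels"
  then obtain b c where "A = {#b#}" "c \<in># C" "\<Sum>\<^sub># C = b + \<Sum>\<^sub># (C - {#c#})"
    unfolding semifield_rels_def by auto
  then show "\<Sum>\<^sub># A + \<Sum>\<^sub># C = \<Sum>\<^sub># C" by (simp add: add.assoc[symmetric] add_idem)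
qed

text \<open>For a totally ordered \<open>S\<close> and a non-zero sum: the maximum is attained at least twice.\<close>

definition tropical_null :: "'s::idempotent_semifield multiset \<Rightarrow> bool" where
  "tropical_null A \<longleftrightarrow> (\<forall>a\<in>#A. \<Sum>\<^sub># A = \<Sum>\<^sub># (A - {#a#}))"

text \<open>The contextual form of "\<open>A\<close> is null if \<open>C\<close> is". Adding an arbitrary \<open>D\<close> turns it into a preorder that is
  stable under sums, which the bare implication is not.\<close>

definition null_preserving :: "'s::idempotent_semifield multiset \<Rightarrow> 's multiset \<Rightarrow> bool" where
  "null_preserving C A \<longleftrightarrow> (\<forall>D. tropical_null (C + D) \<longrightarrow> tropical_null (A + D))"

lemma null_preserving_add: "null_preserving C A \<Longrightarrow> null_preserving C' A' \<Longrightarrow> null_preserving (C + C') (A + A')"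
  unfolding null_preserving_def by (metis add.assoc add.commute)

lemma tropical_null_add_zero: "tropical_null (add_mset 0 D) \<longleftrightarrow> tropical_null D"
proof -
  have "\<Sum>\<^sub># (add_mset 0 D - {#d#}) = \<Sum>\<^sub># (D - {#d#})" if "d \<in># D" for d
  proof (cases "d = 0")
    case True
    have "\<Sum>\<^sub># D = d + \<Sum>\<^sub># (D - {#d#})" using that by (metis insert_DiffM sum_mset.add_mset)
    then show ?thesis using True by simp
  next
    case False
    then have "add_mset 0 D - {#d#} = add_mset 0 (D - {#d#})" by (metis diff_union_swap)
    then show ?thesis by simp
  qed
  note remove = this
  have sum: "\<Sum>\<^sub># (add_mset 0 D) = \<Sum>\<^sub># D" by simp
  show ?thesis
    unfolding tropical_null_def sum
  proof (intro iffI ballI)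
    fix a assume "\<forall>a\<in>#add_mset 0 D. \<Sum>\<^sub># D = \<Sum>\<^sub># (add_mset 0 D - {#a#})" "a \<in># D"
    then show "\<Sum>\<^sub># D = \<Sum>\<^sub># (D - {#a#})" using remove[of a] by (metis insert_iff set_mset_add_mset_insert)
  next
    fix a assume *: "\<forall>a\<in>#D. \<Sum>\<^sub># D = \<Sum>\<^sub># (D - {#a#})" and "a \<in># add_mset 0 D"
    then consider "a \<in># D" | "a = 0" by auto
    then show "\<Sum>\<^sub># D = \<Sum>\<^sub># (add_mset 0 D - {#a#})"
      by cases (use * remove[of a] in metis, simp)
  qed
qed

lemma tropical_null_scale:
  assumes "z \<noteq> 0" shows "tropical_null (image_mset ((*) z) A) \<longleftrightarrow> tropical_null A"
proof -
  obtain z' where z': "z * z' = 1" using ex_mult_inverse[OF assms] by blast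
  have sum: "\<Sum>\<^sub># (image_mset ((*) z) B) = z * \<Sum>\<^sub># B" for B :: "'a multiset"
    by (induction B) (simp_all add: distrib_left)
  have cancel: "z * a = z * b \<longleftrightarrow> a = b" for a b
  proof
    assume "z * a = z * b"
    then have "z' * (z * a) = z' * (z * b)" by simp
    moreover have "z' * (z * c) = c" for c
      using z' by (metis mult.assoc mult.commute mult_1)
    ultimately show "a = b" by simp
  qed simp
  have "image_mset ((*) z) A - {#z * a#} = image_mset ((*) z) (A - {#a#})" if "a \<in># A" for a
    using that by (simp add: image_mset_Diff)
  then show ?thesis unfolding tropical_null_def by (auto simp: sum cancel)
qed

text \<open>A factor \<open>z \<noteq> 0\<close> can be moved to the test multiset by inverting it, and zeros never affect nullity.\<close>

lemma null_preserving_scale: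
  assumes "null_preserving C A" shows "null_preserving (image_mset ((*) z) C) (image_mset ((*) z) A)"
proof (cases "z = 0")
  case True
  have zero: "tropical_null (image_mset ((*) z) B + D) \<longleftrightarrow> tropical_null D" for B D
    by (induction B) (simp_all add: True tropical_null_add_zero)
  show ?thesis unfolding null_preserving_def zero by simp
next
  case False
  then obtain z' where z': "z * z' = 1" using ex_mult_inverse by blast
  have D: "image_mset ((*) z) (image_mset ((*) z') D) = D" for D
    by (induction D) (simp_all add: z' mult.assoc[symmetric])
  have "tropical_null (image_mset ((*) z) B + D) \<longleftrightarrow> tropical_null (B + image_mset ((*) z') D)" for B D
    using tropical_null_scale[OF False, of "B + image_mset ((*) z') D"] by (simp add: D)
  then show ?thesis using assms unfolding null_preserving_def by blast
qed

text \<open>If \<open>b\<close> is redundant in \<open>b + D\<close>, then so is \<open>a\<close> in \<open>A + D\<close>: write \<open>\<Sum>A = b + \<Sum>(A - a)\<close> and let \<open>D\<close> absorb \<open>b\<close>.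
  An element of \<open>D\<close> that is redundant next to \<open>b\<close> is redundant next to \<open>A\<close>, since \<open>\<Sum>A\<close> absorbs \<open>b\<close>.\<close>

lemma null_preserving_rel:
  assumes "(C, A) \<in> semifield_rels" shows "null_preserving C A"
proof -
  from assms obtain b where C: "C = {#b#}" and "A \<noteq> {#}" and A: "\<And>a. a \<in># A \<Longrightarrow> \<Sum>\<^sub># A = b + \<Sum>\<^sub># (A - {#a#})"
    unfolding semifield_rels_def by auto
  then have bA: "b + \<Sum>\<^sub># A = \<Sum>\<^sub># A"
    using monomial_order.H_sum[OF monomial_order_semifield assms] by simp
  have "tropical_null (A + D)" if "tropical_null (C + D)" for D
    unfolding tropical_null_def
  proof
    have bD: "b + \<Sum>\<^sub># D = \<Sum>\<^sub># D" using that unfolding tropical_null_def C by simp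
    fix x assume "x \<in># A + D"
    then consider "x \<in># A" | "x \<in># D" by auto
    then show "\<Sum>\<^sub># (A + D) = \<Sum>\<^sub># (A + D - {#x#})"
    proof cases
      case 1
      have "\<Sum>\<^sub># A + \<Sum>\<^sub># D = \<Sum>\<^sub># (A - {#x#}) + (b + \<Sum>\<^sub># D)" by (subst A[OF 1]) (simp add: add_ac)
      also have "\<dots> = \<Sum>\<^sub># (A - {#x#} + D)" by (simp add: bD)
      also have "A - {#x#} + D = A + D - {#x#}" using 1 by simp
      finally show ?thesis by simp
    next
      case 2
      have "x \<in># C + D" using 2 by simp
      then have "\<Sum>\<^sub># (C + D) = \<Sum>\<^sub># (C + D - {#x#})" using that unfolding tropical_null_def by blast
      also have "C + D - {#x#} = C + (D - {#x#})" by (rule diff_union_single_conv[OF 2])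
      finally have D: "b + \<Sum>\<^sub># D = b + \<Sum>\<^sub># (D - {#x#})" by (simp add: C)
      have "\<Sum>\<^sub># A + \<Sum>\<^sub># D = \<Sum>\<^sub># A + (b + \<Sum>\<^sub># D)" by (simp add: bD)
      also have "\<dots> = (b + \<Sum>\<^sub># A) + \<Sum>\<^sub># (D - {#x#})" unfolding D by (simp add: add_ac)
      also have "\<dots> = \<Sum>\<^sub># (A + (D - {#x#}))" unfolding bA by simp
      also have "A + (D - {#x#}) = A + D - {#x#}" by (rule diff_union_single_conv[OF 2, symmetric])
      finally show ?thesis by simp
    qed
  qed
  then show ?thesis by (simp add: null_preserving_def)
qed

lemma mle_null_preserving: "monomial_le semifield_rels C A \<Longrightarrow> null_preserving C A"
  unfolding monomial_le_def
proof (induction rule: alg_le.induct)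
  case (order x y) then show ?case by (simp add: null_preserving_def)
next
  case (gen x y)
  then show ?case using null_preserving_rel[of x y]
    by (auto simp: null_preserving_def tropical_null_add_zero)
next
  case (trans x y z) then show ?case by (simp add: null_preserving_def)
next
  case (add x y z)
  then show ?case by (simp add: null_preserving_add null_preserving_def[of z z])
next
  case (mult_left x y z)
  have "null_preserving (mset_mult z x) (mset_mult z y)"
    by (induction z) (auto intro: null_preserving_add null_preserving_scale mult_left.IH simp: null_preserving_def[of "{#}" "{#}"])
  then show ?case .
next
  case (mult_right x y z)
  have "null_preserving (mset_mult z x) (mset_mult z y)"
    by (induction z) (auto intro: null_preserving_add null_preserving_scale mult_right.IH simp: null_preserving_def[of "{#}" "{#}"])
  then show ?case by (simp add: mset_mult_comm)
qed

text \<open>The forward direction tests with \<open>D = 0\<close>. Backwards, for a non-empty multiset the condition is the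
  defining relation with \<open>b = 0\<close>.\<close>

lemma semifield_null_iff: "monomial_le semifield_rels {#} A \<longleftrightarrow> tropical_null A"
proof
  assume "monomial_le semifield_rels {#} A"
  from mle_null_preserving[OF this] show "tropical_null A"
    unfolding null_preserving_def by (metis add_0 add.right_neutral empty_iff set_mset_empty tropical_null_def)
next
  assume A: "tropical_null A"
  show "monomial_le semifield_rels {#} A"
  proof (cases "A = {#}")
    case False
    then have "monomial_le semifield_rels {#0#} A"
      using A by (intro mle_gen) (auto simp: semifield_rels_def tropical_null_def)
    then show ?thesis by (rule mle_trans[OF mle_zero(1)])
  qed (simp add: mle_refl)
qed

lemma tropical_null_image:
  assumes "finite S"
  shows "tropical_null {# f i. i \<in># mset_set S #} \<longleftrightarrow> (\<forall>p\<in>S. (\<Sum>i\<in>S. f i) = (\<Sum>i\<in>S - {p}. f i))"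
proof -
  have "{# f i. i \<in># mset_set S #} - {#f p#} = {# f i. i \<in># mset_set (S - {p}) #}" if "p \<in> S" for p
    using that assms by (simp add: mset_set_Diff image_mset_Diff)
  then show ?thesis
    unfolding tropical_null_def using assms by (auto simp: sum_unfold_sum_mset)
qed

text \<open>The relation \<open>1.(\<Sum>A) \<le> A\<close> of the blueprint becomes an equivalence in the hull.\<close>

lemma scalar_quotient_hull:
  "scalar_quotient (ring_mon :: 'k::field multiset set blueprint) class_sum (monomial ring_rels) (=)
    (ext_power ring_mon ring_eps n d) (d_subsets n d) (ext_vec ring_mon ring_eps n d)
    {(x, y). x \<preceq>\<^bsub>ext_power ring_mon ring_eps n d\<^esub> y \<or> y \<preceq>\<^bsub>ext_power ring_mon ring_eps n d\<^esub> x}"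
proof -
  let ?B = "ring_mon :: 'k multiset set blueprint" and ?H = "ring_rels :: ('k multiset \<times> 'k multiset) set"
  let ?E = "ext_power ?B ring_eps n d"
  interpret R: scalar_retraction ?B class_sum "monomial ?H" "(=)"
    unfolding ring_mon_def by (rule monomial_order.scalar_retraction_monomial_bp[OF monomial_order_ring])
  interpret E: coordinatized ?B ?E "d_subsets n d" "ext_vec ?B ring_eps n d"
    unfolding ring_mon_def ring_eps_def
    by (rule coordinatized_ext_power[OF ordered_blueprint_monomial_bp])
      (auto simp: monomial_bp_simps(7) monomial_mult monomial_one)
  show ?thesis
  proof
    fix v w I assume "v \<in> d_subsets n d \<rightarrow> carrier ?B" "w \<in> d_subsets n d \<rightarrow> carrier ?B"
      "(ext_vec ?B ring_eps n d v, ext_vec ?B ring_eps n d w) \<in> {(x, y). x \<preceq>\<^bsub>?E\<^esub> y \<or> y \<preceq>\<^bsub>?E\<^esub> x}"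
      "I \<in> d_subsets n d"
    then show "class_sum (v I) = class_sum (w I)"
      using R.\<theta>_mono[of "v I" "w I"] R.\<theta>_mono[of "w I" "v I"] by (auto simp: E.vec_leq Pi_iff)
  next
    fix v assume v: "v \<in> d_subsets n d \<rightarrow> carrier ?B"
    have le: "monomial ?H (class_sum x) \<preceq>\<^bsub>?B\<^esub> x" if "x \<in> carrier ?B" for x
    proof -
      from that obtain A where A: "x = mclass ?H A" by (auto simp: ring_mon_def monomial_bp_simps)
      have "monomial_le ?H {#\<Sum>\<^sub># A#} A" by (rule mle_gen) (auto simp: ring_rels_def)
      then show ?thesis
        by (simp add: A ring_mon_def monomial_eq_mclass monomial_bp_simps
            monomial_order.class_sum_mclass[OF monomial_order_ring])
    qed
    let ?w = "\<lambda>I. monomial ?H (class_sum (v I))"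
    have w: "?w \<in> d_subsets n d \<rightarrow> carrier ?B" by simp
    have "ext_vec ?B ring_eps n d ?w \<preceq>\<^bsub>?E\<^esub> ext_vec ?B ring_eps n d v"
      unfolding E.vec_leq[OF w v] using le v by (auto simp: Pi_iff)
    moreover have "ext_vec ?B ring_eps n d v \<in> carrier ?E" "ext_vec ?B ring_eps n d ?w \<in> carrier ?E"
      using v w unfolding E.carrier_N by blast+
    ultimately show "mod_le ?B ?E {(x, y). x \<preceq>\<^bsub>?E\<^esub> y \<or> y \<preceq>\<^bsub>?E\<^esub> x} (ext_vec ?B ring_eps n d v) (ext_vec ?B ring_eps n d ?w) \<and>
      mod_le ?B ?E {(x, y). x \<preceq>\<^bsub>?E\<^esub> y \<or> y \<preceq>\<^bsub>?E\<^esub> x} (ext_vec ?B ring_eps n d ?w) (ext_vec ?B ring_eps n d v)"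
      by (auto intro: mod_le.gen)
  qed
qed

text \<open>A single \<open>x\<close> with \<open>x + s = s\<close> lies below \<open>s + s\<close>, because either copy of \<open>s\<close> may be replaced by \<open>x\<close>. Each
  element of \<open>A\<close> therefore uses up two copies of \<open>s\<close>, and further copies do no harm.\<close>

lemma mle_replicate:
  fixes s :: "'s::idempotent_semifield"
  assumes "A \<noteq> {#}" "\<And>x. x \<in># A \<Longrightarrow> x + s = s" "2 * size A \<le> k"
  shows "monomial_le semifield_rels A (replicate_mset k s)"
  using assms
proof (induction A arbitrary: k)
  case (add x A)
  have rep: "\<Sum>\<^sub># (replicate_mset (Suc j) s) = s" for j
    by (induction j) (simp_all add: add_idem)
  have single: "monomial_le semifield_rels {#x#} (replicate_mset (Suc (Suc j)) s)" for j
  proof (rule mle_gen)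
    let ?R = "replicate_mset (Suc (Suc j)) s"
    have R: "?R - {#s#} = replicate_mset (Suc j) s" by simp
    have "\<Sum>\<^sub># ?R = x + \<Sum>\<^sub># (?R - {#a#})" if "a \<in># ?R" for a
    proof -
      have "a = s" using that by (simp only: in_replicate_mset)
      then show ?thesis using add.prems(2)[of x] unfolding R \<open>a = s\<close> rep by simp
    qed
    moreover have "?R \<noteq> {#}" by simp
    ultimately show "({#x#}, ?R) \<in> semifield_rels" unfolding semifield_rels_def by blast
  qed
  show ?case
  proof (cases "A = {#}")
    case True
    obtain j where "k = Suc (Suc j)" using add.prems(3) True by (cases k; cases "k - 1") auto
    then show ?thesis using single True by simp
  next
    case False
    have "monomial_le semifield_rels A (replicate_mset (k - 2) s)"
      by (rule add.IH[OF False]) (use add.prems in auto)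
    from mle_add[OF this single[of 0]]
    have "monomial_le semifield_rels (A + {#x#}) (replicate_mset (k - 2) s + replicate_mset 2 s)"
      by (simp add: numeral_2_eq_2)
    moreover have "replicate_mset (k - 2) s + replicate_mset 2 s = replicate_mset k s"
      using add.prems(3) by (simp add: multiset_eq_iff)
    ultimately show ?thesis by simp
  qed
qed simp

text \<open>One direction is \<open>1.(\<Sum>A) \<le> A\<close> again. For the other, \<open>A\<close> lies below a large multiple of \<open>1.(\<Sum>A)\<close>, and the
  idempotent quotient identifies a vector with its double. The multiples are powers of two, so that
  doubling reaches them, and one exponent serves all coordinates because there are finitely many.\<close>

lemma scalar_quotient_idem:
  "scalar_quotient (semifield_mon :: 's::idempotent_semifield multiset set blueprint) class_sum (monomial semifield_rels)
    (\<lambda>a b. a + b = b)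
    (ext_power semifield_mon semifield_eps n d) (d_subsets n d) (ext_vec semifield_mon semifield_eps n d)
    {(x, y). y = x \<oplus>\<^bsub>ext_power semifield_mon semifield_eps n d\<^esub> x \<or> x = y \<oplus>\<^bsub>ext_power semifield_mon semifield_eps n d\<^esub> y}"
proof -
  let ?B = "semifield_mon :: 's multiset set blueprint" and ?H = "semifield_rels :: ('s multiset \<times> 's multiset) set"
  let ?E = "ext_power ?B semifield_eps n d" and ?J = "d_subsets n d" and ?vec = "ext_vec ?B semifield_eps n d"
  let ?R = "{(x, y). y = x \<oplus>\<^bsub>?E\<^esub> x \<or> x = y \<oplus>\<^bsub>?E\<^esub> y}"
  interpret R: scalar_retraction ?B class_sum "monomial ?H" "\<lambda>a b. a + b = b"
    unfolding semifield_mon_def by (rule monomial_order.scalar_retraction_monomial_bp[OF monomial_order_semifield])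
  interpret E: coordinatized ?B ?E ?J ?vec
    unfolding semifield_mon_def semifield_eps_def
    by (rule coordinatized_ext_power[OF ordered_blueprint_monomial_bp])
      (simp add: monomial_bp_simps(7), simp only: monomial_mult mult_1_left, rule monomial_one)
  interpret EM: abelian_monoid ?E by (rule E.N_abelian_monoid)
  show ?thesis
  proof
    fix v w I assume vw: "v \<in> ?J \<rightarrow> carrier ?B" "w \<in> ?J \<rightarrow> carrier ?B" and "(?vec v, ?vec w) \<in> ?R" and I: "I \<in> ?J"
    then consider "?vec w = ?vec v \<oplus>\<^bsub>?E\<^esub> ?vec v" | "?vec v = ?vec w \<oplus>\<^bsub>?E\<^esub> ?vec w" by auto
    then have "w I = v I \<oplus>\<^bsub>?B\<^esub> v I \<or> v I = w I \<oplus>\<^bsub>?B\<^esub> w I"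
    proof cases
      case 1
      have "(\<lambda>I. v I \<oplus>\<^bsub>?B\<^esub> v I) \<in> ?J \<rightarrow> carrier ?B" using vw by auto
      then show ?thesis using 1 I vw by (simp add: E.vec_add E.vec_eq_iff)
    next
      case 2
      have "(\<lambda>I. w I \<oplus>\<^bsub>?B\<^esub> w I) \<in> ?J \<rightarrow> carrier ?B" using vw by auto
      then show ?thesis using 2 I vw by (simp add: E.vec_add E.vec_eq_iff)
    qed
    moreover have "v I \<in> carrier ?B" "w I \<in> carrier ?B" using vw I by auto
    ultimately show "class_sum (v I) + class_sum (w I) = class_sum (w I)"
      by (auto simp: R.\<theta>_add add_idem)
  next
    fix v assume v: "v \<in> ?J \<rightarrow> carrier ?B"
    let ?\<sigma> = "\<lambda>x. monomial ?H (class_sum x)"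
    let ?w = "\<lambda>I. ?\<sigma> (v I)"
    let ?N = "\<lambda>m I. mclass ?H (replicate_mset (2 ^ m) (class_sum (v I)))"
    have w: "?w \<in> ?J \<rightarrow> carrier ?B" by simp
    have N: "?N m \<in> ?J \<rightarrow> carrier ?B" for m by (simp add: semifield_mon_def monomial_bp_simps)
    \<comment> \<open>The empty sum stands for zero and has no defining relation of its own, hence the separate case.\<close>
    have le: "?\<sigma> x \<preceq>\<^bsub>?B\<^esub> x" if "x \<in> carrier ?B" for x
    proof -
      from that obtain A where A: "x = mclass ?H A" by (auto simp: semifield_mon_def monomial_bp_simps)
      have "monomial_le ?H {#\<Sum>\<^sub># A#} A"
      proof (cases "A = {#}")
        case True then show ?thesis using mle_zero by simp
      next
        case False
        have "\<Sum>\<^sub># A = \<Sum>\<^sub># A + \<Sum>\<^sub># (A - {#a#})" if "a \<in># A" for a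
        proof -
          have "\<Sum>\<^sub># A = a + \<Sum>\<^sub># (A - {#a#})" using that by (metis insert_DiffM sum_mset.add_mset)
          then show ?thesis by (simp add: add.assoc add_idem)
        qed
        then show ?thesis using False by (intro mle_gen) (auto simp: semifield_rels_def)
      qed
      then show ?thesis
        by (simp add: A semifield_mon_def monomial_eq_mclass monomial_bp_simps
            monomial_order.class_sum_mclass[OF monomial_order_semifield])
    qed
    have ge: "\<exists>m0. \<forall>m\<ge>m0. x \<preceq>\<^bsub>?B\<^esub> mclass ?H (replicate_mset (2 ^ m) (class_sum x))" if "x \<in> carrier ?B" for x
    proof -
      from that obtain A where A: "x = mclass ?H A" by (auto simp: semifield_mon_def monomial_bp_simps)
      have sum: "class_sum x = \<Sum>\<^sub># A" unfolding A by (rule monomial_order.class_sum_mclass[OF monomial_order_semifield])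
      \<comment> \<open>\<open>2 * size A \<le> m < 2 ^ m\<close> leaves two copies for each element.\<close>
      have "monomial_le ?H A (replicate_mset (2 ^ m) (\<Sum>\<^sub># A))" if "2 * size A \<le> m" for m
      proof (cases "A = {#}")
        case True
        have "monomial_le ?H {#} (replicate_mset k 0)" for k
        proof (induction k)
          case (Suc k)
          from mle_add[OF mle_zero(1) this] show ?case by simp
        qed (simp add: mle_refl)
        then show ?thesis using True by simp
      next
        case False
        have absorb: "y + \<Sum>\<^sub># A = \<Sum>\<^sub># A" if "y \<in># A" for y
        proof -
          have "\<Sum>\<^sub># A = y + \<Sum>\<^sub># (A - {#y#})" using that by (metis insert_DiffM sum_mset.add_mset)
          then show ?thesis by (simp add: add.assoc[symmetric] add_idem)
        qed
        have "2 * size A \<le> 2 ^ m" using that less_exp[of m] by linarith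
        from mle_replicate[OF False absorb this] show ?thesis .
      qed
      then show ?thesis unfolding sum by (intro exI[of _ "2 * size A"]) (simp add: A semifield_mon_def monomial_bp_simps)
    qed
    have "\<forall>I\<in>?J. \<exists>m0. \<forall>m\<ge>m0. v I \<preceq>\<^bsub>?B\<^esub> ?N m I" using ge v by blast
    then obtain m0 where m0: "\<And>I m. I \<in> ?J \<Longrightarrow> m0 I \<le> m \<Longrightarrow> v I \<preceq>\<^bsub>?B\<^esub> ?N m I" by metis
    \<comment> \<open>The sum of the exponents is an upper bound for each of them.\<close>
    define m where "m = (\<Sum>I\<in>?J. m0 I)"
    have "m0 I \<le> m" if "I \<in> ?J" for I
      unfolding m_def using that E.finite_J by (intro member_le_sum) auto
    then have "?vec v \<preceq>\<^bsub>?E\<^esub> ?vec (?N m)"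
      unfolding E.vec_leq[OF v N] using m0 by blast
    have carr: "?vec v \<in> carrier ?E" "?vec ?w \<in> carrier ?E" "?vec (?N m) \<in> carrier ?E" for m
      using v w N unfolding E.carrier_N by blast+
    have double: "?vec (?N (Suc m)) = ?vec (?N m) \<oplus>\<^bsub>?E\<^esub> ?vec (?N m)" for m
    proof -
      have "?N (Suc m) = (\<lambda>I. ?N m I \<oplus>\<^bsub>?B\<^esub> ?N m I)"
        unfolding semifield_mon_def monomial_bp_simps
        by (intro ext arg_cong[of _ _ "mclass ?H"]) (simp add: multiset_eq_iff)
      then show ?thesis by (simp only: E.vec_add[OF N N])
    qed
    have "mod_le ?B ?E ?R (?vec (?N m)) (?vec ?w)" for m
    proof (induction m)
      case 0
      have "?N 0 = ?w" by (simp add: monomial_eq_mclass fun_eq_iff)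
      moreover have "?vec ?w \<preceq>\<^bsub>?E\<^esub> ?vec ?w" unfolding E.vec_leq[OF w w] by (simp add: R.leq_refl)
      then have "mod_le ?B ?E ?R (?vec ?w) (?vec ?w)" by (rule mod_le.order[OF carr(2) carr(2)])
      ultimately show ?case by simp
    next
      case (Suc m)
      have "mod_le ?B ?E ?R (?vec (?N (Suc m))) (?vec (?N m))"
        unfolding double by (rule mod_le.gen) (use carr in auto)
      then show ?case using Suc by (rule mod_le.trans)
    qed
    moreover have "mod_le ?B ?E ?R (?vec v) (?vec (?N m))"
      using carr \<open>?vec v \<preceq>\<^bsub>?E\<^esub> ?vec (?N m)\<close> by (intro mod_le.order)
    moreover have "mod_le ?B ?E ?R (?vec ?w) (?vec v)"
    proof (rule mod_le.order[OF carr(2,1)])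
      show "?vec ?w \<preceq>\<^bsub>?E\<^esub> ?vec v" unfolding E.vec_leq[OF w v] using le v by (auto simp: Pi_iff)
    qed
    ultimately show "mod_le ?B ?E ?R (?vec v) (?vec ?w) \<and> mod_le ?B ?E ?R (?vec ?w) (?vec v)"
      by (blast intro: mod_le.trans)
  qed
qed

section \<open>Alternating functions on words\<close>

lemma inversions_insert:
  "inversions (u @ a # v) =
    inversions (u @ v) + length (filter (\<lambda>x. a < x) u) + length (filter (\<lambda>y. y < a) v)"
  by (induction u) auto

lemma length_filter_less_greater:
  "x \<notin> set v \<Longrightarrow> length (filter (\<lambda>y. y < x) v) + length (filter (\<lambda>y. x < y) v) = length v"
  for x :: nat
  by (induction v) auto

text \<open>Letters between the two exchanged positions are compared with both \<open>x\<close> and \<open>y\<close> and contribute an even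
  number in total, letters outside contribute the same on both sides, and the pair itself one.\<close>

lemma inversions_exchange:
  assumes "distinct (u @ x # v @ y # w)"
  shows "odd (inversions (u @ x # v @ y # w) + inversions (u @ y # v @ x # w))"
proof -
  let ?lt = "\<lambda>z l. length (filter (\<lambda>y. y < z) l)" and ?gt = "\<lambda>z l. length (filter (\<lambda>y. z < y) l)"
  let ?k = "inversions (u @ v @ w) + ?gt x u + ?gt y u + ?lt x w + ?lt y w"
  have "inversions (u @ x # v @ y # w) = ?k + ?lt x v + ?gt y v + (if y < x then 1 else 0)"
    using inversions_insert[of u x "v @ y # w"] inversions_insert[of "u @ v" y w] by simp
  moreover have "inversions (u @ y # v @ x # w) = ?k + ?lt y v + ?gt x v + (if x < y then 1 else 0)"
    using inversions_insert[of u y "v @ x # w"] inversions_insert[of "u @ v" x w] by simp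
  moreover have "?lt x v + ?gt x v = length v" "?lt y v + ?gt y v = length v"
    using assms by (intro length_filter_less_greater; simp)+
  moreover have "x < y \<or> y < x" using assms by auto
  ultimately have "inversions (u @ x # v @ y # w) + inversions (u @ y # v @ x # w) = 2 * (?k + length v) + 1"
    by auto
  then show ?thesis by (simp only: odd_two_times_div_two_succ even_plus_one_iff even_mult_iff) simp
qed

text \<open>The alternating function on words with prescribed values on increasing words.\<close>

definition alt_ext :: "(nat set \<Rightarrow> 'k::comm_ring_1) \<Rightarrow> nat list \<Rightarrow> 'k" where
  "alt_ext f w = (if distinct w then (-1) ^ inversions w * f (set w) else 0)"

lemma permute_list_transpose:
  "permute_list (Transposition.transpose (length u) (length u + 1 + length v)) (u @ x # v @ y # w) = u @ y # v @ x # w"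
proof (rule nth_equalityI)
  fix i assume "i < length (permute_list (Transposition.transpose (length u) (length u + 1 + length v)) (u @ x # v @ y # w))"
  then have i: "i < length (u @ x # v @ y # w)" by simp
  then have "permute_list (Transposition.transpose (length u) (length u + 1 + length v)) (u @ x # v @ y # w) ! i =
     (u @ x # v @ y # w) ! Transposition.transpose (length u) (length u + 1 + length v) i"
    unfolding permute_list_def by (subst nth_map) (simp_all del: upt_Suc)
  also have "\<dots> = (u @ y # v @ x # w) ! i"
    by (auto simp: Transposition.transpose_def nth_append nth_Cons split: nat.splits)
  finally show "permute_list (Transposition.transpose (length u) (length u + 1 + length v)) (u @ x # v @ y # w) ! i = (u @ y # v @ x # w) ! i" .
qed simp

lemma alt_ext_transpose:
  assumes "i < j" "j < length w"
  shows "alt_ext f (permute_list (Transposition.transpose i j) w) = - alt_ext f w"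
proof -
  define u x v y t where "u = take i w" "x = w ! i" "v = take (j - Suc i) (drop (Suc i) w)" "y = w ! j" "t = drop (Suc j) w"
  have "drop (Suc i) w = v @ y # t"
    using id_take_nth_drop[of "j - Suc i" "drop (Suc i) w"] assms by (simp add: u_x_v_y_t_def)
  then have w: "w = u @ x # v @ y # t"
    using id_take_nth_drop[of i w] assms by (simp add: u_x_v_y_t_def)
  have ij: "i = length u" "j = length u + 1 + length v" using assms by (auto simp: u_x_v_y_t_def)
  have p: "permute_list (Transposition.transpose i j) w = u @ y # v @ x # t"
    unfolding ij w by (rule permute_list_transpose)
  have eq: "distinct (u @ y # v @ x # t) = distinct w" "set (u @ y # v @ x # t) = set w"
    unfolding w by auto
  show ?thesis
  proof (cases "distinct w")
    case True
    from inversions_exchange[OF True[unfolded w]]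
    have "(-1 :: 'a) ^ inversions (u @ y # v @ x # t) = - ((-1) ^ inversions w)"
      unfolding w[symmetric] by (auto simp: minus_one_power_iff)
    then show ?thesis unfolding alt_ext_def p eq using True by simp
  next
    case False
    then show ?thesis unfolding alt_ext_def p eq by simp
  qed
qed

lemma alt_ext_permute:
  assumes "\<pi> permutes {..<d}" "length w = d"
  shows "alt_ext f (permute_list \<pi> w) = of_int (sign \<pi>) * alt_ext f w"
  using assms(1) finite_lessThan assms(2)
proof (induction arbitrary: w rule: permutes_induct)
  case (swap a b p)
  have "permutation p" using swap.hyps(4) by (auto simp: permutation_permutes)
  then have s: "sign (Transposition.transpose a b \<circ> p) = - sign p"
    using swap.hyps(3) by (simp add: sign_compose permutation_swap_id sign_swap_id)
  have "permute_list (Transposition.transpose a b \<circ> p) w = permute_list p (permute_list (Transposition.transpose a b) w)"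
    by (rule permute_list_compose) (use swap in simp)
  then have "alt_ext f (permute_list (Transposition.transpose a b \<circ> p) w) =
      of_int (sign p) * alt_ext f (permute_list (Transposition.transpose a b) w)"
    using swap by simp
  also have "alt_ext f (permute_list (Transposition.transpose a b) w) = - alt_ext f w"
    using alt_ext_transpose[of a b w f] alt_ext_transpose[of b a w f] swap
    by (cases "a < b") (auto simp: transpose_commute)
  finally show ?case unfolding s by simp
qed simp

lemma alternating_alt_ext:
  "alternating n d (\<lambda>w\<in>words n d. alt_ext f w :: 'k::field)"
  unfolding alternating_def
proof (intro conjI ballI allI impI)
  fix w \<pi> assume w: "w \<in> words n d" and \<pi>: "\<pi> permutes {..<d}"
  then have "permute_list \<pi> w \<in> words n d" by (simp add: words_def)
  then show "(\<lambda>w\<in>words n d. alt_ext f w) (permute_list \<pi> w) = of_int (sign \<pi>) * (\<lambda>w\<in>words n d. alt_ext f w) w"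
    using w alt_ext_permute[OF \<pi>, of w f] by (simp add: words_def)
qed (simp add: alt_ext_def)

text \<open>The permutation that sorts a word without repetitions has the parity of its number of inversions.\<close>

lemma alternating_eq_alt_ext:
  assumes "alternating n d p" "w \<in> words n d"
  shows "p w = alt_ext (\<lambda>I. p (sorted_list_of_set I)) w"
proof (cases "distinct w")
  case True
  have len: "length w = d" and sub: "set w \<subseteq> {1..n}" using assms(2) by (auto simp: words_def)
  let ?s = "sorted_list_of_set (set w)"
  have "mset ?s = mset w" using True by (simp add: set_eq_iff_mset_eq_distinct[symmetric])
  then obtain \<pi> where \<pi>: "\<pi> permutes {..<length w}" "permute_list \<pi> w = ?s"
    by (rule mset_eq_permutation)
  have 1: "p ?s = of_int (sign \<pi>) * p w"
    using assms \<pi> len unfolding alternating_def by metis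
  have "alt_ext (\<lambda>_. 1 :: 'a) ?s = of_int (sign \<pi>) * alt_ext (\<lambda>_. 1) w"
    using alt_ext_permute[OF \<pi>(1) refl, of "\<lambda>_. 1 :: 'a"] \<pi>(2) by simp
  then have 2: "of_int (sign \<pi>) * (-1) ^ inversions w = (1 :: 'a)"
    using True by (simp add: alt_ext_def inversions_sorted)
  have "(-1) ^ inversions w * p ?s = (of_int (sign \<pi>) * (-1) ^ inversions w) * p w"
    unfolding 1 by (simp add: mult_ac)
  then show ?thesis using True 2 by (simp add: alt_ext_def)
next
  case False
  then show ?thesis using assms unfolding alternating_def alt_ext_def by auto
qed

text \<open>Sign rule for deleting the letter \<open>a\<close> at position \<open>length u + 1\<close>. For a word without repetitions the
  second exponent is the rank of \<open>a\<close> among the letters. For a repeated letter the asymmetry between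
  \<open>\<le>\<close> on the left and \<open><\<close> on the right separates its occurrences.\<close>

lemma alt_ext_delete:
  "(-1) ^ Suc (length u) * alt_ext f (u @ v) =
    (-1) ^ inversions (u @ a # v) * (-1) ^ Suc (length (filter (\<lambda>x. x \<le> a) u) + length (filter (\<lambda>y. y < a) v)) *
    (if distinct (u @ v) then f (set (u @ v)) else 0)"
proof -
  have "length u = length (filter (\<lambda>x. x \<le> a) u) + length (filter (\<lambda>x. a < x) u)"
    by (induction u) auto
  moreover have "even (inversions (u @ a # v) + Suc (p + q) + (Suc l + inversions (u @ v)))"
    if "l = p + r" "inversions (u @ a # v) = inversions (u @ v) + r + q" for l p q r
    unfolding that by presburger
  ultimately have "even (inversions (u @ a # v) + Suc (length (filter (\<lambda>x. x \<le> a) u) + length (filter (\<lambda>y. y < a) v)) +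
       (Suc (length u) + inversions (u @ v)))"
    using inversions_insert[of u a v] by blast
  then have "(-1 :: 'a) ^ (inversions (u @ a # v) + Suc (length (filter (\<lambda>x. x \<le> a) u) + length (filter (\<lambda>y. y < a) v))) =
      (-1) ^ (Suc (length u) + inversions (u @ v))"
    by (auto simp: minus_one_power_iff)
  then have "(-1 :: 'a) ^ inversions (u @ a # v) * (-1) ^ Suc (length (filter (\<lambda>x. x \<le> a) u) + length (filter (\<lambda>y. y < a) v)) =
      (-1) ^ Suc (length u) * (-1) ^ inversions (u @ v)"
    by (simp only: power_add)
  then show ?thesis by (simp add: alt_ext_def)
qed

definition set_pluecker_sum :: "(nat set \<Rightarrow> 'k::comm_ring_1) \<Rightarrow> nat set \<Rightarrow> nat set \<Rightarrow> 'k" where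
  "set_pluecker_sum f X Y =
    (\<Sum>i\<in>Y - X. (-1) ^ (card {y \<in> Y. y \<le> i} + card {x \<in> X. x < i}) * f (X \<union> {i}) * f (Y - {i}))"

text \<open>By the sign rule for deletion, the signs depending on the order of the letters are the same in all
  terms.\<close>

lemma word_pluecker_distinct:
  assumes "distinct ys" "distinct xs"
  shows "(\<Sum>k<length ys. (-1) ^ Suc k * alt_ext f (take k ys @ drop (Suc k) ys) * alt_ext f (ys ! k # xs)) =
    (-1) ^ (inversions ys + inversions xs) * set_pluecker_sum f (set xs) (set ys)"
proof -
  let ?X = "set xs" and ?Y = "set ys"
  let ?g = "\<lambda>i. (-1) ^ (inversions ys + inversions xs) * (if i \<in> ?X then 0 else
      (-1) ^ (card {y \<in> ?Y. y \<le> i} + card {x \<in> ?X. x < i}) * f (?X \<union> {i}) * f (?Y - {i}))"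
  have "(-1) ^ Suc k * alt_ext f (take k ys @ drop (Suc k) ys) * alt_ext f (ys ! k # xs) = ?g (ys ! k)"
    if k: "k < length ys" for k
  proof -
    define u i v where "u = take k ys" "i = ys ! k" "v = drop (Suc k) ys"
    have ys: "ys = u @ i # v" unfolding u_i_v_def by (rule id_take_nth_drop[OF k])
    have dist: "distinct (u @ v)" "i \<notin> set (u @ v)" using assms(1) unfolding ys by auto
    have Y: "set (u @ v) = ?Y - {i}" using dist(2) unfolding ys by auto
    have "{y \<in> ?Y. y \<le> i} = set (filter (\<lambda>y. y \<le> i) ys)" by auto
    then have "card {y \<in> ?Y. y \<le> i} = length (filter (\<lambda>y. y \<le> i) ys)"
      using assms(1) by (simp only: distinct_card distinct_filter)
    also have "\<dots> = Suc (length (filter (\<lambda>x. x \<le> i) u) + length (filter (\<lambda>y. y \<le> i) v))"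
      unfolding ys by simp
    also have "filter (\<lambda>y. y \<le> i) v = filter (\<lambda>y. y < i) v"
      using dist(2) by (intro filter_cong) (auto simp: order_le_less)
    finally have rank: "Suc (length (filter (\<lambda>x. x \<le> i) u) + length (filter (\<lambda>y. y < i) v)) = card {y \<in> ?Y. y \<le> i}" ..
    have "k = length u" using k by (simp add: u_i_v_def)
    then have 1: "(-1) ^ Suc k * alt_ext f (u @ v) =
        (-1) ^ inversions ys * (-1) ^ card {y \<in> ?Y. y \<le> i} * f (?Y - {i})"
      using alt_ext_delete[of u f v i] dist(1) by (simp only: rank ys[symmetric] Y if_True)
    have "{x \<in> ?X. x < i} = set (filter (\<lambda>x. x < i) xs)" by auto
    then have "card {x \<in> ?X. x < i} = length (filter (\<lambda>x. x < i) xs)"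
      using assms(2) by (simp only: distinct_card distinct_filter)
    then have 2: "alt_ext f (i # xs) = (if i \<in> ?X then 0 else
        (-1) ^ (card {x \<in> ?X. x < i} + inversions xs) * f (?X \<union> {i}))"
      using assms(2) by (simp add: alt_ext_def)
    show ?thesis
      unfolding u_i_v_def[symmetric] 1 2 by (simp add: power_add mult_ac)
  qed
  then have "(\<Sum>k<length ys. (-1) ^ Suc k * alt_ext f (take k ys @ drop (Suc k) ys) * alt_ext f (ys ! k # xs)) =
      (\<Sum>k<length ys. ?g (ys ! k))" by simp
  also have "\<dots> = (\<Sum>i\<in>?Y. ?g i)"
    by (rule sum.reindex_bij_betw[OF bij_betw_nth]) (use assms in auto)
  also have "\<dots> = (\<Sum>i\<in>?Y - ?X. ?g i)"
    by (rule sum.mono_neutral_right) auto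
  also have "\<dots> = (-1) ^ (inversions ys + inversions xs) * set_pluecker_sum f ?X ?Y"
    unfolding set_pluecker_sum_def sum_distrib_left by (rule sum.cong) auto
  finally show ?thesis .
qed

lemma not_distinct_delete:
  assumes "i < j" "j < length ys" "ys ! i = ys ! j" "k < length ys" "k \<noteq> i" "k \<noteq> j"
  shows "\<not> distinct (take k ys @ drop (Suc k) ys)"
proof
  let ?R = "take k ys @ drop (Suc k) ys"
  assume d: "distinct ?R"
  have nth: "?R ! m = ys ! (if m < k then m else Suc m)" if "m < length ys - 1" for m
    using that assms(4) by (auto simp: nth_append)
  \<comment> \<open>The position after deletion of the letter at position \<open>k\<close>.\<close>
  let ?t = "\<lambda>m. if m < k then m else m - 1"
  have t: "?t i < length ?R" "?t j < length ?R" "?t i \<noteq> ?t j" using assms by auto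
  have "?R ! ?t i = ys ! i" "?R ! ?t j = ys ! j" using assms by (subst nth; auto)+
  with assms(3) have "?R ! ?t i = ?R ! ?t j" by (simp only:)
  with nth_eq_iff_index_eq[OF d t(1,2)] t(3) show False by blast
qed

text \<open>Only deletion at one of two positions with equal letters can leave a word without repetitions. Both leave
  the same set of letters, and the exponents in the sign rule differ by one, as the later deletion
  counts the earlier occurrence.\<close>

lemma word_pluecker_not_distinct:
  assumes "\<not> distinct ys"
  shows "(\<Sum>k<length ys. (-1) ^ Suc k * alt_ext f (take k ys @ drop (Suc k) ys) * alt_ext f (ys ! k # xs)) = 0"
proof -
  from assms obtain u c v w where ys: "ys = u @ c # v @ c # w"
    using not_distinct_decomp[of ys] by auto
  let ?t = "\<lambda>k. (-1) ^ Suc k * alt_ext f (take k ys @ drop (Suc k) ys) * alt_ext f (ys ! k # xs)"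
  let ?i = "length u" and ?j = "length (u @ c # v)"
  have ij: "?i < ?j" "?j < length ys" "ys ! ?i = c" "ys ! ?j = c"
    unfolding ys by (auto simp: nth_append)
  have "(\<Sum>k<length ys. ?t k) = (\<Sum>k\<in>{?i, ?j}. ?t k)"
  proof (rule sum.mono_neutral_right)
    show "\<forall>k\<in>{..<length ys} - {?i, ?j}. ?t k = 0"
      using not_distinct_delete[OF ij(1,2)] ij(3,4) by (auto simp: alt_ext_def simp del: length_append)
  qed (use ij in auto)
  also have "\<dots> = ?t ?i + ?t ?j" by simp
  also have "\<dots> = 0"
  proof -
    have i: "take ?i ys @ drop (Suc ?i) ys = u @ v @ c # w" unfolding ys by simp
    have j: "take ?j ys @ drop (Suc ?j) ys = (u @ c # v) @ w" unfolding ys by simp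
    let ?F = "if distinct (u @ v @ c # w) then f (set (u @ v @ c # w)) else 0"
    have F: "(if distinct ((u @ c # v) @ w) then f (set ((u @ c # v) @ w)) else 0) = ?F"
    proof -
      have "distinct ((u @ c # v) @ w) = distinct (u @ v @ c # w)" "set ((u @ c # v) @ w) = set (u @ v @ c # w)" by auto
      then show ?thesis by simp
    qed
    have 1: "(-1) ^ Suc ?i * alt_ext f (u @ v @ c # w) = (-1) ^ inversions ys *
        (-1) ^ Suc (length (filter (\<lambda>x. x \<le> c) u) + length (filter (\<lambda>y. y < c) (v @ c # w))) * ?F"
      using alt_ext_delete[of u f "v @ c # w" c] unfolding ys by simp
    have 2: "(-1) ^ Suc ?j * alt_ext f ((u @ c # v) @ w) = (-1) ^ inversions ys *
        (-1) ^ Suc (length (filter (\<lambda>x. x \<le> c) (u @ c # v)) + length (filter (\<lambda>y. y < c) w)) * ?F"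
      using alt_ext_delete[of "u @ c # v" f w c] unfolding F ys by simp
    have "(-1) ^ Suc ?i * alt_ext f (u @ v @ c # w) + (-1) ^ Suc ?j * alt_ext f ((u @ c # v) @ w) = 0"
    proof (cases "distinct (u @ v @ c # w)")
      case True
      then have "filter (\<lambda>y. y \<le> c) v = filter (\<lambda>y. y < c) v" by (intro filter_cong) (auto simp: order_le_less)
      then show ?thesis unfolding 1 2 by (simp add: power_add)
    next
      case False
      show ?thesis unfolding 1 2 if_not_P[OF False] by simp
    qed
    then show ?thesis unfolding i j ij(3,4) by (simp only: distrib_right[symmetric] mult_zero_left)
  qed
  finally show ?thesis .
qed

lemma word_pluecker_iff:
  fixes p :: "nat list \<Rightarrow> 'k::field"
  assumes p: "\<forall>w\<in>words n d. p w = alt_ext f w"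
  shows "(\<forall>ys xs. ys \<in> words n (d + 1) \<and> set xs \<subseteq> {1..n} \<and> length xs + 1 = d \<longrightarrow>
       (\<Sum>k=1..d+1. (-1) ^ k * p (take (k - 1) ys @ drop k ys) * p (ys ! (k - 1) # xs)) = 0) \<longleftrightarrow>
     (\<forall>X Y. X \<subseteq> {1..n} \<and> card X + 1 = d \<and> Y \<in> d_subsets n (d + 1) \<longrightarrow> set_pluecker_sum f X Y = 0)"
    (is "?L \<longleftrightarrow> ?R")
proof -
  have sum: "(\<Sum>k=1..d+1. (-1) ^ k * p (take (k - 1) ys @ drop k ys) * p (ys ! (k - 1) # xs)) =
      (\<Sum>k<length ys. (-1) ^ Suc k * alt_ext f (take k ys @ drop (Suc k) ys) * alt_ext f (ys ! k # xs))"
    if "ys \<in> words n (d + 1)" "set xs \<subseteq> {1..n}" "length xs + 1 = d" for ys xs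
  proof -
    have "take k ys @ drop (Suc k) ys \<in> words n d" "ys ! k # xs \<in> words n d" if k: "k < Suc d" for k
    proof -
      have ys: "length ys = Suc d" "set ys \<subseteq> {1..n}" using \<open>ys \<in> _\<close> by (auto simp: words_def)
      then have "ys ! k \<in> {1..n}" using k nth_mem[of k ys] by (auto simp del: nth_mem)
      then show "ys ! k # xs \<in> words n d" using \<open>set xs \<subseteq> _\<close> \<open>length xs + 1 = d\<close> by (simp add: words_def)
      have "set (take k ys @ drop (Suc k) ys) \<subseteq> set ys" by (auto dest: in_set_takeD in_set_dropD)
      then show "take k ys @ drop (Suc k) ys \<in> words n d" using ys k unfolding words_def by auto
    qed
    then have "(\<Sum>k<Suc d. (-1) ^ Suc k * p (take k ys @ drop (Suc k) ys) * p (ys ! k # xs)) =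
       (\<Sum>k<Suc d. (-1) ^ Suc k * alt_ext f (take k ys @ drop (Suc k) ys) * alt_ext f (ys ! k # xs))"
      by (intro sum.cong refl) (simp add: p)
    moreover have "length ys = Suc d" using that(1) by (simp add: words_def)
    ultimately show ?thesis
      using sum.atLeast1_atMost_eq[of "\<lambda>k. (-1) ^ k * p (take (k - 1) ys @ drop k ys) * p (ys ! (k - 1) # xs)" "Suc d"]
      by simp
  qed
  show ?thesis
  proof
    assume L: ?L
    show ?R
    proof (intro allI impI)
      fix X Y assume *: "X \<subseteq> {1..n} \<and> card X + 1 = d \<and> Y \<in> d_subsets n (d + 1)"
      then have fin: "finite X" "finite Y" by (auto simp: d_subsets_def intro: finite_subset)
      let ?ys = "sorted_list_of_set Y" and ?xs = "sorted_list_of_set X"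
      have w: "?ys \<in> words n (d + 1)" "set ?xs \<subseteq> {1..n}" "length ?xs + 1 = d"
        using * fin by (auto simp: words_def d_subsets_def)
      with L have "(\<Sum>k=1..d+1. (-1) ^ k * p (take (k - 1) ?ys @ drop k ?ys) * p (?ys ! (k - 1) # ?xs)) = 0" by blast
      then have "(-1) ^ (inversions ?ys + inversions ?xs) * set_pluecker_sum f (set ?xs) (set ?ys) = 0"
        unfolding sum[OF w] by (subst (asm) word_pluecker_distinct) simp_all
      then show "set_pluecker_sum f X Y = 0" using fin by simp
    qed
  next
    assume R: ?R
    show ?L
    proof (intro allI impI)
      fix ys xs assume *: "ys \<in> words n (d + 1) \<and> set xs \<subseteq> {1..n} \<and> length xs + 1 = d"
      then have s: "(\<Sum>k=1..d+1. (-1) ^ k * p (take (k - 1) ys @ drop k ys) * p (ys ! (k - 1) # xs)) =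
          (\<Sum>k<length ys. (-1) ^ Suc k * alt_ext f (take k ys @ drop (Suc k) ys) * alt_ext f (ys ! k # xs))"
        by (intro sum) auto
      show "(\<Sum>k=1..d+1. (-1) ^ k * p (take (k - 1) ys @ drop k ys) * p (ys ! (k - 1) # xs)) = 0"
      proof (cases "distinct ys \<and> distinct xs")
        case True
        then have "set_pluecker_sum f (set xs) (set ys) = 0"
          using R * by (auto simp: d_subsets_def words_def distinct_card)
        then show ?thesis
          unfolding s word_pluecker_distinct[OF True[THEN conjunct1] True[THEN conjunct2]] by simp
      next
        case False
        show ?thesis
        proof (cases "distinct ys")
          case True
          then have "\<not> distinct xs" using False by simp
          then show ?thesis unfolding s by (simp add: alt_ext_def)
        next
          case False
          then show ?thesis unfolding s by (rule word_pluecker_not_distinct)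
        qed
      qed
    qed
  qed
qed

section \<open>Matroids and Pluecker vectors\<close>

lemma pluecker_index:
  assumes "X \<subseteq> {1..n}" "card X + 1 = d" "Y \<in> d_subsets n (d + 1)"
    and "k \<in> {1..card Y}" "sorted_list_of_set Y ! (k - 1) \<notin> X"
  shows "X \<union> {sorted_list_of_set Y ! (k - 1)} \<in> d_subsets n d"
    and "Y - {sorted_list_of_set Y ! (k - 1)} \<in> d_subsets n d"
proof -
  have fin: "finite X" "finite Y" using assms by (auto simp: d_subsets_def intro: finite_subset)
  have "sorted_list_of_set Y ! (k - 1) \<in> set (sorted_list_of_set Y)"
    using assms(4) fin by (intro nth_mem) auto
  then have "sorted_list_of_set Y ! (k - 1) \<in> Y" using fin by simp
  then show "X \<union> {sorted_list_of_set Y ! (k - 1)} \<in> d_subsets n d"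
    "Y - {sorted_list_of_set Y ! (k - 1)} \<in> d_subsets n d"
    using assms fin by (auto simp: d_subsets_def)
qed

lemma pluecker_rel_cong:
  assumes "f1pm_algebra B \<epsilon>" "X \<subseteq> {1..n}" "card X + 1 = d" "Y \<in> d_subsets n (d + 1)"
    and "v \<in> d_subsets n d \<rightarrow> und B" "\<And>I. I \<in> d_subsets n d \<Longrightarrow> v I = w I"
  shows "pluecker_rel B \<epsilon> v X Y \<longleftrightarrow> pluecker_rel B \<epsilon> w X Y"
proof -
  interpret f1pm_algebra B \<epsilon> by fact
  note index = pluecker_index[OF assms(2-4)]
  have "v I \<in> carrier B" if "I \<in> d_subsets n d" for I using assms(5) that und_subset by blast
  moreover have "\<epsilon> \<in> carrier B" using eps_und und_subset by blast
  ultimately show ?thesis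
    unfolding pluecker_rel_def Let_def
    by (intro arg_cong2[of _ _ _ _ "leq B"] refl finsum_cong')
      (use index in \<open>auto simp: assms(6)[symmetric]\<close>)
qed

text \<open>Uniqueness of coordinates makes \<open>\<Delta> \<mapsto> \<Sum>\<^sub>I \<Delta>\<^sub>I e\<^sub>I\<close> injective on extensional functions, and it commutes with
  the action of the units.\<close>

lemma bij_betw_matroids_pluecker_classes:
  fixes B :: "'b blueprint"
  assumes "f1pm_algebra B \<epsilon>"
  shows "bij_betw (\<lambda>C. ext_vec B \<epsilon> n d ` C) (matroids B \<epsilon> n d)
    (pluecker_class B \<epsilon> n d ` pluecker_vectors B \<epsilon> n d)"
proof -
  interpret f1pm_algebra B \<epsilon> by fact
  let ?J = "d_subsets n d" and ?vec = "ext_vec B \<epsilon> n d"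
  interpret E: coordinatized B "ext_power B \<epsilon> n d" ?J ?vec
    by (rule coordinatized_ext_power[OF ordered_blueprint_axioms eps_und eps_square])
  have units: "bp_units B \<subseteq> carrier B"
    unfolding bp_units_def Units_def using und_subset by auto
  have inj: "inj_on ?vec (?J \<rightarrow>\<^sub>E carrier B)"
  proof (rule inj_onI)
    fix v w assume vw: "v \<in> ?J \<rightarrow>\<^sub>E carrier B" "w \<in> ?J \<rightarrow>\<^sub>E carrier B" "?vec v = ?vec w"
    then have "v \<in> ?J \<rightarrow> carrier B" "w \<in> ?J \<rightarrow> carrier B" by auto
    with vw(3) have "\<forall>I\<in>?J. v I = w I" by (simp add: E.vec_eq_iff)
    then show "v = w" by (intro PiE_ext[OF vw(1,2)]) blast
  qed
  have gp: "\<Delta> \<in> ?J \<rightarrow>\<^sub>E carrier B" if "\<Delta> \<in> gp_functions B \<epsilon> n d" for \<Delta>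
  proof -
    have "\<Delta> \<in> ?J \<rightarrow>\<^sub>E und B" using that by (simp add: gp_functions_def)
    then show ?thesis using PiE_mono[of ?J "\<lambda>_. und B" "\<lambda>_. carrier B"] und_subset by blast
  qed
  have cls: "gp_class B n d \<Delta> \<subseteq> ?J \<rightarrow>\<^sub>E carrier B" if "\<Delta> \<in> gp_functions B \<epsilon> n d" for \<Delta>
  proof
    fix g assume "g \<in> gp_class B n d \<Delta>"
    then obtain a where a: "a \<in> bp_units B" "g = (\<lambda>I\<in>?J. a \<otimes>\<^bsub>B\<^esub> \<Delta> I)" unfolding gp_class_def by blast
    have "a \<in> carrier B" using a(1) units by blast
    then show "g \<in> ?J \<rightarrow>\<^sub>E carrier B" using gp[OF that] unfolding a(2) by auto
  qed
  have "inj_on (\<lambda>C. ?vec ` C) (matroids B \<epsilon> n d)"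
    by (rule inj_on_subset[OF inj_on_image_Pow[OF inj]]) (use cls in \<open>auto simp: matroids_def\<close>)
  moreover have image: "?vec ` gp_class B n d \<Delta> = pluecker_class B \<epsilon> n d (?vec \<Delta>)"
    if "\<Delta> \<in> gp_functions B \<epsilon> n d" for \<Delta>
  proof -
    have \<Delta>: "\<Delta> \<in> ?J \<rightarrow> carrier B" using gp[OF that] by auto
    have "?vec (\<lambda>I\<in>?J. a \<otimes>\<^bsub>B\<^esub> \<Delta> I) = act (ext_power B \<epsilon> n d) a (?vec \<Delta>)" if "a \<in> bp_units B" for a
    proof -
      have "a \<in> carrier B" using that units by blast
      then show ?thesis unfolding E.vec_act[OF \<open>a \<in> carrier B\<close> \<Delta>] using \<Delta> by (intro E.vec_cong) auto
    qed
    then have "(\<lambda>a. ?vec (\<lambda>I\<in>?J. a \<otimes>\<^bsub>B\<^esub> \<Delta> I)) ` bp_units B = (\<lambda>a. act (ext_power B \<epsilon> n d) a (?vec \<Delta>)) ` bp_units B"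
      by (intro image_cong refl)
    then show ?thesis
      unfolding gp_class_def pluecker_class_def by (simp only: Setcompr_eq_image image_image)
  qed
  moreover have "pluecker_vectors B \<epsilon> n d = ?vec ` gp_functions B \<epsilon> n d"
  proof (intro equalityI subsetI)
    fix w assume "w \<in> pluecker_vectors B \<epsilon> n d"
    then obtain v where v: "v \<in> ?J \<rightarrow> und B" "w = ?vec v" "\<exists>J\<in>?J. v J \<in> bp_units B"
      "\<And>X Y. X \<subseteq> {1..n} \<Longrightarrow> card X + 1 = d \<Longrightarrow> Y \<in> d_subsets n (d + 1) \<Longrightarrow> pluecker_rel B \<epsilon> v X Y"
      unfolding pluecker_vectors_def by blast
    have "pluecker_rel B \<epsilon> (restrict v ?J) X Y"
      if "X \<subseteq> {1..n}" "card X + 1 = d" "Y \<in> d_subsets n (d + 1)" for X Y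
      using v(4)[OF that] pluecker_rel_cong[OF assms that v(1), of "restrict v ?J"] by simp
    then have "restrict v ?J \<in> gp_functions B \<epsilon> n d"
      using v(1,3) by (auto simp: gp_functions_def)
    moreover have "w = ?vec (restrict v ?J)"
      unfolding v(2) using v(1) und_subset by (intro E.vec_cong) (auto simp: Pi_iff)
    ultimately show "w \<in> ?vec ` gp_functions B \<epsilon> n d" by blast
  next
    fix w assume "w \<in> ?vec ` gp_functions B \<epsilon> n d"
    then obtain \<Delta> where \<Delta>: "\<Delta> \<in> gp_functions B \<epsilon> n d" "w = ?vec \<Delta>" by blast
    then have "\<Delta> \<in> ?J \<rightarrow> und B" by (auto simp: gp_functions_def)
    then show "w \<in> pluecker_vectors B \<epsilon> n d"
      using \<Delta> unfolding pluecker_vectors_def gp_functions_def ext_power_def Let_def by auto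
  qed
  ultimately show ?thesis
    unfolding bij_betw_def matroids_def by (auto simp: image_image)
qed

lemma gp_functions_ring_iff:
  "(\<lambda>I\<in>d_subsets n d. monomial ring_rels (f I)) \<in> gp_functions ring_mon ring_eps n d \<longleftrightarrow>
    (\<exists>I\<in>d_subsets n d. f I \<noteq> (0 :: 'k::field)) \<and>
    (\<forall>X Y. X \<subseteq> {1..n} \<and> card X + 1 = d \<and> Y \<in> d_subsets n (d + 1) \<longrightarrow> set_pluecker_sum f X Y = 0)"
proof -
  let ?\<Delta> = "\<lambda>I\<in>d_subsets n d. monomial ring_rels (f I)"
  have "(\<exists>b. f I * b = 1) \<longleftrightarrow> f I \<noteq> 0" for I
    by (metis mult_zero_left right_inverse zero_neq_one)
  then have units: "monomial ring_rels (f I) \<in> bp_units (monomial_bp ring_rels) \<longleftrightarrow> f I \<noteq> 0" for I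
    by (simp add: monomial_order.bp_units_monomial[OF monomial_order_ring])
  have rel: "pluecker_rel (monomial_bp ring_rels) (monomial ring_rels (-1)) ?\<Delta> X Y \<longleftrightarrow> set_pluecker_sum f X Y = 0"
    if "X \<subseteq> {1..n}" "card X + 1 = d" "Y \<in> d_subsets n (d + 1)" for X Y
    by (subst pluecker_rel_monomial[OF _ that, where v = f])
      (simp_all add: ring_null_iff set_pluecker_sum_def sum_unfold_sum_mset)
  show ?thesis
    unfolding gp_functions_def ring_mon_def ring_eps_def using rel
    by (auto simp: units monomial_bp_simps(7))
qed

lemma field_gp_functions_iff:
  "(\<lambda>w\<in>words n d. alt_ext f w :: 'k::field) \<in> field_gp_functions n d \<longleftrightarrow>
    (\<exists>I\<in>d_subsets n d. f I \<noteq> 0) \<and>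
    (\<forall>X Y. X \<subseteq> {1..n} \<and> card X + 1 = d \<and> Y \<in> d_subsets n (d + 1) \<longrightarrow> set_pluecker_sum f X Y = 0)"
proof -
  let ?p = "\<lambda>w\<in>words n d. alt_ext f w"
  have nonzero: "(\<exists>w\<in>words n d. ?p w \<noteq> 0) \<longleftrightarrow> (\<exists>I\<in>d_subsets n d. f I \<noteq> 0)"
  proof
    assume "\<exists>w\<in>words n d. ?p w \<noteq> 0"
    then obtain w where w: "w \<in> words n d" "alt_ext f w \<noteq> 0" by auto
    then have "distinct w" "f (set w) \<noteq> 0" by (auto simp: alt_ext_def split: if_splits)
    moreover have "set w \<in> d_subsets n d" using w \<open>distinct w\<close> by (auto simp: words_def d_subsets_def distinct_card)
    ultimately show "\<exists>I\<in>d_subsets n d. f I \<noteq> 0" by blast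
  next
    assume "\<exists>I\<in>d_subsets n d. f I \<noteq> 0"
    then obtain I where I: "I \<in> d_subsets n d" "f I \<noteq> 0" by blast
    then have "sorted_list_of_set I \<in> words n d" "alt_ext f (sorted_list_of_set I) \<noteq> 0"
      using d_subsets_finite(2)[OF I(1)] by (auto simp: words_def d_subsets_def alt_ext_def)
    then show "\<exists>w\<in>words n d. ?p w \<noteq> 0" by force
  qed
  have "\<forall>w\<in>words n d. ?p w = alt_ext f w" by simp
  note relations = word_pluecker_iff[OF this]
  have "?p \<in> words n d \<rightarrow>\<^sub>E UNIV" by simp
  then show ?thesis
    unfolding field_gp_functions_def mem_Collect_eq nonzero relations using alternating_alt_ext[of n d f] by blast
qed

text \<open>The Grassmann-Pluecker function over \<open>K\<^sup>m\<^sup>o\<^sup>n\<close> that belongs to a function on words over \<open>K\<close>.\<close>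

definition to_blueprint :: "nat \<Rightarrow> nat \<Rightarrow> (nat list \<Rightarrow> 'k::field) \<Rightarrow> nat set \<Rightarrow> 'k multiset set" where
  "to_blueprint n d p = (\<lambda>I\<in>d_subsets n d. monomial ring_rels (p (sorted_list_of_set I)))"

definition alternating_functions :: "nat \<Rightarrow> nat \<Rightarrow> (nat list \<Rightarrow> 'k::field) set" where
  "alternating_functions n d = {p \<in> words n d \<rightarrow>\<^sub>E UNIV. alternating n d p}"

lemma alternating_functions_eq:
  assumes "p \<in> alternating_functions n d"
  shows "p = (\<lambda>w\<in>words n d. alt_ext (\<lambda>I. p (sorted_list_of_set I)) w)"
proof
  fix w show "p w = (\<lambda>w\<in>words n d. alt_ext (\<lambda>I. p (sorted_list_of_set I)) w) w"
    using assms alternating_eq_alt_ext[of n d p w]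
    by (cases "w \<in> words n d") (auto simp: alternating_functions_def PiE_arb[of p _ _ w])
qed

lemma alt_ext_cong:
  assumes "\<And>I. I \<in> d_subsets n d \<Longrightarrow> f I = g I" "w \<in> words n d"
  shows "alt_ext f w = alt_ext g w"
  using assms(1)[of "set w"] assms(2) by (auto simp: alt_ext_def words_def d_subsets_def distinct_card)

lemma inj_on_to_blueprint: "inj_on (to_blueprint n d) (alternating_functions n d :: (nat list \<Rightarrow> 'k::field) set)"
proof (rule inj_onI)
  fix p q :: "nat list \<Rightarrow> 'k"
  assume pq: "p \<in> alternating_functions n d" "q \<in> alternating_functions n d" "to_blueprint n d p = to_blueprint n d q"
  have "p (sorted_list_of_set I) = q (sorted_list_of_set I)" if "I \<in> d_subsets n d" for I
    using fun_cong[OF pq(3), of I] that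
    by (simp add: to_blueprint_def monomial_order.monomial_eq_iff[OF monomial_order_ring])
  then have "alt_ext (\<lambda>I. p (sorted_list_of_set I)) w = alt_ext (\<lambda>I. q (sorted_list_of_set I)) w"
    if "w \<in> words n d" for w
    using that by (intro alt_ext_cong) auto
  then show "p = q"
    using alternating_functions_eq[OF pq(1)] alternating_functions_eq[OF pq(2)]
    by (metis (no_types, lifting) restrict_ext)
qed

lemma to_blueprint_gp_functions:
  "to_blueprint n d ` field_gp_functions n d = (gp_functions ring_mon ring_eps n d :: (nat set \<Rightarrow> 'k::field multiset set) set)"
proof (intro equalityI subsetI)
  fix \<Delta> :: "nat set \<Rightarrow> 'k multiset set" assume "\<Delta> \<in> to_blueprint n d ` field_gp_functions n d"
  then obtain p :: "nat list \<Rightarrow> 'k" where p: "p \<in> field_gp_functions n d" "\<Delta> = to_blueprint n d p" by blast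
  then have "p \<in> alternating_functions n d" by (simp add: field_gp_functions_def alternating_functions_def)
  from p(1) show "\<Delta> \<in> gp_functions ring_mon ring_eps n d"
    unfolding p(2) to_blueprint_def gp_functions_ring_iff
    by (subst (asm) alternating_functions_eq[OF \<open>p \<in> alternating_functions n d\<close>])
      (unfold field_gp_functions_iff)
next
  fix \<Delta> :: "nat set \<Rightarrow> 'k multiset set" assume \<Delta>: "\<Delta> \<in> gp_functions ring_mon ring_eps n d"
  then have range: "\<Delta> \<in> d_subsets n d \<rightarrow>\<^sub>E range (monomial ring_rels)"
    by (simp add: gp_functions_def ring_mon_def monomial_bp_simps(7))
  then have "\<forall>I. \<exists>a. I \<in> d_subsets n d \<longrightarrow> \<Delta> I = monomial ring_rels a" by (auto simp: PiE_iff)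
  then obtain f where f: "\<And>I. I \<in> d_subsets n d \<Longrightarrow> \<Delta> I = monomial ring_rels (f I)" by metis
  have eq: "\<Delta> = (\<lambda>I\<in>d_subsets n d. monomial ring_rels (f I))"
  proof
    fix I show "\<Delta> I = (\<lambda>I\<in>d_subsets n d. monomial ring_rels (f I)) I"
      using f[of I] PiE_arb[OF range, of I] by (cases "I \<in> d_subsets n d") simp_all
  qed
  let ?p = "\<lambda>w\<in>words n d. alt_ext f w"
  have "?p \<in> field_gp_functions n d" using \<Delta> unfolding eq gp_functions_ring_iff field_gp_functions_iff .
  moreover have "to_blueprint n d ?p = \<Delta>"
  proof -
    have "?p (sorted_list_of_set I) = f I" if "I \<in> d_subsets n d" for I
      using that d_subsets_finite(2)[OF that]
      by (auto simp: alt_ext_def words_def d_subsets_def inversions_sorted)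
    then show ?thesis unfolding to_blueprint_def eq by (intro restrict_ext) simp
  qed
  ultimately show "\<Delta> \<in> to_blueprint n d ` field_gp_functions n d" by blast
qed

lemma to_blueprint_class:
  "to_blueprint n d ` field_gp_class n d p = gp_class ring_mon n d (to_blueprint n d (p :: nat list \<Rightarrow> 'k::field))"
proof -
  have word: "sorted_list_of_set I \<in> words n d" if "I \<in> d_subsets n d" for I
    using that d_subsets_finite(2)[OF that] by (auto simp: words_def d_subsets_def)
  have 1: "to_blueprint n d (\<lambda>xs\<in>words n d. a * p xs) =
      (\<lambda>I\<in>d_subsets n d. monomial ring_rels a \<otimes>\<^bsub>ring_mon\<^esub> to_blueprint n d p I)" for a
    by (rule ext) (simp add: to_blueprint_def word ring_mon_def monomial_mult)
  have "(\<exists>b. a * b = 1) \<longleftrightarrow> a \<noteq> 0" for a :: 'k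
    by (metis mult_zero_left right_inverse zero_neq_one)
  then have "monomial ring_rels a \<in> bp_units (monomial_bp ring_rels) \<longleftrightarrow> a \<noteq> 0" for a :: 'k
    by (simp add: monomial_order.bp_units_monomial[OF monomial_order_ring])
  moreover have "bp_units (monomial_bp ring_rels) \<subseteq> range (monomial (ring_rels :: ('k multiset \<times> 'k multiset) set))"
    unfolding bp_units_def Units_def by (auto simp: monomial_bp_simps(7))
  ultimately have units: "bp_units ring_mon = monomial ring_rels ` {a :: 'k. a \<noteq> 0}"
    unfolding ring_mon_def by auto
  show ?thesis
  proof -
    have "field_gp_class n d p = (\<lambda>a. \<lambda>xs\<in>words n d. a * p xs) ` {a. a \<noteq> 0}"
      unfolding field_gp_class_def by blast
    then show ?thesis
      unfolding gp_class_def by (simp only: Setcompr_eq_image Collect_mem_eq units image_image 1)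
  qed
qed

text \<open>A class consists of alternating functions, on which the passage to \<open>K\<^sup>m\<^sup>o\<^sup>n\<close> is injective; so it is
  injective on classes as sets of functions.\<close>

lemma bij_betw_field_matroids:
  "bij_betw (\<lambda>C. to_blueprint n d ` C) (field_matroids n d)
    (matroids (ring_mon :: 'k::field multiset set blueprint) ring_eps n d)"
proof -
  have "C \<subseteq> alternating_functions n d" if C: "C \<in> field_matroids n d" for C :: "(nat list \<Rightarrow> 'k) set"
  proof -
    obtain p where p: "p \<in> field_gp_functions n d" "C = field_gp_class n d p"
      using C unfolding field_matroids_def by blast
    then have alt: "alternating n d p" by (simp add: field_gp_functions_def)
    have "alternating n d (\<lambda>xs\<in>words n d. a * p xs)" for a
      unfolding alternating_def
    proof (intro conjI ballI allI impI)
      fix w \<pi> assume w: "w \<in> words n d" and \<pi>: "\<pi> permutes {..<d}"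
      then have "permute_list \<pi> w \<in> words n d" by (simp add: words_def)
      moreover have "p (permute_list \<pi> w) = of_int (sign \<pi>) * p w"
        using alt w \<pi> unfolding alternating_def by blast
      ultimately show "(\<lambda>xs\<in>words n d. a * p xs) (permute_list \<pi> w) = of_int (sign \<pi>) * (\<lambda>xs\<in>words n d. a * p xs) w"
        using w by simp
    next
      fix w assume "w \<in> words n d" "\<not> distinct w"
      then show "(\<lambda>xs\<in>words n d. a * p xs) w = 0" using alt unfolding alternating_def by simp
    qed
    then show ?thesis unfolding p(2) field_gp_class_def alternating_functions_def by auto
  qed
  then have "inj_on (\<lambda>C. to_blueprint n d ` C) (field_matroids n d :: (nat list \<Rightarrow> 'k) set set)"
    by (intro inj_on_subset[OF inj_on_image_Pow[OF inj_on_to_blueprint]]) auto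
  moreover have "(\<lambda>C. to_blueprint n d ` C) ` field_matroids n d = (matroids ring_mon ring_eps n d :: (nat set \<Rightarrow> 'k multiset set) set set)"
    unfolding field_matroids_def matroids_def to_blueprint_gp_functions[symmetric]
    by (simp add: image_image to_blueprint_class)
  ultimately show ?thesis by (simp add: bij_betw_def)
qed

text \<open>A tropical Pluecker vector is given by some family satisfying the relations, which by uniqueness of
  coordinates agrees with \<open>v\<close> wherever the relations look at it.\<close>

lemma gp_functions_semifield_iff:
  fixes v :: "nat set \<Rightarrow> 's::idempotent_semifield"
  shows "(\<lambda>I\<in>d_subsets n d. monomial semifield_rels (v I)) \<in> gp_functions semifield_mon semifield_eps n d \<longleftrightarrow>
    trop_ext_vec n d v \<in> trop_pluecker_vectors n d"
proof -
  let ?J = "d_subsets n d" and ?\<Delta> = "\<lambda>I\<in>d_subsets n d. monomial semifield_rels (v I)"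
  let ?N = "trop_ext_power n d :: ('s, ('s, nat \<Rightarrow> 's) tensor set set) bmodule"
  interpret M: coordinatized discrete_bp ?N ?J "trop_ext_vec n d"
    by (rule coordinatized_trop_ext_power)
  let ?P = "\<lambda>v. \<forall>A X p. A \<in> d_subsets n (d + 1) \<and> X \<subseteq> {1..n} \<and> card X + 1 = d \<and> p \<in> A - X \<longrightarrow>
           (\<Sum>i\<in>A - X. v (A - {i}) * v (X \<union> {i})) =
           (\<Sum>i\<in>A - X - {p}. v (A - {i}) * v (X \<union> {i}))"
  have index: "A - {i} \<in> ?J" "X \<union> {i} \<in> ?J"
    if "A \<in> d_subsets n (d + 1)" "X \<subseteq> {1..n}" "card X + 1 = d" "i \<in> A - X" for A X i
  proof -
    have "finite X" "finite A" using that by (auto simp: d_subsets_def intro: finite_subset)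
    then show "A - {i} \<in> ?J" "X \<union> {i} \<in> ?J" using that by (auto simp: d_subsets_def)
  qed
  have P_cong: "?P u \<longleftrightarrow> ?P v" if "\<And>I. I \<in> ?J \<Longrightarrow> u I = v I" for u
  proof -
    have sum: "(\<Sum>i\<in>S. u (A - {i}) * u (X \<union> {i})) = (\<Sum>i\<in>S. v (A - {i}) * v (X \<union> {i}))"
      if "A \<in> d_subsets n (d + 1)" "X \<subseteq> {1..n}" "card X + 1 = d" "S \<subseteq> A - X" for A X S
    proof (rule sum.cong[OF refl])
      fix i assume "i \<in> S"
      then have "i \<in> A - X" using that(4) by blast
      from index[OF that(1-3) this] show "u (A - {i}) * u (X \<union> {i}) = v (A - {i}) * v (X \<union> {i})"
        by (simp only: \<open>\<And>I. I \<in> ?J \<Longrightarrow> u I = v I\<close>)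
    qed
    show ?thesis
      by (intro iff_allI imp_cong refl, elim conjE) (simp only: sum Diff_subset subset_refl)
  qed
  have "trop_ext_vec n d v \<in> trop_pluecker_vectors n d \<longleftrightarrow> (\<exists>I\<in>?J. v I \<noteq> 0) \<and> ?P v"
  proof -
    have carr: "trop_ext_vec n d v \<in> carrier ?N" by (simp add: M.carrier_N)
    have zero: "trop_ext_vec n d v = \<zero>\<^bsub>?N\<^esub> \<longleftrightarrow> (\<forall>I\<in>?J. v I = 0)"
      unfolding M.vec_zero by (subst M.vec_eq_iff) auto
    have eq: "trop_ext_vec n d v = trop_ext_vec n d u \<longleftrightarrow> (\<forall>I\<in>?J. v I = u I)" for u
      by (subst M.vec_eq_iff) auto
    show ?thesis
    proof
      assume "trop_ext_vec n d v \<in> trop_pluecker_vectors n d"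
      then obtain u where u: "trop_ext_vec n d v \<noteq> \<zero>\<^bsub>?N\<^esub>" "trop_ext_vec n d v = trop_ext_vec n d u" "?P u"
        unfolding trop_pluecker_vectors_def by blast
      then have "?P v" using P_cong[of u] unfolding eq by simp
      then show "(\<exists>I\<in>?J. v I \<noteq> 0) \<and> ?P v" using u(1) unfolding zero by blast
    next
      assume *: "(\<exists>I\<in>?J. v I \<noteq> 0) \<and> ?P v"
      then have "trop_ext_vec n d v \<noteq> \<zero>\<^bsub>?N\<^esub>" unfolding zero by blast
      then show "trop_ext_vec n d v \<in> trop_pluecker_vectors n d"
        unfolding trop_pluecker_vectors_def using carr * by blast
    qed
  qed
  moreover have "?\<Delta> \<in> gp_functions semifield_mon semifield_eps n d \<longleftrightarrow> (\<exists>I\<in>?J. v I \<noteq> 0) \<and> ?P v"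
  proof -
    have "(\<exists>b. a * b = 1) \<longleftrightarrow> a \<noteq> 0" for a :: 's
      using ex_mult_inverse by (metis mult_zero_left zero_neq_one)
    then have units: "monomial semifield_rels a \<in> bp_units (monomial_bp semifield_rels) \<longleftrightarrow> a \<noteq> 0" for a :: 's
      by (simp add: monomial_order.bp_units_monomial[OF monomial_order_semifield])
    have rel: "pluecker_rel (monomial_bp semifield_rels) (monomial semifield_rels 1) ?\<Delta> X Y \<longleftrightarrow>
        (\<forall>p\<in>Y - X. (\<Sum>i\<in>Y - X. v (Y - {i}) * v (X \<union> {i})) = (\<Sum>i\<in>Y - X - {p}. v (Y - {i}) * v (X \<union> {i})))"
      if "X \<subseteq> {1..n}" "card X + 1 = d" "Y \<in> d_subsets n (d + 1)" for X Y
    proof -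
      have "finite (Y - X)" using d_subsets_finite(2)[OF that(3)] by simp
      then show ?thesis
        by (subst pluecker_rel_monomial[OF _ that, where v = v])
          (simp_all add: semifield_null_iff tropical_null_image mult.commute)
    qed
    show ?thesis
      unfolding gp_functions_def semifield_mon_def semifield_eps_def using rel
      by (auto simp: units monomial_bp_simps(7))
  qed
  ultimately show ?thesis by simp
qed

section \<open>Canonical isomorphisms\<close>

text \<open>In coordinates, every canonical isomorphism sends \<open>\<Sum> p\<^sub>I e\<^sub>I\<close> to the class of \<open>\<Sum> 1.p\<^sub>I e\<^sub>I\<close>, and this class
  contains exactly one vector with monomial coordinates.\<close>

lemma canonical_field_matroids:
  fixes n d :: nat
  defines "BK \<equiv> ring_mon :: 'k::field multiset set blueprint"
  defines "EB \<equiv> ext_power BK ring_eps n d"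
  defines "canonical \<equiv> \<lambda>\<Phi>. semilinear_iso (monomial ring_rels) (field_ext_power n d) (mod_hull BK EB) \<Phi> \<and>
            (\<forall>I\<in>d_subsets n d.
              \<Phi> (field_ext_basis n I) = hull_class BK EB (ext_basis BK ring_eps n I))"
  shows "\<exists>\<Phi>. canonical \<Phi>"
    and "canonical \<Phi> \<Longrightarrow> bij_betw
             (\<lambda>C. {\<Delta> \<in> d_subsets n d \<rightarrow>\<^sub>E und BK. \<exists>p\<in>C.
                \<Phi> (field_ext_vec n d (\<lambda>I. p (sorted_list_of_set I))) =
                hull_class BK EB (ext_vec BK ring_eps n d \<Delta>)})
             (field_matroids n d) (matroids BK ring_eps n d)"
proof -
  let ?J = "d_subsets n d" and ?\<sigma> = "monomial ring_rels :: 'k \<Rightarrow> 'k multiset set"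
  interpret S: scalar_quotient BK class_sum ?\<sigma> "(=)" EB ?J "ext_vec BK ring_eps n d"
    "{(x, y). x \<preceq>\<^bsub>EB\<^esub> y \<or> y \<preceq>\<^bsub>EB\<^esub> x}"
    unfolding EB_def BK_def by (rule scalar_quotient_hull)
  have hull: "mod_hull BK EB = S.Q" "hull_class BK EB = S.c"
    by (simp_all add: mod_hull_def hull_class_def hull_le_def fun_eq_iff)
  have basis: "ext_basis BK ring_eps n I = ext_vec BK ring_eps n d (\<lambda>K. if K = I then \<one>\<^bsub>BK\<^esub> else \<zero>\<^bsub>BK\<^esub>)"
    if "I \<in> ?J" for I
    unfolding BK_def ring_mon_def ring_eps_def using that
    by (intro ext_basis_eq_vec ordered_blueprint_monomial_bp)
      (simp_all add: monomial_bp_simps(7) monomial_mult monomial_one)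
  have canonical: "canonical \<Phi> \<longleftrightarrow> semilinear_iso ?\<sigma> (field_ext_power n d) S.Q \<Phi> \<and>
      (\<forall>I\<in>?J. \<Phi> (field_ext_vec n d (\<lambda>K. if K = I then 1 else 0)) =
         S.c (ext_vec BK ring_eps n d (\<lambda>K. if K = I then \<one>\<^bsub>BK\<^esub> else \<zero>\<^bsub>BK\<^esub>)))" for \<Phi>
    unfolding canonical_def hull by (simp add: basis field_ext_basis_eq_vec del: bmod_quot_simps)
  show "\<exists>\<Phi>. canonical \<Phi>"
    unfolding canonical by (rule S.canonical_iso_exists[OF coordinatized_field_ext_power])
  assume "canonical \<Phi>"
  then have \<Phi>: "\<Phi> (field_ext_vec n d v) = S.c (ext_vec BK ring_eps n d (\<lambda>I. ?\<sigma> (v I)))" for v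
    unfolding canonical by (intro S.canonical_iso_vec[OF coordinatized_field_ext_power]) blast+
  have "{\<Delta> \<in> ?J \<rightarrow>\<^sub>E und BK. \<exists>p\<in>C. \<Phi> (field_ext_vec n d (\<lambda>I. p (sorted_list_of_set I))) =
      hull_class BK EB (ext_vec BK ring_eps n d \<Delta>)} = to_blueprint n d ` C" for C :: "(nat list \<Rightarrow> 'k) set"
  proof -
    have "\<Phi> (field_ext_vec n d (\<lambda>I. p (sorted_list_of_set I))) = hull_class BK EB (ext_vec BK ring_eps n d \<Delta>) \<longleftrightarrow>
        \<Delta> = to_blueprint n d p" if \<Delta>: "\<Delta> \<in> ?J \<rightarrow>\<^sub>E und BK" for \<Delta> p
    proof -
      have range: "\<Delta> \<in> ?J \<rightarrow>\<^sub>E range ?\<sigma>" using \<Delta> by (simp add: BK_def ring_mon_def monomial_bp_simps(7))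
      then have "\<Delta> \<in> ?J \<rightarrow> carrier BK" by (auto simp: PiE_iff)
      then have "\<Phi> (field_ext_vec n d (\<lambda>I. p (sorted_list_of_set I))) = hull_class BK EB (ext_vec BK ring_eps n d \<Delta>) \<longleftrightarrow>
          (\<forall>I\<in>?J. p (sorted_list_of_set I) = class_sum (\<Delta> I))"
        unfolding \<Phi> hull by (subst S.c_vecE_eq_iff) simp_all
      also have "\<dots> \<longleftrightarrow> (\<forall>I\<in>?J. \<Delta> I = to_blueprint n d p I)"
      proof (intro ball_cong refl)
        fix I assume I: "I \<in> ?J"
        then obtain a where "\<Delta> I = ?\<sigma> a" using range by (auto simp: PiE_iff)
        then show "p (sorted_list_of_set I) = class_sum (\<Delta> I) \<longleftrightarrow> \<Delta> I = to_blueprint n d p I"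
          using I by (auto simp: to_blueprint_def monomial_order.monomial_eq_iff[OF monomial_order_ring])
      qed
      also have "\<dots> \<longleftrightarrow> \<Delta> = to_blueprint n d p"
      proof
        assume "\<forall>I\<in>?J. \<Delta> I = to_blueprint n d p I"
        moreover have "to_blueprint n d p \<in> ?J \<rightarrow>\<^sub>E range ?\<sigma>" by (simp add: to_blueprint_def)
        ultimately show "\<Delta> = to_blueprint n d p" by (intro PiE_ext[OF range]) blast+
      qed simp
      finally show ?thesis .
    qed
    moreover have "to_blueprint n d p \<in> ?J \<rightarrow>\<^sub>E und BK" for p
      by (simp add: to_blueprint_def BK_def ring_mon_def monomial_bp_simps(7))
    ultimately show ?thesis by blast
  qed
  then show "bij_betw (\<lambda>C. {\<Delta> \<in> ?J \<rightarrow>\<^sub>E und BK. \<exists>p\<in>C.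
      \<Phi> (field_ext_vec n d (\<lambda>I. p (sorted_list_of_set I))) = hull_class BK EB (ext_vec BK ring_eps n d \<Delta>)})
      (field_matroids n d) (matroids BK ring_eps n d)"
    using bij_betw_field_matroids[of n d] unfolding BK_def by simp
qed

text \<open>The canonical isomorphism matches the tropical vector with coordinates \<open>v\<close> and the class of the vector
  with coordinates \<open>1.v\<^sub>I\<close>, so its inverse undoes the passage to monomials.\<close>

lemma canonical_tropical_vectors:
  fixes n d :: nat
  defines "BS \<equiv> semifield_mon :: 's::idempotent_semifield multiset set blueprint"
  defines "EB \<equiv> ext_power BS semifield_eps n d"
  defines "canonical \<equiv> \<lambda>\<Phi>. semilinear_iso (monomial semifield_rels) (trop_ext_power n d) (mod_idem BS EB) \<Phi> \<and>
            (\<forall>I\<in>d_subsets n d.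
              \<Phi> (trop_ext_basis n I) = idem_class BS EB (ext_basis BS semifield_eps n I))"
  shows "\<exists>\<Phi>. canonical \<Phi>"
    and "canonical \<Phi> \<Longrightarrow> bij_betw
             (\<lambda>\<Delta>. inv_into (carrier (trop_ext_power n d)) \<Phi>
                (idem_class BS EB (ext_vec BS semifield_eps n d \<Delta>)))
             (gp_functions BS semifield_eps n d) (trop_pluecker_vectors n d)"
proof -
  let ?J = "d_subsets n d" and ?\<sigma> = "monomial semifield_rels :: 's \<Rightarrow> 's multiset set"
  let ?N = "trop_ext_power n d :: ('s, ('s, nat \<Rightarrow> 's) tensor set set) bmodule"
  interpret S: scalar_quotient BS class_sum ?\<sigma> "\<lambda>a b. a + b = b" EB ?J "ext_vec BS semifield_eps n d"
    "{(x, y). y = x \<oplus>\<^bsub>EB\<^esub> x \<or> x = y \<oplus>\<^bsub>EB\<^esub> y}"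
    unfolding EB_def BS_def by (rule scalar_quotient_idem)
  interpret M: coordinatized discrete_bp ?N ?J "trop_ext_vec n d" by (rule coordinatized_trop_ext_power)
  have idem: "mod_idem BS EB = S.Q" "idem_class BS EB = S.c"
    by (simp_all add: mod_idem_def idem_class_def idem_le_def fun_eq_iff)
  have basis: "ext_basis BS semifield_eps n I = ext_vec BS semifield_eps n d (\<lambda>K. if K = I then \<one>\<^bsub>BS\<^esub> else \<zero>\<^bsub>BS\<^esub>)"
    if "I \<in> ?J" for I
  proof -
    have "?\<sigma> 1 \<otimes>\<^bsub>monomial_bp semifield_rels\<^esub> ?\<sigma> 1 = \<one>\<^bsub>monomial_bp semifield_rels\<^esub>"
      by (simp only: monomial_mult mult_1_left) (rule monomial_one)
    from ext_basis_eq_vec[OF ordered_blueprint_monomial_bp _ this that] show ?thesis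
      unfolding BS_def semifield_mon_def semifield_eps_def by (simp add: monomial_bp_simps(7))
  qed
  have canonical: "canonical \<Phi> \<longleftrightarrow> semilinear_iso ?\<sigma> ?N S.Q \<Phi> \<and>
      (\<forall>I\<in>?J. \<Phi> (trop_ext_vec n d (\<lambda>K. if K = I then 1 else 0)) =
         S.c (ext_vec BS semifield_eps n d (\<lambda>K. if K = I then \<one>\<^bsub>BS\<^esub> else \<zero>\<^bsub>BS\<^esub>)))" for \<Phi>
    unfolding canonical_def idem by (simp add: basis trop_ext_basis_eq_vec del: bmod_quot_simps)
  show "\<exists>\<Phi>. canonical \<Phi>"
    unfolding canonical by (rule S.canonical_iso_exists[OF coordinatized_trop_ext_power])
  assume can: "canonical \<Phi>"
  then have \<Phi>: "\<Phi> (trop_ext_vec n d v) = S.c (ext_vec BS semifield_eps n d (\<lambda>I. ?\<sigma> (v I)))" for v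
    unfolding canonical by (intro S.canonical_iso_vec[OF coordinatized_trop_ext_power]) blast+
  from can have inj: "inj_on \<Phi> (carrier ?N)"
    unfolding canonical semilinear_iso_def bij_betw_def by blast
  let ?G = "\<lambda>\<Delta>. inv_into (carrier ?N) \<Phi> (idem_class BS EB (ext_vec BS semifield_eps n d \<Delta>))"
  let ?D = "\<lambda>v. \<lambda>I\<in>?J. ?\<sigma> (v I)"
  have G: "?G (?D v) = trop_ext_vec n d v" for v
  proof -
    have "ext_vec BS semifield_eps n d (?D v) = ext_vec BS semifield_eps n d (\<lambda>I. ?\<sigma> (v I))"
      by (rule S.E.vec_cong) auto
    then have "idem_class BS EB (ext_vec BS semifield_eps n d (?D v)) = \<Phi> (trop_ext_vec n d v)"
      unfolding idem \<Phi> by simp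
    then show ?thesis using inv_into_f_f[OF inj, of "trop_ext_vec n d v"] by (simp add: M.carrier_N)
  qed
  have gp: "\<exists>v. \<Delta> = ?D v" if "\<Delta> \<in> gp_functions BS semifield_eps n d" for \<Delta>
  proof -
    have range: "\<Delta> \<in> ?J \<rightarrow>\<^sub>E range ?\<sigma>"
      using that by (simp add: gp_functions_def BS_def semifield_mon_def monomial_bp_simps(7))
    then have "\<forall>I. \<exists>a. I \<in> ?J \<longrightarrow> \<Delta> I = ?\<sigma> a" by (auto simp: PiE_iff)
    then obtain v where v: "\<And>I. I \<in> ?J \<Longrightarrow> \<Delta> I = ?\<sigma> (v I)" by metis
    have "\<Delta> = ?D v"
    proof
      fix I show "\<Delta> I = ?D v I" using v[of I] PiE_arb[OF range, of I] by (cases "I \<in> ?J") simp_all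
    qed
    then show ?thesis by blast
  qed
  have iff: "?D v \<in> gp_functions BS semifield_eps n d \<longleftrightarrow> trop_ext_vec n d v \<in> trop_pluecker_vectors n d" for v
    unfolding BS_def by (rule gp_functions_semifield_iff)
  show "bij_betw ?G (gp_functions BS semifield_eps n d) (trop_pluecker_vectors n d)"
    unfolding bij_betw_def
  proof
    show "inj_on ?G (gp_functions BS semifield_eps n d)"
    proof (rule inj_onI)
      fix \<Delta> \<Delta>' assume *: "\<Delta> \<in> gp_functions BS semifield_eps n d" "\<Delta>' \<in> gp_functions BS semifield_eps n d" "?G \<Delta> = ?G \<Delta>'"
      then obtain v w where D: "\<Delta> = ?D v" "\<Delta>' = ?D w" using gp by blast
      have "trop_ext_vec n d v = trop_ext_vec n d w" using *(3) unfolding D G .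
      then have "\<forall>I\<in>?J. v I = w I" by (subst (asm) M.vec_eq_iff) auto
      then show "\<Delta> = \<Delta>'" unfolding D by (intro restrict_ext) simp
    qed
    show "?G ` gp_functions BS semifield_eps n d = trop_pluecker_vectors n d"
    proof (intro equalityI subsetI)
      fix w assume "w \<in> ?G ` gp_functions BS semifield_eps n d"
      then obtain \<Delta> where \<Delta>: "\<Delta> \<in> gp_functions BS semifield_eps n d" "w = ?G \<Delta>" by blast
      then obtain v where "\<Delta> = ?D v" using gp by blast
      then show "w \<in> trop_pluecker_vectors n d" using \<Delta> G[of v] iff[of v] by simp
    next
      fix w :: "('s, nat \<Rightarrow> 's) tensor set set"
      assume w: "w \<in> trop_pluecker_vectors n d"
      then obtain v where "w = trop_ext_vec n d v" unfolding trop_pluecker_vectors_def by blast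
      then show "w \<in> ?G ` gp_functions BS semifield_eps n d" using w G[of v] iff[of v] by (metis image_eqI)
    qed
  qed
qed

theorem theoremC:
  fixes d n :: nat and B :: "'b blueprint" and \<epsilon> :: 'b
  assumes "d \<le> n"
  shows
    "(let BK = (ring_mon :: 'k::field multiset set blueprint);
          EB = ext_power BK ring_eps n d;
          canonical = (\<lambda>\<Phi>. semilinear_iso (monomial ring_rels) (field_ext_power n d) (mod_hull BK EB) \<Phi> \<and>
            (\<forall>I\<in>d_subsets n d.
              \<Phi> (field_ext_basis n I) = hull_class BK EB (ext_basis BK ring_eps n I)))
      in (\<exists>\<Phi>. canonical \<Phi>) \<and>
         (\<forall>\<Phi>. canonical \<Phi> \<longrightarrow>
           bij_betw
             (\<lambda>C. {\<Delta> \<in> d_subsets n d \<rightarrow>\<^sub>E und BK. \<exists>p\<in>C.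
                \<Phi> (field_ext_vec n d (\<lambda>I. p (sorted_list_of_set I))) =
                hull_class BK EB (ext_vec BK ring_eps n d \<Delta>)})
             (field_matroids n d) (matroids BK ring_eps n d)))
     \<and>
     (let BS = (semifield_mon :: 's::idempotent_semifield multiset set blueprint);
          EB = ext_power BS semifield_eps n d;
          canonical = (\<lambda>\<Phi>. semilinear_iso (monomial semifield_rels) (trop_ext_power n d) (mod_idem BS EB) \<Phi> \<and>
            (\<forall>I\<in>d_subsets n d.
              \<Phi> (trop_ext_basis n I) = idem_class BS EB (ext_basis BS semifield_eps n I)))
      in (\<exists>\<Phi>. canonical \<Phi>) \<and>
         (\<forall>\<Phi>. canonical \<Phi> \<longrightarrow>
           bij_betw
             (\<lambda>\<Delta>. inv_into (carrier (trop_ext_power n d)) \<Phi>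
                (idem_class BS EB (ext_vec BS semifield_eps n d \<Delta>)))
             (gp_functions BS semifield_eps n d) (trop_pluecker_vectors n d)))
     \<and>
     (f1pm_algebra B \<epsilon> \<longrightarrow>
       bij_betw (\<lambda>C. ext_vec B \<epsilon> n d ` C)
         (matroids B \<epsilon> n d)
         (pluecker_class B \<epsilon> n d ` pluecker_vectors B \<epsilon> n d))"
  unfolding Let_def
  by (intro conjI;
      (rule canonical_field_matroids(1) canonical_tropical_vectors(1)
       | (intro allI impI, erule canonical_field_matroids(2) canonical_tropical_vectors(2))
       | (rule impI, erule bij_betw_matroids_pluecker_classes)))

end
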